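(* Let $\mathcal{H}=\mathcal{H}_1\oplus\mathcal{H}_2$ be a nontrivial orthogonal decomposition of a complex Hilbert space and suppose $T=\begin{bmatrix} V & E\\ 0 & Q\end{bmatrix}\in\mathcal{Q}_{\mathcal{H}_1,\mathcal{H}_2}$. Then the following conditions are equivalent: (i) $T$ is a quasi-Brownian isometry; (ii) $T$ is a $2$-isometry; (iii) $(|Q|^2-I)(|Q|^2+|E|^2-I)=0$; (iv) $\sigma(|Q|,|E|)\subseteq\mathbb{T}_+\cup(\{1\}\times\mathbb{R}_+)$; (v) there exists an orthogonal decomposition $\mathcal{H}_2=\mathcal{H}_{\mathrm{i}}\oplus\mathcal{H}_{\mathrm{si}}$ (zero summands are allowed) such that (a) $\mathcal{H}_{\mathrm{i}}$ and $\mathcal{H}_{\mathrm{si}}$ reduce both $Q$ and $|E|$, (b) $Q|_{\mathcal{H}_{\mathrm{i}}}$ is an isometry and $\big(Q|_{\mathcal{H}_{\mathrm{si}}},|E||_{\mathcal{H}_{\mathrm{si}}}\big)$ is a spherical isometry. Moreover, if $\mathcal{H}_{\mathrm{i}}$ and $\mathcal{H}_{\mathrm{si}}$ are as in (v) and $\mathcal{H}_{\mathrm{i}}=\mathcal{H}_{\mathrm{u}}\oplus\mathcal{H}_{\mathrm{s}}$ is the von Neumann-Wold decomposition of $\mathcal{H}_{\mathrm{i}}$ for $Q|_{\mathcal{H}_{\mathrm{i}}}$, then $\mathcal{H}_{\mathrm{u}}$ and $\mathcal{H}_{\mathrm{s}}$ reduce both $Q$ and $|E|$, $Q|_{\mathcal{H}_{\mathrm{u}}}$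 is a unitary operator and $Q|_{\mathcal{H}_{\mathrm{s}}}$ is a unilateral shift (of finite or infinite multiplicity).
   Context: $B(\mathcal{H},\mathcal{K})$ denotes the bounded linear operators between complex Hilbert spaces, $B(\mathcal{H})=B(\mathcal{H},\mathcal{H})$; $\mathscr{N}(T)$ is the kernel of $T$; $|T|=(T^*T)^{1/2}$. Class $\mathcal{Q}$: an orthogonal decomposition $\mathcal{H}=\mathcal{H}_1\oplus\mathcal{H}_2$ is nontrivial if $\mathcal{H}_1\neq\{0\}$ and $\mathcal{H}_2\neq\{0\}$. For such a decomposition, $T=\begin{bmatrix} V & E\\ 0 & Q\end{bmatrix}\in\mathcal{Q}_{\mathcal{H}_1,\mathcal{H}_2}$ means that $T\in B(\mathcal{H})$ has this block form with $V\in B(\mathcal{H}_1)$, $E\in B(\mathcal{H}_2,\mathcal{H}_1)$, $Q\in B(\mathcal{H}_2)$ satisfying $V^*V=I$, $V^*E=0$, $QE^*E=E^*EQ$, and $Q$ is quasinormal, i.e. $QQ^*Q=Q^*QQ$. Then $|Q|$ and $|E|$ are commuting positive operators and $Q$ commutes with $|E|$; $\sigma(|Q|,|E|)$ denotes the Taylor spectrum of $(|Q|,|E|)$. $T\in B(\mathcal{H})$ is a $2$-isometry if $T^{*2}T^2-2T^*T+I=0$. With $\triangle_T=T^*T-I$, $T$ is $\triangle_T$-regular if $\triangle_T\geqslant0$ and $\triangle_TT=\triangle_T^{1/2}T\triangle_T^{1/2}$. A quasi-Brownian isometry is a $\triangle_T$-regular $2$-isometry. A pair $(T_1,T_2)$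 of commuting operators is a spherical isometry if $T_1^*T_1+T_2^*T_2=I$. For an isometry $W$ on $\mathcal{K}$, the von Neumann-Wold decomposition of $\mathcal{K}$ for $W$ is $\mathcal{K}=\mathcal{K}_1\oplus\mathcal{K}_2$ with $\mathcal{K}_1=\bigcap_{n=0}^\infty W^n(\mathcal{K})$ and $\mathcal{K}_2=\bigoplus_{n=0}^\infty W^n\mathscr{N}(W^* )$; $\mathcal{K}_1$ reduces $W$ to a unitary operator and $\mathcal{K}_2$ reduces $W$ to a unilateral shift of multiplicity $\dim\mathscr{N}(W^* )$. $\mathbb{R}_+=[0,\infty)$ and $\mathbb{T}_+=\{(s,t)\in\mathbb{R}_+^2: s^2+t^2=1\}$. *)

theory Defs
  imports "HOL-Analysis.Analysis"
begin

section \<open>Complex Hilbert spaces\<close>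

text \<open>The inner product is linear in its first argument. The unit law for \<open>scaleC\<close>, positivity
  and definiteness of \<open>cinner\<close> follow from \<open>scaleR_scaleC\<close> and \<open>cinner_norm\<close>.\<close>

class complex_hilbert = banach +
  fixes scaleC :: "complex \<Rightarrow> 'a \<Rightarrow> 'a" (infixr "*\<^sub>C" 75)
    and cinner :: "'a \<Rightarrow> 'a \<Rightarrow> complex"
  assumes scaleC_add_right: "c *\<^sub>C (x + y) = c *\<^sub>C x + c *\<^sub>C y"
    and scaleC_add_left: "(c + d) *\<^sub>C x = c *\<^sub>C x + d *\<^sub>C x"
    and scaleC_scaleC: "c *\<^sub>C d *\<^sub>C x = (c * d) *\<^sub>C x"
    and scaleR_scaleC: "r *\<^sub>R x = complex_of_real r *\<^sub>C x"
    and cinner_commute: "cinner x y = cnj (cinner y x)"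
    and cinner_add_left: "cinner (x + y) z = cinner x z + cinner y z"
    and cinner_scaleC_left: "cinner (c *\<^sub>C x) y = c * cinner x y"
    and cinner_norm: "cinner x x = complex_of_real ((norm x)\<^sup>2)"

instantiation complex :: complex_hilbert
begin

definition scaleC_complex :: "complex \<Rightarrow> complex \<Rightarrow> complex" where
  "scaleC_complex c x = c * x"

definition cinner_complex :: "complex \<Rightarrow> complex \<Rightarrow> complex" where
  "cinner_complex x y = x * cnj y"

instance
  by standard
    (simp_all add: scaleC_complex_def cinner_complex_def algebra_simps scaleR_conv_of_real
      complex_norm_square[symmetric])

end

definition closed_csubspace :: "'a::complex_hilbert set \<Rightarrow> bool" where
  "closed_csubspace S \<longleftrightarrow> closed S \<and> 0 \<in> S \<and> (\<forall>x\<in>S. \<forall>y\<in>S. x + y \<in> S) \<and> (\<forall>c. \<forall>x\<in>S. c *\<^sub>C x \<in> S)"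

definition orth_decomp :: "'a::complex_hilbert set \<Rightarrow> 'a set \<Rightarrow> 'a set \<Rightarrow> bool" where
  "orth_decomp S S1 S2 \<longleftrightarrow>
     closed_csubspace S1 \<and> closed_csubspace S2 \<and> (\<forall>x\<in>S1. \<forall>y\<in>S2. cinner x y = 0) \<and>
     S = {x + y | x y. x \<in> S1 \<and> y \<in> S2}"

definition orth_minus :: "'a::complex_hilbert set \<Rightarrow> 'a set \<Rightarrow> 'a set" where
  "orth_minus S M = {x \<in> S. \<forall>y\<in>M. cinner x y = 0}"


section \<open>Operators between closed subspaces\<close>

text \<open>An operator on a closed subspace \<open>S\<close> is a function on the ambient type of which only the values
  on \<open>S\<close> matter; identities between such operators are stated pointwise on \<open>S\<close>. In particular,
  the restriction of an operator on \<open>S\<close> to an invariant subspace \<open>M\<close> is the same function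
  regarded as an operator on \<open>M\<close>; its adjoint is then \<open>adj_on M\<close>, not \<open>adj_on S\<close>.\<close>

definition bounded_op :: "'a::complex_hilbert set \<Rightarrow> 'a set \<Rightarrow> ('a \<Rightarrow> 'a) \<Rightarrow> bool" where
  "bounded_op S S' A \<longleftrightarrow>
     (\<forall>x\<in>S. A x \<in> S') \<and> (\<forall>x\<in>S. \<forall>y\<in>S. A (x + y) = A x + A y) \<and>
     (\<forall>c. \<forall>x\<in>S. A (c *\<^sub>C x) = c *\<^sub>C A x) \<and> (\<exists>K. \<forall>x\<in>S. norm (A x) \<le> K * norm x)"

text \<open>For \<open>A\<close> from \<open>S\<close> to \<open>S'\<close> and \<open>y\<close> in \<open>S'\<close> this is the value at \<open>y\<close> of the Hilbert space
  adjoint, an operator from \<open>S'\<close> to \<open>S\<close>; \<open>S'\<close> does not enter the formula.\<close>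

definition adj_on :: "'a::complex_hilbert set \<Rightarrow> ('a \<Rightarrow> 'a) \<Rightarrow> 'a \<Rightarrow> 'a" where
  "adj_on S A y = (THE x. x \<in> S \<and> (\<forall>z\<in>S. cinner (A z) y = cinner z x))"

definition positive_op :: "'a::complex_hilbert set \<Rightarrow> ('a \<Rightarrow> 'a) \<Rightarrow> bool" where
  "positive_op S A \<longleftrightarrow> bounded_op S S A \<and> (\<forall>x\<in>S. cinner (A x) x \<in> \<real>\<^sub>\<ge>\<^sub>0)"

text \<open>The positive square root of a positive operator; the value 0 outside \<open>S\<close> only serves to make
  the function unique.\<close>

definition sqrt_on :: "'a::complex_hilbert set \<Rightarrow> ('a \<Rightarrow> 'a) \<Rightarrow> 'a \<Rightarrow> 'a" where
  "sqrt_on S A =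
     (THE R. positive_op S R \<and> (\<forall>x\<in>S. R (R x) = A x) \<and> (\<forall>x. x \<notin> S \<longrightarrow> R x = 0))"

definition abs_on :: "'a::complex_hilbert set \<Rightarrow> ('a \<Rightarrow> 'a) \<Rightarrow> 'a \<Rightarrow> 'a" where
  "abs_on S A = sqrt_on S (\<lambda>x. adj_on S A (A x))"

definition reduces :: "'a::complex_hilbert set \<Rightarrow> 'a set \<Rightarrow> ('a \<Rightarrow> 'a) \<Rightarrow> bool" where
  "reduces S M A \<longleftrightarrow> closed_csubspace M \<and> M \<subseteq> S \<and> A ` M \<subseteq> M \<and> A ` orth_minus S M \<subseteq> orth_minus S M"

definition isometry_on :: "'a::complex_hilbert set \<Rightarrow> ('a \<Rightarrow> 'a) \<Rightarrow> bool" where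
  "isometry_on S W \<longleftrightarrow> bounded_op S S W \<and> (\<forall>x\<in>S. adj_on S W (W x) = x)"

definition unitary_on :: "'a::complex_hilbert set \<Rightarrow> ('a \<Rightarrow> 'a) \<Rightarrow> bool" where
  "unitary_on S W \<longleftrightarrow> isometry_on S W \<and> (\<forall>x\<in>S. W (adj_on S W x) = x)"

definition quasinormal_on :: "'a::complex_hilbert set \<Rightarrow> ('a \<Rightarrow> 'a) \<Rightarrow> bool" where
  "quasinormal_on S A \<longleftrightarrow>
     bounded_op S S A \<and> (\<forall>x\<in>S. A (adj_on S A (A x)) = adj_on S A (A (A x)))"

definition spherical_isometry_on ::
    "'a::complex_hilbert set \<Rightarrow> ('a \<Rightarrow> 'a) \<Rightarrow> ('a \<Rightarrow> 'a) \<Rightarrow> bool" where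
  "spherical_isometry_on S A B \<longleftrightarrow>
     bounded_op S S A \<and> bounded_op S S B \<and> (\<forall>x\<in>S. A (B x) = B (A x)) \<and>
     (\<forall>x\<in>S. adj_on S A (A x) + adj_on S B (B x) = x)"

definition two_isometry_on :: "'a::complex_hilbert set \<Rightarrow> ('a \<Rightarrow> 'a) \<Rightarrow> bool" where
  "two_isometry_on S T \<longleftrightarrow> bounded_op S S T \<and>
     (\<forall>x\<in>S. adj_on S T (adj_on S T (T (T x))) - 2 *\<^sub>R adj_on S T (T x) + x = 0)"

definition triangle_on :: "'a::complex_hilbert set \<Rightarrow> ('a \<Rightarrow> 'a) \<Rightarrow> 'a \<Rightarrow> 'a" where
  "triangle_on S T x = adj_on S T (T x) - x"

definition triangle_regular_on :: "'a::complex_hilbert set \<Rightarrow> ('a \<Rightarrow> 'a) \<Rightarrow> bool" where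
  "triangle_regular_on S T \<longleftrightarrow> bounded_op S S T \<and> positive_op S (triangle_on S T) \<and>
     (\<forall>x\<in>S. triangle_on S T (T x) =
        sqrt_on S (triangle_on S T) (T (sqrt_on S (triangle_on S T) x)))"

definition quasi_brownian_isometry_on :: "'a::complex_hilbert set \<Rightarrow> ('a \<Rightarrow> 'a) \<Rightarrow> bool" where
  "quasi_brownian_isometry_on S T \<longleftrightarrow> triangle_regular_on S T \<and> two_isometry_on S T"


section \<open>Taylor spectrum of a commuting pair\<close>

text \<open>The Koszul complex of a commuting pair \<open>(A, B)\<close> on \<open>S\<close> is
  \<open>0 \<rightarrow> S \<rightarrow> S \<times> S \<rightarrow> S \<rightarrow> 0\<close> with the two maps below. A pair of complex numbers is in the
  Taylor spectrum iff the complex of the correspondingly translated pair is not exact.\<close>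

definition koszul0 :: "('a \<Rightarrow> 'a) \<Rightarrow> ('a \<Rightarrow> 'a) \<Rightarrow> 'a \<Rightarrow> 'a \<times> 'a" where
  "koszul0 A B x = (A x, B x)"

definition koszul1 :: "('a \<Rightarrow> 'a) \<Rightarrow> ('a \<Rightarrow> 'a) \<Rightarrow> 'a \<times> 'a \<Rightarrow> 'a::complex_hilbert" where
  "koszul1 A B p = A (snd p) - B (fst p)"

definition koszul_exact :: "'a::complex_hilbert set \<Rightarrow> ('a \<Rightarrow> 'a) \<Rightarrow> ('a \<Rightarrow> 'a) \<Rightarrow> bool" where
  "koszul_exact S A B \<longleftrightarrow>
     {x \<in> S. koszul0 A B x = (0, 0)} = {0} \<and>
     {p \<in> S \<times> S. koszul1 A B p = 0} = koszul0 A B ` S \<and>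
     koszul1 A B ` (S \<times> S) = S"

definition taylor_spectrum ::
    "'a::complex_hilbert set \<Rightarrow> ('a \<Rightarrow> 'a) \<Rightarrow> ('a \<Rightarrow> 'a) \<Rightarrow> (complex \<times> complex) set" where
  "taylor_spectrum S A B =
     {(l, m). \<not> koszul_exact S (\<lambda>x. A x - l *\<^sub>C x) (\<lambda>x. B x - m *\<^sub>C x)}"

definition T_plus :: "(real \<times> real) set" where
  "T_plus = {(s, t). 0 \<le> s \<and> 0 \<le> t \<and> s\<^sup>2 + t\<^sup>2 = 1}"


section \<open>Von Neumann-Wold decomposition\<close>

text \<open>This is the Hilbert space direct sum when the subspaces are closed and pairwise orthogonal.\<close>

definition hilbert_sum :: "(nat \<Rightarrow> 'a::complex_hilbert set) \<Rightarrow> 'a set" where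
  "hilbert_sum M = {x. \<exists>f. (\<forall>n. f n \<in> M n) \<and> f sums x}"

definition ker_adj_on :: "'a::complex_hilbert set \<Rightarrow> ('a \<Rightarrow> 'a) \<Rightarrow> 'a set" where
  "ker_adj_on S W = {x \<in> S. adj_on S W x = 0}"

definition wold_unitary_part :: "'a::complex_hilbert set \<Rightarrow> ('a \<Rightarrow> 'a) \<Rightarrow> 'a set" where
  "wold_unitary_part S W = (\<Inter>n. (W ^^ n) ` S)"

definition wold_shift_part :: "'a::complex_hilbert set \<Rightarrow> ('a \<Rightarrow> 'a) \<Rightarrow> 'a set" where
  "wold_shift_part S W = hilbert_sum (\<lambda>n. (W ^^ n) ` ker_adj_on S W)"

text \<open>A unilateral shift is an isometry with a wandering subspace \<open>L\<close> that generates \<open>S\<close>; its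
  multiplicity is the dimension of \<open>L\<close>, which is not restricted (\<open>S = {0}\<close> has multiplicity 0).\<close>

definition unilateral_shift_on :: "'a::complex_hilbert set \<Rightarrow> ('a \<Rightarrow> 'a) \<Rightarrow> bool" where
  "unilateral_shift_on S W \<longleftrightarrow> isometry_on S W \<and>
     (\<exists>L. closed_csubspace L \<and> L \<subseteq> S \<and>
        (\<forall>m n. m \<noteq> n \<longrightarrow> (\<forall>x\<in>(W ^^ m) ` L. \<forall>y\<in>(W ^^ n) ` L. cinner x y = 0)) \<and>
        S = hilbert_sum (\<lambda>n. (W ^^ n) ` L))"


section \<open>The class of block operators\<close>

text \<open>\<open>T\<close> has the upper triangular block matrix with first row \<open>V, E\<close> and second row \<open>0, Q\<close> with
  respect to the orthogonal decomposition of the whole space into \<open>H1\<close> and \<open>H2\<close>.\<close>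

definition class_Q :: "'a::complex_hilbert set \<Rightarrow> 'a set \<Rightarrow>
    ('a \<Rightarrow> 'a) \<Rightarrow> ('a \<Rightarrow> 'a) \<Rightarrow> ('a \<Rightarrow> 'a) \<Rightarrow> ('a \<Rightarrow> 'a) \<Rightarrow> bool" where
  "class_Q H1 H2 T V E Q \<longleftrightarrow>
     bounded_op UNIV UNIV T \<and> bounded_op H1 H1 V \<and> bounded_op H2 H1 E \<and> bounded_op H2 H2 Q \<and>
     (\<forall>x\<in>H1. \<forall>y\<in>H2. T (x + y) = (V x + E y) + Q y) \<and>
     (\<forall>x\<in>H1. adj_on H1 V (V x) = x) \<and>
     (\<forall>y\<in>H2. adj_on H1 V (E y) = 0) \<and>
     (\<forall>y\<in>H2. Q (adj_on H2 E (E y)) = adj_on H2 E (E (Q y))) \<and>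
     quasinormal_on H2 Q"

text \<open>Used with \<open>P\<close> the modulus of \<open>E\<close>.\<close>

definition isometry_spherical_decomp :: "'a::complex_hilbert set \<Rightarrow> ('a \<Rightarrow> 'a) \<Rightarrow> ('a \<Rightarrow> 'a) \<Rightarrow>
    'a set \<Rightarrow> 'a set \<Rightarrow> bool" where
  "isometry_spherical_decomp H2 Q P Hi Hsi \<longleftrightarrow>
     orth_decomp H2 Hi Hsi \<and>
     reduces H2 Hi Q \<and> reduces H2 Hi P \<and> reduces H2 Hsi Q \<and> reduces H2 Hsi P \<and>
     isometry_on Hi Q \<and> spherical_isometry_on Hsi Q P"

end

(* With R = |Q|^2, S = |E|^2 and D = R + S - I one has T*T - I = 0 (+) D, and Q commutes with D, so
   that T*^2 T^2 - 2 T*T + I = 0 (+) (R - I) D. Hence T is a 2-isometry iff (R - I) D = 0; in that case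
   D^2 = S D forces D >= 0, and the square root of D commutes with Q, which gives regularity. The
   decomposition in (v) is H_i = ker (R - I) and its orthogonal complement, on which D vanishes.

   For (iv), a pair of commuting selfadjoint operators has an exact Koszul complex at (l, m) if
   |A - l|^2 + |B - m|^2 is bounded below, and, for real l and m, only if (uniform boundedness). If
   G = (R - I) D is nonzero, the approximate eigenvectors of G^2 at its norm can be refined one
   operator at a time to joint approximate eigenvectors of |Q| and |E| as well, which produces a point
   of the Taylor spectrum at which (s^2 - 1) (s^2 + t^2 - 1) does not vanish. *)

theory Submission imports Defs begin

section \<open>Inner products and orthogonal projections\<close>

text \<open>No joint spectral measure of |Q| and |E| is constructed. Its role is taken by two facts:
  a positive operator has a positive square root that commutes with whatever commutes with the
  operator, and therefore the product of two commuting positive operators is positive. The second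
  fact turns the refinement of approximate eigenvectors into inequalities between quadratic forms.

  The relation D^2 = S D comes from D = (R - I) + S. It forces D >= 0 because the forms of D and S
  agree on the orthogonal complement of the kernel of D.

  The two directions of the exactness criterion differ in nature. A lower bound inverts |A - l|^2 +
  |B - m|^2, and the inverse contracts the complex. Exactness in turn only says that every vector is
  of the form A z - B y for the shifted operators, and a quantitative bound has to be extracted from
  it.

  Adjoints depend on the subspace on which an operator is considered. Passing to a summand therefore
  always goes through reducing subspaces, where the adjoint of the restriction is the restriction of
  the adjoint.\<close>

lemma scaleC_one [simp]: "(1::complex) *\<^sub>C (x::'a::complex_hilbert) = x"
  using scaleR_scaleC[of 1 x] by simp

lemma scaleC_zero_left [simp]: "0 *\<^sub>C (x::'a::complex_hilbert) = 0"
  using scaleR_scaleC[of 0 x] by simp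

lemma scaleC_zero_right [simp]: "c *\<^sub>C (0::'a::complex_hilbert) = 0"
  using scaleC_scaleC[of c 0 0] by simp

lemma scaleC_minus1: "(-1) *\<^sub>C (x::'a::complex_hilbert) = - x"
  using scaleR_scaleC[of "-1" x] by simp

lemma scaleC_minus_right [simp]: "c *\<^sub>C (- x) = - (c *\<^sub>C (x::'a::complex_hilbert))"
  using scaleC_scaleC[of c "-1" x] scaleC_scaleC[of "-1" c x] by (simp add: scaleC_minus1)

lemma scaleC_diff_right: "c *\<^sub>C (x - y) = c *\<^sub>C x - c *\<^sub>C (y::'a::complex_hilbert)"
  using scaleC_add_right[of c x "- y"] by simp

lemma scaleC_diff_left: "(c - d) *\<^sub>C (x::'a::complex_hilbert) = c *\<^sub>C x - d *\<^sub>C x"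
  using scaleC_add_left[of "c - d" d x] by simp

lemma cinner_add_right: "cinner x (y + z) = cinner x y + cinner x (z::'a::complex_hilbert)"
  using cinner_commute[of x] cinner_add_left[of y z x] by (metis complex_cnj_add)

lemma cinner_scaleC_right: "cinner x (c *\<^sub>C y) = cnj c * cinner x (y::'a::complex_hilbert)"
  using cinner_commute[of x] cinner_scaleC_left[of c y x] by (metis complex_cnj_mult)

lemma cinner_zero_left [simp]: "cinner 0 (x::'a::complex_hilbert) = 0"
  using cinner_scaleC_left[of 0 0 x] by simp

lemma cinner_zero_right [simp]: "cinner (x::'a::complex_hilbert) 0 = 0"
  using cinner_scaleC_right[of x 0 0] by simp

lemma cinner_minus_left [simp]: "cinner (- x) (y::'a::complex_hilbert) = - cinner x y"
  using cinner_scaleC_left[of "-1" x y] by (simp add: scaleC_minus1)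

lemma cinner_minus_right [simp]: "cinner (x::'a::complex_hilbert) (- y) = - cinner x y"
  using cinner_scaleC_right[of x "-1" y] by (simp add: scaleC_minus1)

lemma cinner_diff_left: "cinner (x - y) (z::'a::complex_hilbert) = cinner x z - cinner y z"
  using cinner_add_left[of x "- y" z] by simp

lemma cinner_diff_right: "cinner (x::'a::complex_hilbert) (y - z) = cinner x y - cinner x z"
  using cinner_add_right[of x y "- z"] by simp

lemmas cinner_simps = cinner_add_left cinner_add_right cinner_diff_left cinner_diff_right
  cinner_scaleC_left cinner_scaleC_right

lemma cinner_scaleR_left: "cinner (r *\<^sub>R x) (y::'a::complex_hilbert) = of_real r * cinner x y"
  by (simp add: scaleR_scaleC cinner_scaleC_left)

lemma cinner_scaleR_right: "cinner (x::'a::complex_hilbert) (r *\<^sub>R y) = of_real r * cinner x y"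
  by (simp add: scaleR_scaleC cinner_scaleC_right)

lemma Re_cinner_self: "Re (cinner x x) = (norm (x::'a::complex_hilbert))\<^sup>2"
  by (simp add: cinner_norm)

lemma cinner_self_eq_0 [simp]: "cinner x x = 0 \<longleftrightarrow> (x::'a::complex_hilbert) = 0"
  by (simp add: cinner_norm)

lemma Re_cinner_commute: "Re (cinner x y) = Re (cinner (y::'a::complex_hilbert) x)"
  using cinner_commute[of x y] by simp

lemma cinner_eq_0_commute: "cinner x y = 0 \<longleftrightarrow> cinner (y::'a::complex_hilbert) x = 0"
  using cinner_commute[of x y] cinner_commute[of y x] by auto

lemma norm_scaleC [simp]: "norm (c *\<^sub>C (x::'a::complex_hilbert)) = cmod c * norm x"
proof -
  have "complex_of_real ((norm (c *\<^sub>C x))\<^sup>2) = c * cnj c * complex_of_real ((norm x)\<^sup>2)"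
    by (simp only: cinner_norm[symmetric] cinner_scaleC_left cinner_scaleC_right mult_ac)
  also have "\<dots> = complex_of_real ((cmod c * norm x)\<^sup>2)"
    by (simp add: complex_norm_square[symmetric] power_mult_distrib)
  finally have "(norm (c *\<^sub>C x))\<^sup>2 = (cmod c * norm x)\<^sup>2"
    using of_real_eq_iff by blast
  then show ?thesis by simp
qed

lemma norm_add_square:
  "(norm (x + y))\<^sup>2 = (norm x)\<^sup>2 + (norm y)\<^sup>2 + 2 * Re (cinner x (y::'a::complex_hilbert))"
  using Re_cinner_commute[of x y]
  by (simp add: Re_cinner_self[symmetric] cinner_add_left cinner_add_right)

lemma norm_diff_square:
  "(norm (x - y))\<^sup>2 = (norm x)\<^sup>2 + (norm y)\<^sup>2 - 2 * Re (cinner x (y::'a::complex_hilbert))"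
  using norm_add_square[of x "- y"] by simp

lemma Cauchy_Schwarz_cinner: "cmod (cinner x y) \<le> norm x * norm (y::'a::complex_hilbert)"
proof (cases "y = 0")
  case False
  \<comment> \<open>\<open>c\<close> times \<open>y\<close> is the orthogonal projection of
    \<open>x\<close> onto the line of \<open>y\<close>; the inequality expresses that the residual
    has nonnegative squared norm.\<close>
  define c where "c = cinner x y / of_real ((norm y)\<^sup>2)"
  have ny: "complex_of_real ((norm y)\<^sup>2) \<noteq> 0" using False by simp
  have "cinner x (c *\<^sub>C y) = of_real ((cmod (cinner x y))\<^sup>2 / (norm y)\<^sup>2)"
    unfolding c_def cinner_scaleC_right using complex_norm_square[of "cinner x y"]
    by (simp add: mult.commute)
  then have "0 \<le> (norm x)\<^sup>2 + (cmod c * norm y)\<^sup>2 - 2 * ((cmod (cinner x y))\<^sup>2 / (norm y)\<^sup>2)"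
    using norm_diff_square[of x "c *\<^sub>C y"] zero_le_power2[of "norm (x - c *\<^sub>C y)"] by simp
  moreover have "(cmod c * norm y)\<^sup>2 = (cmod (cinner x y))\<^sup>2 / (norm y)\<^sup>2"
    using False by (simp add: c_def norm_divide norm_power power_divide power_mult_distrib)
      (simp add: power2_eq_square power4_eq_xxxx)
  ultimately have "(cmod (cinner x y))\<^sup>2 / (norm y)\<^sup>2 \<le> (norm x)\<^sup>2" by simp
  then have "(cmod (cinner x y))\<^sup>2 \<le> (norm x * norm y)\<^sup>2"
    using False by (simp add: field_simps power_mult_distrib)
  then show ?thesis by (rule power2_le_imp_le) simp
qed simp

lemma Re_cinner_le: "\<bar>Re (cinner x y)\<bar> \<le> norm x * norm (y::'a::complex_hilbert)"
  using Cauchy_Schwarz_cinner[of x y] abs_Re_le_cmod[of "cinner x y"] by linarith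

lemma bounded_bilinear_cinner: "bounded_bilinear (cinner :: 'a::complex_hilbert \<Rightarrow> _)"
proof
  show "\<exists>K. \<forall>a b. norm (cinner a (b::'a)) \<le> norm a * norm b * K"
    by (rule exI[of _ 1]) (simp add: Cauchy_Schwarz_cinner)
qed (simp_all add: cinner_add_left cinner_add_right cinner_scaleR_left cinner_scaleR_right
    scaleR_conv_of_real)

lemmas tendsto_cinner = bounded_bilinear.tendsto[OF bounded_bilinear_cinner]

lemma parallelogram:
  "(norm (x + y))\<^sup>2 + (norm (x - y))\<^sup>2 = 2 * (norm x)\<^sup>2 + 2 * (norm (y::'a::complex_hilbert))\<^sup>2"
  by (simp add: norm_add_square norm_diff_square)

section \<open>Closed subspaces and orthogonal projections\<close>

lemma closed_csubspaceD:
  assumes "closed_csubspace S"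
  shows "closed S" "0 \<in> S" "\<And>x y. x \<in> S \<Longrightarrow> y \<in> S \<Longrightarrow> x + y \<in> S"
    "\<And>c x. x \<in> S \<Longrightarrow> c *\<^sub>C x \<in> S" "\<And>x. x \<in> S \<Longrightarrow> - x \<in> S"
    "\<And>x y. x \<in> S \<Longrightarrow> y \<in> S \<Longrightarrow> x - y \<in> S" "\<And>r x. x \<in> S \<Longrightarrow> r *\<^sub>R x \<in> S"
proof -
  show *: "closed S" "0 \<in> S" "\<And>x y. x \<in> S \<Longrightarrow> y \<in> S \<Longrightarrow> x + y \<in> S"
    "\<And>c x. x \<in> S \<Longrightarrow> c *\<^sub>C x \<in> S"
    using assms by (auto simp: closed_csubspace_def)
  show m: "\<And>x. x \<in> S \<Longrightarrow> - x \<in> S" using *(4)[of _ "-1"] by (simp add: scaleC_minus1)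
  show "\<And>x y. x \<in> S \<Longrightarrow> y \<in> S \<Longrightarrow> x - y \<in> S" using *(3)[OF _ m] by simp
  show "\<And>r x. x \<in> S \<Longrightarrow> r *\<^sub>R x \<in> S" using *(4) by (simp add: scaleR_scaleC)
qed

lemma closed_csubspace_UNIV: "closed_csubspace UNIV"
  by (simp add: closed_csubspace_def)

lemma closed_csubspace_INT:
  "(\<And>i. i \<in> I \<Longrightarrow> closed_csubspace (M i)) \<Longrightarrow> closed_csubspace (\<Inter>i\<in>I. M i)"
  by (auto simp: closed_csubspace_def)

lemma closed_csubspace_orth_minus:
  assumes "closed_csubspace S"
  shows "closed_csubspace (orth_minus S M)"
proof -
  have "closed {x. cinner x y = 0}" for y
    by (intro closed_Collect_eq continuous_intros
        linear_continuous_on[OF bounded_bilinear.bounded_linear_left[OF bounded_bilinear_cinner]])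
  then have "closed (S \<inter> (\<Inter>y\<in>M. {x. cinner x y = 0}))"
    using assms by (intro closed_Int closed_INT) (auto simp: closed_csubspace_def)
  moreover have "orth_minus S M = S \<inter> (\<Inter>y\<in>M. {x. cinner x y = 0})"
    by (auto simp: orth_minus_def)
  ultimately show ?thesis
    using assms by (auto simp: closed_csubspace_def orth_minus_def cinner_simps)
qed

text \<open>A minimizing sequence is Cauchy by the parallelogram law, since the midpoint of two of
  its members lies in \<open>S\<close> and so stays at distance at least \<open>d\<close> from
  \<open>x\<close>.\<close>

lemma closest_point_exists:
  assumes S: "closed_csubspace S"
  shows "\<exists>p\<in>S. \<forall>y\<in>S. norm (x - p) \<le> norm (x - (y::'a::complex_hilbert))"
proof -
  note cs = closed_csubspaceD[OF S]
  define d where "d = (INF y\<in>S. norm (x - y))"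
  have bdd: "bdd_below ((\<lambda>y. norm (x - y)) ` S)" by (rule bdd_belowI[of _ 0]) auto
  have d_le: "d \<le> norm (x - y)" if "y \<in> S" for y
    unfolding d_def by (rule cINF_lower[OF bdd that])
  have d0: "0 \<le> d" unfolding d_def using cs(2) by (intro cINF_greatest) auto
  have "\<exists>y\<in>S. norm (x - y) < d + e" if "e > 0" for e
  proof -
    have "(INF y\<in>S. norm (x - y)) < d + e" unfolding d_def[symmetric] using that by simp
    then show ?thesis using cINF_less_iff[OF _ bdd] cs(2) by blast
  qed
  then have "\<forall>n. \<exists>y\<in>S. norm (x - y) < d + inverse (real (Suc n))" by simp
  then obtain y where y: "\<And>n. y n \<in> S" "\<And>n. norm (x - y n) < d + inverse (real (Suc n))"
    by metis
  have lim: "(\<lambda>n. norm (x - y n)) \<longlonglongrightarrow> d"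
  proof (rule tendsto_sandwich[of "\<lambda>_. d"])
    show "(\<lambda>n. d + inverse (real (Suc n))) \<longlonglongrightarrow> d"
      using tendsto_add[OF tendsto_const LIMSEQ_inverse_real_of_nat] by simp
  qed (use d_le y in \<open>auto intro!: always_eventually less_imp_le\<close>)
  have close: "(norm (y m - y n))\<^sup>2 \<le> 2 * (norm (x - y m))\<^sup>2 + 2 * (norm (x - y n))\<^sup>2 - 4 * d\<^sup>2" for m n
  proof -
    have "(1/2) *\<^sub>R (y m + y n) \<in> S" using y cs by simp
    then have "d \<le> norm (x - (1/2) *\<^sub>R (y m + y n))" by (rule d_le)
    also have "x - (1/2) *\<^sub>R (y m + y n) = (1/2) *\<^sub>R ((x - y m) + (x - y n))"
      by (simp add: algebra_simps flip: scaleR_add_left)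
    finally have "2 * d \<le> norm ((x - y m) + (x - y n))" by simp
    then have "(2 * d)\<^sup>2 \<le> (norm ((x - y m) + (x - y n)))\<^sup>2" using d0 by (intro power_mono) auto
    then show ?thesis
      using parallelogram[of "x - y m" "x - y n"] by (simp add: norm_minus_commute power_mult_distrib)
  qed
  have "Cauchy y"
  proof (rule metric_CauchyI)
    fix e :: real assume e: "e > 0"
    have "(\<lambda>n. (norm (x - y n))\<^sup>2) \<longlonglongrightarrow> d\<^sup>2" using lim by (intro tendsto_power)
    then have "\<forall>\<^sub>F n in sequentially. (norm (x - y n))\<^sup>2 < d\<^sup>2 + e\<^sup>2 / 4"
      by (rule order_tendstoD) (use e in simp)
    then obtain N where N: "\<And>n. n \<ge> N \<Longrightarrow> (norm (x - y n))\<^sup>2 < d\<^sup>2 + e\<^sup>2 / 4"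
      unfolding eventually_sequentially by blast
    show "\<exists>M. \<forall>m\<ge>M. \<forall>n\<ge>M. dist (y m) (y n) < e"
    proof (intro exI allI impI)
      fix m n assume "N \<le> m" "N \<le> n"
      then have "(norm (y m - y n))\<^sup>2 < e\<^sup>2" using N[of m] N[of n] close[of m n] by linarith
      then show "dist (y m) (y n) < e"
        unfolding dist_norm by (rule power2_less_imp_less) (use e in simp)
    qed
  qed
  then obtain p where p: "y \<longlonglongrightarrow> p" using Cauchy_convergent_iff convergent_def by blast
  have "p \<in> S" using closed_sequentially[OF cs(1)] y(1) p by blast
  moreover have "norm (x - p) = d"
    using LIMSEQ_unique[OF lim tendsto_norm[OF tendsto_diff[OF tendsto_const p]]] by simp
  ultimately show ?thesis using d_le by blast
qed

text \<open>The closest point works: if \<open>x - p\<close> had a component along some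
  \<open>y\<close> in \<open>S\<close>, moving \<open>p\<close> by that component would bring it
  strictly closer to \<open>x\<close>.\<close>

lemma orthogonal_projection_exists:
  assumes S: "closed_csubspace S"
  obtains p where "p \<in> S" "\<And>y. y \<in> S \<Longrightarrow> cinner (x - p) (y::'a::complex_hilbert) = 0"
proof -
  note cs = closed_csubspaceD[OF S]
  obtain p where p: "p \<in> S" "\<And>y. y \<in> S \<Longrightarrow> norm (x - p) \<le> norm (x - y)"
    using closest_point_exists[OF S] by blast
  have "cinner (x - p) y = 0" if "y \<in> S" for y
  proof (cases "y = 0")
    case False
    define c where "c = cinner (x - p) y / of_real ((norm y)\<^sup>2)"
    have ny: "complex_of_real ((norm y)\<^sup>2) \<noteq> 0" using False by simp
    have "p + c *\<^sub>C y \<in> S" using p that cs by simp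
    then have "norm (x - p) \<le> norm (x - p - c *\<^sub>C y)" using p(2) by (simp add: algebra_simps)
    then have "(norm (x - p))\<^sup>2 \<le> (norm (x - p - c *\<^sub>C y))\<^sup>2" by (intro power_mono) auto
    moreover have "cinner (x - p) (c *\<^sub>C y) = of_real ((cmod (cinner (x - p) y))\<^sup>2 / (norm y)\<^sup>2)"
      unfolding c_def cinner_scaleC_right using complex_norm_square[of "cinner (x - p) y"]
      by (simp add: mult.commute)
    moreover have "(cmod c * norm y)\<^sup>2 = (cmod (cinner (x - p) y))\<^sup>2 / (norm y)\<^sup>2"
      using False by (simp add: c_def norm_divide norm_power power_divide power_mult_distrib)
      (simp add: power2_eq_square power4_eq_xxxx)
    ultimately have "(cmod (cinner (x - p) y))\<^sup>2 / (norm y)\<^sup>2 \<le> 0"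
      using norm_diff_square[of "x - p" "c *\<^sub>C y"] by simp
    then show ?thesis using False by (simp add: divide_le_0_iff)
  qed simp
  then show ?thesis using p(1) that by blast
qed

text \<open>For \<open>x\<close> in the double complement with projection \<open>p\<close> on
  \<open>M\<close>, the residual \<open>x - p\<close> lies in the complement of \<open>M\<close>.
  Hence it is orthogonal to both \<open>x\<close> and \<open>p\<close>, and so to itself.\<close>

lemma orth_minus_orth_minus:
  assumes S: "closed_csubspace S" and M: "closed_csubspace M" "M \<subseteq> S"
  shows "orth_minus S (orth_minus S M) = (M::'a::complex_hilbert set)"
proof
  show "M \<subseteq> orth_minus S (orth_minus S M)"
    using M(2) cinner_eq_0_commute by (fastforce simp: orth_minus_def)
  show "orth_minus S (orth_minus S M) \<subseteq> M"
  proof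
    fix x assume x: "x \<in> orth_minus S (orth_minus S M)"
    obtain p where p: "p \<in> M" "\<And>y. y \<in> M \<Longrightarrow> cinner (x - p) y = 0"
      using orthogonal_projection_exists[OF M(1)] by blast
    have "x - p \<in> orth_minus S M"
      using x p M(2) closed_csubspaceD(6)[OF S] by (auto simp: orth_minus_def)
    then have "cinner x (x - p) = 0" "cinner (x - p) p = 0"
      using x p by (auto simp: orth_minus_def)
    then have "cinner (x - p) (x - p) = 0"
      using cinner_eq_0_commute[of "x - p" p] by (simp add: cinner_diff_left)
    then show "x \<in> M" using p by simp
  qed
qed

lemma orth_decomp_orth_minus:
  assumes S: "closed_csubspace S" and M: "closed_csubspace M" "M \<subseteq> S"
  shows "orth_decomp S M (orth_minus S (M::'a::complex_hilbert set))"
proof -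
  note cs = closed_csubspaceD[OF S]
  have "\<exists>u v. x = u + v \<and> u \<in> M \<and> v \<in> orth_minus S M" if x: "x \<in> S" for x
  proof -
    obtain p where p: "p \<in> M" "\<And>y. y \<in> M \<Longrightarrow> cinner (x - p) y = 0"
      using orthogonal_projection_exists[OF M(1)] by blast
    have "x = p + (x - p) \<and> p \<in> M \<and> x - p \<in> orth_minus S M"
      using p x M(2) cs by (auto simp: orth_minus_def)
    then show ?thesis by blast
  qed
  then have "S = {u + v |u v. u \<in> M \<and> v \<in> orth_minus S M}"
    using M(2) cs(3) by (auto simp: orth_minus_def)
  moreover have "\<forall>x\<in>M. \<forall>y\<in>orth_minus S M. cinner x y = 0"
    using cinner_eq_0_commute by (fastforce simp: orth_minus_def)
  ultimately show ?thesis
    using closed_csubspace_orth_minus[OF S] M(1) unfolding orth_decomp_def by blast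
qed

section \<open>Bounded operators, adjoints and positivity\<close>

lemma bounded_opD:
  assumes "bounded_op S S' A"
  shows "\<And>x. x \<in> S \<Longrightarrow> A x \<in> S'"
    "\<And>x y. x \<in> S \<Longrightarrow> y \<in> S \<Longrightarrow> A (x + y) = A x + A y"
    "\<And>c x. x \<in> S \<Longrightarrow> A (c *\<^sub>C x) = c *\<^sub>C A x"
  using assms by (auto simp: bounded_op_def)

lemma bounded_op_linear:
  assumes "bounded_op S S' A" "closed_csubspace S"
  shows "A 0 = 0" "\<And>x. x \<in> S \<Longrightarrow> A (- x) = - A x"
    "\<And>x y. x \<in> S \<Longrightarrow> y \<in> S \<Longrightarrow> A (x - y) = A x - A y"
    "\<And>r x. x \<in> S \<Longrightarrow> A (r *\<^sub>R x) = r *\<^sub>R A x"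
proof -
  note A = bounded_opD[OF assms(1)] and S = closed_csubspaceD[OF assms(2)]
  show "A 0 = 0" using A(3)[OF S(2), of 0] by simp
  show m: "A (- x) = - A x" if "x \<in> S" for x using A(3)[OF that, of "-1"] by (simp add: scaleC_minus1)
  show "A (x - y) = A x - A y" if "x \<in> S" "y \<in> S" for x y
    using A(2)[OF that(1) S(5)[OF that(2)]] m[OF that(2)] by simp
  show "A (r *\<^sub>R x) = r *\<^sub>R A x" if "x \<in> S" for x r
    using A(3)[OF that] by (simp add: scaleR_scaleC)
qed

lemma bounded_op_bound:
  assumes "bounded_op S S' A"
  obtains K where "K > 0" "\<And>x. x \<in> S \<Longrightarrow> norm (A x) \<le> K * norm x"
proof -
  obtain K where K: "\<And>x. x \<in> S \<Longrightarrow> norm (A x) \<le> K * norm x"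
    using assms unfolding bounded_op_def by blast
  have "norm (A x) \<le> (\<bar>K\<bar> + 1) * norm x" if "x \<in> S" for x
    by (rule order_trans[OF K[OF that]]) (intro mult_right_mono, auto)
  then show ?thesis using that[of "\<bar>K\<bar> + 1"] by simp
qed

lemma bounded_opI:
  assumes "\<And>x. x \<in> S \<Longrightarrow> A x \<in> S'"
    "\<And>x y. x \<in> S \<Longrightarrow> y \<in> S \<Longrightarrow> A (x + y) = A x + A y"
    "\<And>c x. x \<in> S \<Longrightarrow> A (c *\<^sub>C x) = c *\<^sub>C A x"
    "\<And>x. x \<in> S \<Longrightarrow> norm (A x) \<le> K * norm x"
  shows "bounded_op S S' A"
  using assms unfolding bounded_op_def by blast

lemma bounded_op_subset:
  "bounded_op S S' A \<Longrightarrow> M \<subseteq> S \<Longrightarrow> A ` M \<subseteq> M' \<Longrightarrow> bounded_op M M' A"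
  unfolding bounded_op_def by (meson image_subset_iff subset_iff)

lemma bounded_op_cong:
  "closed_csubspace S \<Longrightarrow> bounded_op S S' A \<Longrightarrow> (\<And>x. x \<in> S \<Longrightarrow> B x = A x) \<Longrightarrow> bounded_op S S' B"
  unfolding bounded_op_def closed_csubspace_def by metis

lemma bounded_op_id: "bounded_op S S (\<lambda>x. x)"
  by (rule bounded_opI[where K=1]) auto

lemma bounded_op_compose:
  assumes "bounded_op S S' A" "bounded_op S' S'' B"
  shows "bounded_op S S'' (\<lambda>x. B (A x))"
proof -
  note A = bounded_opD[OF assms(1)] and B = bounded_opD[OF assms(2)]
  obtain K where K: "K > 0" "\<And>x. x \<in> S \<Longrightarrow> norm (A x) \<le> K * norm x"
    using bounded_op_bound[OF assms(1)] by blast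
  obtain L where L: "L > 0" "\<And>x. x \<in> S' \<Longrightarrow> norm (B x) \<le> L * norm x"
    using bounded_op_bound[OF assms(2)] by blast
  show ?thesis
  proof (rule bounded_opI[where K="L * K"])
    fix x assume x: "x \<in> S"
    have "norm (B (A x)) \<le> L * norm (A x)" using L(2) A(1) x by blast
    also have "\<dots> \<le> L * (K * norm x)" using K(2)[OF x] L(1) by simp
    finally show "norm (B (A x)) \<le> L * K * norm x" by (simp add: mult.assoc)
  qed (simp_all add: A B)
qed

lemma bounded_op_scaleC:
  assumes "closed_csubspace S'" "bounded_op S S' A"
  shows "bounded_op S S' (\<lambda>x. c *\<^sub>C A x)"
proof -
  note A = bounded_opD[OF assms(2)]
  obtain K where K: "K > 0" "\<And>x. x \<in> S \<Longrightarrow> norm (A x) \<le> K * norm x"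
    using bounded_op_bound[OF assms(2)] by blast
  show ?thesis
    by (rule bounded_opI[where K="cmod c * K"])
      (auto simp: A K closed_csubspaceD[OF assms(1)] scaleC_add_right scaleC_scaleC mult.commute[of c]
        mult.assoc mult_left_mono)
qed

lemma bounded_op_add:
  assumes "closed_csubspace S'" "bounded_op S S' A" "bounded_op S S' B"
  shows "bounded_op S S' (\<lambda>x. A x + B x)"
proof -
  note A = bounded_opD[OF assms(2)] and B = bounded_opD[OF assms(3)]
  obtain K where K: "K > 0" "\<And>x. x \<in> S \<Longrightarrow> norm (A x) \<le> K * norm x"
    using bounded_op_bound[OF assms(2)] by blast
  obtain L where L: "L > 0" "\<And>x. x \<in> S \<Longrightarrow> norm (B x) \<le> L * norm x"
    using bounded_op_bound[OF assms(3)] by blast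
  show ?thesis
  proof (rule bounded_opI[where K="K + L"])
    fix x assume x: "x \<in> S"
    show "norm (A x + B x) \<le> (K + L) * norm x"
      using norm_triangle_ineq[of "A x" "B x"] K(2)[OF x] L(2)[OF x] by (simp add: distrib_right)
  qed (use closed_csubspaceD[OF assms(1)] in \<open>auto simp: A B scaleC_add_right\<close>)
qed

lemma bounded_op_scaleR:
  "closed_csubspace S' \<Longrightarrow> bounded_op S S' A \<Longrightarrow> bounded_op S S' (\<lambda>x. r *\<^sub>R A x)"
  using bounded_op_scaleC[of S' S A "of_real r"] by (simp add: scaleR_scaleC)

lemma bounded_op_diff:
  assumes "closed_csubspace S'" "bounded_op S S' A" "bounded_op S S' B"
  shows "bounded_op S S' (\<lambda>x. A x - B x)"
  using bounded_op_add[OF assms(1,2) bounded_op_scaleC[OF assms(1,3), of "-1"]]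
  by (simp add: scaleC_minus1)

section \<open>Riesz representation and adjoints\<close>

lemma Riesz_representation:
  assumes S: "closed_csubspace (S::'a::complex_hilbert set)"
    and add: "\<And>x y. x \<in> S \<Longrightarrow> y \<in> S \<Longrightarrow> f (x + y) = f x + f y"
    and sc: "\<And>c x. x \<in> S \<Longrightarrow> f (c *\<^sub>C x) = c * f x"
    and bd: "\<And>x. x \<in> S \<Longrightarrow> cmod (f x) \<le> K * norm x"
  obtains x where "x \<in> S" "\<And>z. z \<in> S \<Longrightarrow> f z = cinner z x"
proof (cases "\<forall>z\<in>S. f z = 0")
  case True
  then show ?thesis using that[of 0] closed_csubspaceD(2)[OF S] by auto
next
  case False
  note cs = closed_csubspaceD[OF S]
  obtain w where w: "w \<in> S" "f w \<noteq> 0" using False by blast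
  have diff: "f (x - y) = f x - f y" if "x \<in> S" "y \<in> S" for x y
    using add[OF that(1) cs(5)[OF that(2)]] sc[OF that(2), of "-1"] by (simp add: scaleC_minus1)
  \<comment> \<open>Boundedness makes this kernel closed, so some \<open>u\<close> with
    \<open>f u\<close> nonzero is orthogonal to it; \<open>u\<close> and the kernel together span
    \<open>S\<close>.\<close>
  define M where "M = {z \<in> S. f z = 0}"
  have "closed M"
    unfolding closed_sequential_limits
  proof (intro allI impI, elim conjE)
    fix y l assume y: "\<forall>n. y n \<in> M" and lim: "y \<longlonglongrightarrow> l"
    have l: "l \<in> S" using closed_sequentially[OF cs(1) _ lim] y by (auto simp: M_def)
    have "(\<lambda>n. K * norm (l - y n)) \<longlonglongrightarrow> K * norm (l - l)"
      by (intro tendsto_intros lim)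
    moreover have "cmod (f l) \<le> K * norm (l - y n)" for n
      using bd[of "l - y n"] y l cs(6) by (auto simp: M_def diff)
    ultimately have "cmod (f l) \<le> K * norm (l - l)"
      by (intro tendsto_lowerbound) (auto intro: always_eventually)
    then show "l \<in> M" using l by (simp add: M_def)
  qed
  then have M: "closed_csubspace M"
    using cs by (auto simp: closed_csubspace_def M_def add sc diff[of 0 0, simplified])
  obtain p where p: "p \<in> M" "\<And>y. y \<in> M \<Longrightarrow> cinner (w - p) y = 0"
    using orthogonal_projection_exists[OF M] by blast
  define u where "u = w - p"
  have u: "u \<in> S" "f u = f w" using p w cs by (auto simp: u_def M_def diff)
  then have u0: "u \<noteq> 0" using w(2) diff[of 0 0] cs(2) by auto
  \<comment> \<open>The scaling is the one for which \<open>cinner u x = f u\<close>.\<close>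
  define x where "x = (cnj (f u) / of_real ((norm u)\<^sup>2)) *\<^sub>C u"
  have "f z = cinner z x" if z: "z \<in> S" for z
  proof -
    have "z - (f z / f u) *\<^sub>C u \<in> M" using z u w(2) cs by (simp add: M_def diff sc)
    then have "cinner u (z - (f z / f u) *\<^sub>C u) = 0" using p(2) by (simp add: u_def)
    then have "cinner z u = f z / f u * of_real ((norm u)\<^sup>2)"
      using cinner_eq_0_commute[of u] by (simp add: cinner_diff_left cinner_scaleC_left cinner_norm)
    then show ?thesis using u w(2) u0 by (simp add: x_def cinner_scaleC_right)
  qed
  moreover have "x \<in> S" using u cs by (simp add: x_def)
  ultimately show ?thesis using that by blast
qed

lemma cinner_ext:
  assumes "closed_csubspace S" "x \<in> S" "y \<in> S" "\<And>z. z \<in> S \<Longrightarrow> cinner z x = cinner z y"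
  shows "x = (y::'a::complex_hilbert)"
proof -
  have "cinner (x - y) (x - y) = 0"
    using assms(4)[OF closed_csubspaceD(6)[OF assms(1-3)]] by (simp add: cinner_diff_right)
  then show ?thesis by simp
qed

text \<open>Riesz representation, applied on \<open>S\<close> to the functional sending
  \<open>z\<close> to \<open>cinner (A z) y\<close>, supplies the unique vector that the definite
  description in \<open>adj_on\<close> selects.\<close>

lemma adj_on_props:
  assumes S: "closed_csubspace S" and A: "bounded_op S S' A"
  shows adj_on_in: "adj_on S A y \<in> S"
    and cinner_adj_on: "\<And>z. z \<in> S \<Longrightarrow> cinner (A z) y = cinner z (adj_on S A y)"
proof -
  note Ad = bounded_opD[OF A]
  obtain K where K: "K > 0" "\<And>x. x \<in> S \<Longrightarrow> norm (A x) \<le> K * norm x"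
    using bounded_op_bound[OF A] by blast
  have "cmod (cinner (A z) y) \<le> (K * norm y) * norm z" if "z \<in> S" for z
    using Cauchy_Schwarz_cinner[of "A z" y] mult_right_mono[OF K(2)[OF that] norm_ge_zero[of y]]
    by (simp add: algebra_simps)
  then obtain x where x: "x \<in> S" "\<And>z. z \<in> S \<Longrightarrow> cinner (A z) y = cinner z x"
    using Riesz_representation[OF S, of "\<lambda>z. cinner (A z) y" "K * norm y"]
    by (auto simp: Ad cinner_simps)
  have "\<exists>!x. x \<in> S \<and> (\<forall>z\<in>S. cinner (A z) y = cinner z x)"
    using x by (intro ex1I[of _ x]) (auto intro!: cinner_ext[OF S])
  from theI'[OF this] show "adj_on S A y \<in> S"
    "\<And>z. z \<in> S \<Longrightarrow> cinner (A z) y = cinner z (adj_on S A y)"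
    unfolding adj_on_def by auto
qed

lemma adj_on_eqI:
  assumes S: "closed_csubspace S" and A: "bounded_op S S' A"
    and "x \<in> S" "\<And>z. z \<in> S \<Longrightarrow> cinner (A z) y = cinner z x"
  shows "adj_on S A y = x"
  by (rule cinner_ext[OF S adj_on_in[OF S A] assms(3)])
    (simp add: assms(4) flip: cinner_adj_on[OF S A])

lemma cinner_adj_on_left:
  assumes "closed_csubspace S" "bounded_op S S' A" "z \<in> S"
  shows "cinner (adj_on S A y) z = cinner y (A z)"
  using cinner_adj_on[OF assms, of y] cinner_commute by metis

lemma bounded_op_adj_on:
  assumes S: "closed_csubspace S" and A: "bounded_op S S' A" and S': "closed_csubspace S'"
  shows "bounded_op S' S (adj_on S A)"
proof -
  obtain K where K: "K > 0" "\<And>x. x \<in> S \<Longrightarrow> norm (A x) \<le> K * norm x"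
    using bounded_op_bound[OF A] by blast
  note cs = closed_csubspaceD[OF S] and adj = adj_on_in[OF S A] cinner_adj_on[OF S A]
  show ?thesis
  proof (rule bounded_opI)
    fix y assume "y \<in> S'"
    let ?x = "adj_on S A y"
    have "(norm ?x)\<^sup>2 = Re (cinner (A ?x) y)" using adj(2)[OF adj(1)] by (simp add: Re_cinner_self)
    also have "\<dots> \<le> norm (A ?x) * norm y" using Re_cinner_le[of "A ?x" y] by linarith
    also have "\<dots> \<le> (K * norm ?x) * norm y" using K(2)[OF adj(1)] by (intro mult_right_mono) auto
    finally have "norm ?x * norm ?x \<le> (K * norm y) * norm ?x" by (simp add: power2_eq_square mult_ac)
    then show "norm ?x \<le> K * norm y"
      using K(1) by (cases "norm ?x = 0") (auto simp: mult_le_cancel_right)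
  qed (auto intro!: adj_on_eqI[OF S A] simp: adj cs cinner_simps)
qed

section \<open>Selfadjoint and positive operators\<close>

definition selfadjoint_on :: "'a::complex_hilbert set \<Rightarrow> ('a \<Rightarrow> 'a) \<Rightarrow> bool" where
  "selfadjoint_on S A \<longleftrightarrow> bounded_op S S A \<and> (\<forall>x\<in>S. \<forall>y\<in>S. cinner (A x) y = cinner x (A y))"

lemma selfadjoint_onD:
  assumes "selfadjoint_on S A"
  shows "bounded_op S S A" "\<And>x y. x \<in> S \<Longrightarrow> y \<in> S \<Longrightarrow> cinner (A x) y = cinner x (A y)"
  using assms by (auto simp: selfadjoint_on_def)

lemma selfadjoint_on_cong:
  "closed_csubspace S \<Longrightarrow> selfadjoint_on S A \<Longrightarrow> (\<And>x. x \<in> S \<Longrightarrow> B x = A x) \<Longrightarrow> selfadjoint_on S B"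
  using bounded_op_cong unfolding selfadjoint_on_def by fastforce

lemma selfadjoint_on_id: "selfadjoint_on S (\<lambda>x. x)"
  by (simp add: selfadjoint_on_def bounded_op_id)

lemma selfadjoint_on_add:
  "closed_csubspace S \<Longrightarrow> selfadjoint_on S A \<Longrightarrow> selfadjoint_on S B \<Longrightarrow> selfadjoint_on S (\<lambda>x. A x + B x)"
  by (simp add: selfadjoint_on_def bounded_op_add cinner_simps)

lemma selfadjoint_on_diff:
  "closed_csubspace S \<Longrightarrow> selfadjoint_on S A \<Longrightarrow> selfadjoint_on S B \<Longrightarrow> selfadjoint_on S (\<lambda>x. A x - B x)"
  by (simp add: selfadjoint_on_def bounded_op_diff cinner_simps)

lemma selfadjoint_on_scaleR:
  "closed_csubspace S \<Longrightarrow> selfadjoint_on S A \<Longrightarrow> selfadjoint_on S (\<lambda>x. r *\<^sub>R A x)"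
  by (simp add: selfadjoint_on_def bounded_op_scaleR cinner_scaleR_left cinner_scaleR_right)

lemma selfadjoint_on_compose:
  assumes "selfadjoint_on S A" "selfadjoint_on S B" "\<And>x. x \<in> S \<Longrightarrow> A (B x) = B (A x)"
  shows "selfadjoint_on S (\<lambda>x. A (B x))"
  unfolding selfadjoint_on_def
proof (intro conjI ballI)
  note A = selfadjoint_onD[OF assms(1)] and B = selfadjoint_onD[OF assms(2)]
  show "bounded_op S S (\<lambda>x. A (B x))" by (rule bounded_op_compose[OF B(1) A(1)])
  show "cinner (A (B x)) y = cinner x (A (B y))" if "x \<in> S" "y \<in> S" for x y
    using that by (simp add: A(2) B(2) bounded_opD(1)[OF A(1)] bounded_opD(1)[OF B(1)] assms(3))
qed

lemma selfadjoint_on_adj_on_comp: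
  assumes S: "closed_csubspace S" and A: "bounded_op S S' A" and S': "closed_csubspace S'"
  shows "selfadjoint_on S (\<lambda>x. adj_on S A (A x))"
  using bounded_op_compose[OF A bounded_op_adj_on[OF S A S']] cinner_adj_on[OF S A]
    cinner_adj_on_left[OF S A] bounded_opD(1)[OF A]
  by (simp add: selfadjoint_on_def)

lemma adj_on_selfadjoint:
  "closed_csubspace S \<Longrightarrow> selfadjoint_on S A \<Longrightarrow> y \<in> S \<Longrightarrow> adj_on S A y = A y"
  by (rule adj_on_eqI) (auto simp: selfadjoint_on_def dest: bounded_opD(1))

text \<open>Over complex scalars a real quadratic form forces symmetry: expanding the form at
  \<open>x + y\<close> and at \<open>x\<close> plus the imaginary unit times \<open>y\<close>
  compares the imaginary and the real parts of \<open>cinner (A x) y\<close> and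
  \<open>cinner (A y) x\<close>.\<close>

lemma positive_op_iff:
  assumes S: "closed_csubspace S"
  shows "positive_op S A \<longleftrightarrow> selfadjoint_on S A \<and> (\<forall>x\<in>S. 0 \<le> Re (cinner (A x) x))"
proof
  assume P: "positive_op S A"
  note cs = closed_csubspaceD[OF S]
  have A: "bounded_op S S A" and pos: "\<And>x. x \<in> S \<Longrightarrow> cinner (A x) x \<in> \<real>\<^sub>\<ge>\<^sub>0"
    using P by (auto simp: positive_op_def)
  note Ad = bounded_opD[OF A]
  have im: "Im (cinner (A x) x) = 0" if "x \<in> S" for x
    using pos[OF that] by (simp add: complex_nonneg_Reals_iff)
  have "cinner (A x) y = cinner x (A y)" if x: "x \<in> S" and y: "y \<in> S" for x y
  proof -
    have "Im (cinner (A x) y + cinner (A y) x) = 0"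
      using im[OF cs(3)[OF x y]] im[OF x] im[OF y] by (simp add: Ad x y cinner_simps)
    moreover have "Im (cinner (A x) (\<i> *\<^sub>C y) + cinner (A (\<i> *\<^sub>C y)) x) = 0"
      using im[OF cs(3)[OF x cs(4)[OF y]], of \<i>] im[OF x] im[OF cs(4)[OF y], of \<i>]
      by (simp add: Ad x cs(4)[OF y] cinner_add_left cinner_add_right)
    ultimately have "cinner (A x) y = cnj (cinner (A y) x)"
      by (simp add: Ad y cinner_simps complex_eq_iff)
    then show ?thesis using cinner_commute by metis
  qed
  then show "selfadjoint_on S A \<and> (\<forall>x\<in>S. 0 \<le> Re (cinner (A x) x))"
    using A pos by (auto simp: selfadjoint_on_def complex_nonneg_Reals_iff)
next
  assume "selfadjoint_on S A \<and> (\<forall>x\<in>S. 0 \<le> Re (cinner (A x) x))"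
  then have A: "bounded_op S S A" "\<And>x. x \<in> S \<Longrightarrow> cinner (A x) x = cinner x (A x)"
    and pos: "\<And>x. x \<in> S \<Longrightarrow> 0 \<le> Re (cinner (A x) x)" by (auto simp: selfadjoint_on_def)
  have "Im (cinner (A x) x) = 0" if "x \<in> S" for x
    using A(2)[OF that] cinner_commute[of x "A x"] by (metis Reals_cnj_iff complex_is_Real_iff)
  then show "positive_op S A"
    using A(1) pos by (auto simp: positive_op_def complex_nonneg_Reals_iff)
qed

lemma positive_opD:
  assumes "closed_csubspace S" "positive_op S A"
  shows "selfadjoint_on S A" "\<And>x. x \<in> S \<Longrightarrow> 0 \<le> Re (cinner (A x) x)" "bounded_op S S A"
  using assms(2) unfolding positive_op_iff[OF assms(1)] selfadjoint_on_def by blast+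

lemma positive_op_adj_on_comp:
  assumes S: "closed_csubspace S" and A: "bounded_op S S' A" and S': "closed_csubspace S'"
  shows "positive_op S (\<lambda>x. adj_on S A (A x))"
  using selfadjoint_on_adj_on_comp[OF assms]
  by (auto simp: positive_op_iff[OF S] cinner_adj_on_left[OF S A] cinner_norm)

lemma positive_op_square:
  assumes "closed_csubspace S" "selfadjoint_on S A"
  shows "positive_op S (\<lambda>x. A (A x))"
  unfolding positive_op_iff[OF assms(1)]
proof (intro conjI ballI)
  show "selfadjoint_on S (\<lambda>x. A (A x))"
    by (rule selfadjoint_on_compose[OF assms(2,2)]) simp
  fix x assume x: "x \<in> S"
  then have "A x \<in> S" using bounded_opD(1)[OF selfadjoint_onD(1)[OF assms(2)]] by blast
  then have "cinner (A (A x)) x = cinner (A x) (A x)" by (rule selfadjoint_onD(2)[OF assms(2) _ x])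
  then show "0 \<le> Re (cinner (A (A x)) x)" by (simp add: Re_cinner_self)
qed

text \<open>This amounts to A^2 <= K A. It follows by expanding the nonnegative form at
  \<open>x - t *\<^sub>R A x\<close> with \<open>t = 1 / K\<close>, so that it is available before
  square roots are constructed.\<close>

lemma positive_op_norm_bound:
  assumes S: "closed_csubspace S" and A: "positive_op S A"
    and K: "K > 0" "\<And>x. x \<in> S \<Longrightarrow> norm (A x) \<le> K * norm x" and x: "x \<in> S"
  shows "(norm (A x))\<^sup>2 \<le> K * Re (cinner (A x) x)"
proof -
  note cs = closed_csubspaceD[OF S]
  note P = positive_opD[OF S A]
  note Ad = bounded_opD[OF P(3)] bounded_op_linear[OF P(3) S]
  define t where "t = 1 / K"
  let ?y = "A x"
  have y: "?y \<in> S" using Ad(1) x .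
  have "Re (cinner (A ?y) ?y) \<le> norm (A ?y) * norm ?y" using Re_cinner_le[of "A ?y" ?y] by linarith
  also have "\<dots> \<le> K * norm ?y * norm ?y" using K(2)[OF y] by (intro mult_right_mono) auto
  finally have b: "Re (cinner (A ?y) ?y) \<le> K * (norm ?y)\<^sup>2" by (simp add: power2_eq_square mult_ac)
  have "x - t *\<^sub>R ?y \<in> S" using cs(6)[OF x cs(7)[OF y]] .
  then have "0 \<le> Re (cinner (A (x - t *\<^sub>R ?y)) (x - t *\<^sub>R ?y))" by (rule P(2))
  also have "A (x - t *\<^sub>R ?y) = ?y - t *\<^sub>R A ?y"
    by (simp only: Ad(6)[OF x cs(7)[OF y]] Ad(7)[OF y])
  also have "Re (cinner (?y - t *\<^sub>R A ?y) (x - t *\<^sub>R ?y)) =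
      Re (cinner ?y x) - t * Re (cinner ?y ?y) - t * Re (cinner (A ?y) x)
        + t * (t * Re (cinner (A ?y) ?y))"
    by (simp add: cinner_diff_left cinner_diff_right cinner_scaleR_left cinner_scaleR_right right_diff_distrib)
  also have "cinner (A ?y) x = cinner ?y ?y" by (rule selfadjoint_onD(2)[OF P(1) y x])
  also have "Re (cinner ?y x) - t * Re (cinner ?y ?y) - t * Re (cinner ?y ?y)
        + t * (t * Re (cinner (A ?y) ?y)) \<le>
      Re (cinner ?y x) - t * Re (cinner ?y ?y) - t * Re (cinner ?y ?y) + t * (t * (K * (norm ?y)\<^sup>2))"
    using b K(1) by (intro add_left_mono mult_left_mono) (auto simp: t_def)
  also have "t * (t * (K * (norm ?y)\<^sup>2)) = t * (norm ?y)\<^sup>2" using K(1) by (simp add: t_def)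
  finally have "t * (norm ?y)\<^sup>2 \<le> Re (cinner ?y x)" by (simp add: Re_cinner_self)
  then show ?thesis using K(1) by (simp add: t_def divide_le_eq mult.commute)
qed

lemma positive_op_cinner_eq_0:
  assumes S: "closed_csubspace S" and A: "positive_op S A" and "x \<in> S" "Re (cinner (A x) x) = 0"
  shows "A x = 0"
proof -
  obtain K where "K > 0" "\<And>x. x \<in> S \<Longrightarrow> norm (A x) \<le> K * norm x"
    using bounded_op_bound[OF positive_opD(3)[OF S A]] by blast
  from positive_op_norm_bound[OF S A this assms(3)] show ?thesis using assms(4) by simp
qed

section \<open>Square roots of positive operators\<close>

lemma bounded_op_tendsto:
  assumes S: "closed_csubspace S" and B: "bounded_op S S' B"
    and u: "\<And>n. u n \<in> S" "l \<in> S" "u \<longlonglongrightarrow> l"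
  shows "(\<lambda>n. B (u n)) \<longlonglongrightarrow> B l"
proof -
  obtain K where K: "K > 0" "\<And>x. x \<in> S \<Longrightarrow> norm (B x) \<le> K * norm x"
    using bounded_op_bound[OF B] by blast
  have "(\<lambda>n. K * norm (u n - l)) \<longlonglongrightarrow> K * norm (l - l)" by (intro tendsto_intros u)
  then have lim: "(\<lambda>n. K * norm (u n - l)) \<longlonglongrightarrow> 0" by simp
  have "norm (B (u n) - B l) \<le> K * norm (u n - l)" for n
    using K(2)[OF closed_csubspaceD(6)[OF S u(1)[of n] u(2)]]
    by (simp add: bounded_op_linear(3)[OF B S u(1) u(2)])
  then have "(\<lambda>n. B (u n) - B l) \<longlonglongrightarrow> 0"
    by (intro Lim_null_comparison[OF _ lim] always_eventually) simp
  then show ?thesis by (simp add: LIM_zero_iff)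
qed

text \<open>\<open>1 - Y\<close> will be a square root of \<open>1 - X\<close>. The iterates \<open>Y\<^sub>n\<close> below are polynomials in \<open>X\<close> with
  nonnegative coefficients, hence dominated by the same iteration for the number \<open>1\<close> in place of
  \<open>X\<close>; this makes the convergence uniform on the unit ball.\<close>

lemma contraction_quadratic_fixpoint:
  fixes S :: "'a::complex_hilbert set"
  assumes S: "closed_csubspace S" and X: "selfadjoint_on S X"
    and X1: "\<And>x. x \<in> S \<Longrightarrow> norm (X x) \<le> norm x"
  shows "\<exists>Y. selfadjoint_on S Y \<and> (\<forall>x\<in>S. norm (Y x) \<le> norm x) \<and>
    (\<forall>x\<in>S. 2 *\<^sub>R Y x = X x + Y (Y x)) \<and>
    (\<forall>B. bounded_op S S B \<longrightarrow> (\<forall>x\<in>S. B (X x) = X (B x)) \<longrightarrow> (\<forall>x\<in>S. B (Y x) = Y (B x)))"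
proof -
  note cs = closed_csubspaceD[OF S]
  note Xb = selfadjoint_onD(1)[OF X]
  define Y where "Y n = ((\<lambda>Y x. (1/2) *\<^sub>R (X x + Y (Y x))) ^^ n) (\<lambda>x. 0)" for n
  define a where "a n = ((\<lambda>a. (1 + a\<^sup>2) / 2) ^^ n) (0::real)" for n
  have Y0: "Y 0 = (\<lambda>x. 0)" and YS: "Y (Suc n) = (\<lambda>x. (1/2) *\<^sub>R (X x + Y n (Y n x)))" for n
    by (simp_all add: Y_def)
  have a0: "a 0 = 0" and aS: "a (Suc n) = (1 + (a n)\<^sup>2) / 2" for n by (simp_all add: a_def)
  have a_nonneg: "0 \<le> a n" for n by (cases n) (simp_all add: a0 aS)
  have a_le1: "a n \<le> 1" for n
  proof (induction n)
    case (Suc n)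
    then show ?case using power_le_one[OF a_nonneg[of n], of 2] by (simp add: aS)
  qed (simp add: a0)
  have a_mono: "incseq a"
  proof (rule incseq_SucI)
    show "a n \<le> a (Suc n)" for n
      using zero_le_power2[of "a n - 1"] by (simp add: aS power2_eq_square algebra_simps)
  qed
  have Yb: "bounded_op S S (Y n)" for n
  proof (induction n)
    case 0
    show ?case using bounded_op_scaleC[OF S bounded_op_id, of 0] by (simp add: Y0)
  next
    case (Suc n)
    show ?case unfolding YS
      by (intro bounded_op_scaleR bounded_op_add S Xb bounded_op_compose[OF Suc Suc])
  qed
  note Yl = bounded_opD[OF Yb] bounded_op_linear[OF Yb S]
  have comm: "B (Y n x) = Y n (B x)"
    if B: "bounded_op S S B" "\<And>x. x \<in> S \<Longrightarrow> B (X x) = X (B x)" and x: "x \<in> S" for B n x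
    using x
  proof (induction n arbitrary: x)
    case 0
    show ?case using bounded_op_linear(1)[OF B(1) S] by (simp add: Y0)
  next
    case (Suc n)
    have 1: "X x \<in> S" "Y n x \<in> S" "Y n (Y n x) \<in> S" "X x + Y n (Y n x) \<in> S"
      using bounded_opD(1)[OF Xb] Yl(1) Suc.prems cs(3) by auto
    show ?case
      using Suc.prems Suc.IH 1 by (simp add: YS bounded_op_linear(4)[OF B(1) S] bounded_opD(2)[OF B(1)] B(2))
  qed
  have YY: "Y m (Y n x) = Y n (Y m x)" if "x \<in> S" for m n x
  proof (rule comm[OF Yb _ that])
    show "Y m (X x) = X (Y m x)" if "x \<in> S" for x
      using comm[OF Xb _ that] by simp
  qed
  have Ysa: "selfadjoint_on S (Y n)" for n
  proof (induction n)
    case 0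
    show ?case using Yb[of 0] by (simp add: selfadjoint_on_def Y0)
  next
    case (Suc n)
    show ?case unfolding YS
      by (intro selfadjoint_on_scaleR selfadjoint_on_add S X selfadjoint_on_compose[OF Suc Suc]) simp
  qed
  have Y_le: "norm (Y n x) \<le> a n * norm x" if "x \<in> S" for n x
    using that
  proof (induction n arbitrary: x)
    case (Suc n)
    have "norm (Y n (Y n x)) \<le> a n * (a n * norm x)"
      using Suc.IH[OF Yl(1)[OF Suc.prems], of n] mult_left_mono[OF Suc.IH[OF Suc.prems] a_nonneg[of n]] by linarith
    then have "norm (X x + Y n (Y n x)) \<le> norm x + (a n)\<^sup>2 * norm x"
      using X1[OF Suc.prems] norm_triangle_ineq[of "X x" "Y n (Y n x)"] by (simp add: power2_eq_square)
    then show ?case by (simp add: YS aS distrib_right)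
  qed (simp add: Y0 a0)
  \<comment> \<open>The iterates commute, so the difference of the squares of \<open>Y k\<close> and
    \<open>Y n\<close> is their difference applied to their sum. The numbers \<open>a\<close>
    satisfy the same factorization, which carries the domination through the induction.\<close>
  have Y_diff: "norm (Y m x - Y n x) \<le> (a m - a n) * norm x" if "n \<le> m" "x \<in> S" for m n x
    using that
  proof (induction n arbitrary: m x)
    case 0
    then show ?case using Y_le by (simp add: Y0 a0)
  next
    case (Suc n)
    then obtain k where k: "m = Suc k" "n \<le> k" by (cases m) auto
    let ?z = "Y k x + Y n x"
    note x = Suc.prems(2)
    have zS: "?z \<in> S" using Yl(1) x cs(3) by simp
    have "Y m x - Y (Suc n) x = (1/2) *\<^sub>R (Y k (Y k x) - Y n (Y n x))"
      by (simp add: k YS flip: scaleR_diff_right)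
    also have "Y k (Y k x) - Y n (Y n x) = Y k ?z - Y n ?z"
      using YY[OF x, of k n] by (simp add: Yl x)
    finally have "norm (Y m x - Y (Suc n) x) = norm (Y k ?z - Y n ?z) / 2" by simp
    also have "\<dots> \<le> (a k - a n) * norm ?z / 2" using Suc.IH[OF k(2) zS] by simp
    also have "\<dots> \<le> (a k - a n) * ((a k + a n) * norm x) / 2"
    proof -
      have "norm ?z \<le> (a k + a n) * norm x"
        using Y_le[OF x, of k] Y_le[OF x, of n] norm_triangle_ineq[of "Y k x" "Y n x"]
        by (simp add: distrib_right)
      then show ?thesis using incseqD[OF a_mono k(2)] by (simp add: mult_left_mono)
    qed
    also have "\<dots> = (a m - a (Suc n)) * norm x"
      by (simp add: k aS power2_eq_square field_simps)
    finally show ?case .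
  qed
  have "convergent a"
    using incseq_convergent[OF a_mono, of 1] a_le1 unfolding convergent_def by metis
  then have aC: "Cauchy a" by (rule convergent_Cauchy)
  have conv: "convergent (\<lambda>n. Y n x)" if x: "x \<in> S" for x
  proof (rule Cauchy_convergent, rule metric_CauchyI)
    fix e :: real assume e: "e > 0"
    have pos: "0 < norm x + 1" by (simp add: add_nonneg_pos)
    then have "0 < e / (norm x + 1)" using e by simp
    then obtain M where M: "\<And>m n. m \<ge> M \<Longrightarrow> n \<ge> M \<Longrightarrow> dist (a m) (a n) < e / (norm x + 1)"
      using metric_CauchyD[OF aC] by blast
    have le: "norm (Y m x - Y n x) < e" if "n \<le> m" "M \<le> n" for m n
    proof -
      have "norm (Y m x - Y n x) \<le> (a m - a n) * (norm x + 1)"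
        using Y_diff[OF that(1) x] incseqD[OF a_mono that(1)] by (simp add: distrib_left)
      also have "\<dots> < e / (norm x + 1) * (norm x + 1)"
        using M[of m n] that incseqD[OF a_mono that(1)]
        by (intro mult_strict_right_mono pos) (simp add: dist_real_def)
      also have "\<dots> = e" using pos by simp
      finally show ?thesis .
    qed
    show "\<exists>M. \<forall>m\<ge>M. \<forall>n\<ge>M. dist (Y m x) (Y n x) < e"
      using le by (metis dist_commute dist_norm nle_le)
  qed
  define Z where "Z x = lim (\<lambda>n. Y n x)" for x
  have Z: "(\<lambda>n. Y n x) \<longlonglongrightarrow> Z x" if "x \<in> S" for x
    using conv[OF that] by (simp add: Z_def convergent_LIMSEQ_iff)
  have ZS: "Z x \<in> S" if "x \<in> S" for x
    using closed_sequentially[OF cs(1) _ Z[OF that]] Yl(1)[OF that] by blast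
  have Z1: "norm (Z x) \<le> norm x" if "x \<in> S" for x
  proof (rule tendsto_upperbound[OF tendsto_norm[OF Z[OF that]]])
    have "norm (Y n x) \<le> norm x" for n
      using Y_le[OF that, of n] mult_right_mono[OF a_le1[of n] norm_ge_zero[of x]] by simp
    then show "\<forall>\<^sub>F n in sequentially. norm (Y n x) \<le> norm x" by simp
  qed simp
  have Zb: "bounded_op S S Z"
  proof (rule bounded_opI[where K=1])
    show "Z (x + y) = Z x + Z y" if "x \<in> S" "y \<in> S" for x y
      using LIMSEQ_unique[OF Z[OF cs(3)[OF that]]] tendsto_add[OF Z[OF that(1)] Z[OF that(2)]]
      by (simp add: Yl that)
    show "Z (c *\<^sub>C x) = c *\<^sub>C Z x" if "x \<in> S" for c x
      using LIMSEQ_unique[OF Z[OF cs(4)[OF that]]]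
        bounded_op_tendsto[OF S bounded_op_scaleC[OF S bounded_op_id] Yl(1)[OF that] ZS[OF that] Z[OF that]]
      by (simp add: Yl that)
  qed (use ZS Z1 in auto)
  have Zsa: "selfadjoint_on S Z"
    unfolding selfadjoint_on_def
  proof (intro conjI ballI Zb)
    fix x y assume x: "x \<in> S" and y: "y \<in> S"
    show "cinner (Z x) y = cinner x (Z y)"
      using LIMSEQ_unique[OF tendsto_cinner[OF Z[OF x] tendsto_const]]
        tendsto_cinner[OF tendsto_const Z[OF y]] selfadjoint_onD(2)[OF Ysa x y] by simp
  qed
  have ZZ: "2 *\<^sub>R Z x = X x + Z (Z x)" if x: "x \<in> S" for x
  proof -
    have "(\<lambda>n. norm (Y n x - Z x)) \<longlonglongrightarrow> norm (Z x - Z x)"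
      by (intro tendsto_intros Z x)
    then have lim: "(\<lambda>n. norm (Y n x - Z x)) \<longlonglongrightarrow> 0" by simp
    have "norm (Y n (Y n x) - Y n (Z x)) \<le> norm (Y n x - Z x)" for n
      using Y_le[OF cs(6)[OF Yl(1)[OF x] ZS[OF x]], of n n]
        mult_right_mono[OF a_le1[of n] norm_ge_zero[of "Y n x - Z x"]]
      by (simp add: Yl(6)[OF Yl(1)[OF x] ZS[OF x]])
    then have "(\<lambda>n. Y n (Y n x) - Y n (Z x)) \<longlonglongrightarrow> 0"
      by (intro Lim_null_comparison[OF _ lim] always_eventually) simp
    from tendsto_add[OF this Z[OF ZS[OF x]]] have "(\<lambda>n. Y n (Y n x)) \<longlonglongrightarrow> Z (Z x)" by simp
    then have "(\<lambda>n. Y (Suc n) x) \<longlonglongrightarrow> (1/2) *\<^sub>R (X x + Z (Z x))"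
      unfolding YS by (intro tendsto_intros)
    from LIMSEQ_unique[OF LIMSEQ_Suc[OF Z[OF x]] this]
    have "2 *\<^sub>R Z x = 2 *\<^sub>R (1/2) *\<^sub>R (X x + Z (Z x))" by (rule arg_cong)
    then show ?thesis by simp
  qed
  have ZB: "B (Z x) = Z (B x)"
    if B: "bounded_op S S B" "\<And>x. x \<in> S \<Longrightarrow> B (X x) = X (B x)" and x: "x \<in> S" for B x
    using LIMSEQ_unique[OF bounded_op_tendsto[OF S B(1) Yl(1)[OF x] ZS[OF x] Z[OF x]]]
      Z[OF bounded_opD(1)[OF B(1) x]] by (simp add: comm[OF B x])
  show ?thesis
    by (intro exI[of _ Z] conjI allI impI ballI) (simp_all add: Zsa Z1 ZZ ZB)
qed

text \<open>For a bound \<open>K\<close> the operator 1 - A/K is a contraction, because |A x|^2 is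
  at most K times the form of \<open>A\<close> at \<open>x\<close>. Its quadratic fixed point
  \<open>Y\<close> satisfies (1 - Y)^2 = A/K, which dictates the root. Commutation with the whole
  commutant of \<open>A\<close> is part of the statement because uniqueness rests on it.\<close>

lemma positive_sqrt_exists:
  fixes S :: "'a::complex_hilbert set"
  assumes S: "closed_csubspace S" and A: "positive_op S A"
  shows "\<exists>R. positive_op S R \<and> (\<forall>x\<in>S. R (R x) = A x) \<and>
    (\<forall>B. bounded_op S S B \<longrightarrow> (\<forall>x\<in>S. B (A x) = A (B x)) \<longrightarrow> (\<forall>x\<in>S. B (R x) = R (B x)))"
proof -
  note cs = closed_csubspaceD[OF S] and P = positive_opD[OF S A]
  obtain K where K: "K > 0" "\<And>x. x \<in> S \<Longrightarrow> norm (A x) \<le> K * norm x"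
    using bounded_op_bound[OF P(3)] by blast
  define X where "X x = x - (1/K) *\<^sub>R A x" for x
  have X: "selfadjoint_on S X" unfolding X_def
    by (intro selfadjoint_on_diff selfadjoint_on_scaleR selfadjoint_on_id S P)
  have X1: "norm (X x) \<le> norm x" if "x \<in> S" for x
  proof -
    let ?c = "Re (cinner (A x) x)"
    have "(norm (A x))\<^sup>2 / K\<^sup>2 \<le> ?c / K"
      using positive_op_norm_bound[OF S A K that] K(1) by (simp add: field_simps power2_eq_square)
    moreover have "(norm (X x))\<^sup>2 = (norm x)\<^sup>2 + (norm (A x))\<^sup>2 / K\<^sup>2 - 2 * (?c / K)"
      using K(1) Re_cinner_commute[of x "A x"]
      by (simp add: X_def norm_diff_square cinner_scaleR_right power_divide)
    moreover have "0 \<le> ?c / K" using P(2)[OF that] K(1) by simp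
    ultimately have "(norm (X x))\<^sup>2 \<le> (norm x)\<^sup>2" by linarith
    then show ?thesis by (rule power2_le_imp_le) simp
  qed
  obtain Y where Y: "selfadjoint_on S Y" "\<forall>x\<in>S. norm (Y x) \<le> norm x"
    "\<forall>x\<in>S. 2 *\<^sub>R Y x = X x + Y (Y x)"
    "\<forall>B. bounded_op S S B \<longrightarrow> (\<forall>x\<in>S. B (X x) = X (B x)) \<longrightarrow> (\<forall>x\<in>S. B (Y x) = Y (B x))"
    using contraction_quadratic_fixpoint[OF S X X1] by blast
  note Yl = bounded_opD[OF selfadjoint_onD(1)[OF Y(1)]] bounded_op_linear[OF selfadjoint_onD(1)[OF Y(1)] S]
  define R where "R x = sqrt K *\<^sub>R (x - Y x)" for x
  have Rpos: "positive_op S R"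
    unfolding positive_op_iff[OF S]
  proof (intro conjI ballI)
    show "selfadjoint_on S R" unfolding R_def
      by (intro selfadjoint_on_diff selfadjoint_on_scaleR selfadjoint_on_id S Y(1))
    fix x assume x: "x \<in> S"
    have "Re (cinner (Y x) x) \<le> norm x * norm x"
      using Re_cinner_le[of "Y x" x] mult_right_mono[OF bspec[OF Y(2) x] norm_ge_zero[of x]] by linarith
    then show "0 \<le> Re (cinner (R x) x)"
      using K(1) by (simp add: R_def cinner_scaleR_left cinner_diff_left Re_cinner_self power2_eq_square)
  qed
  have RR: "R (R x) = A x" if x: "x \<in> S" for x
  proof -
    have "R (R x) = (sqrt K * sqrt K) *\<^sub>R ((x - Y x) - (Y x - Y (Y x)))"
      by (simp add: R_def Yl x cs scaleR_diff_right)
    also have "(x - Y x) - (Y x - Y (Y x)) = x - (2 *\<^sub>R Y x - Y (Y x))"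
      by (simp add: scaleR_2)
    also have "\<dots> = (1/K) *\<^sub>R A x" by (simp add: bspec[OF Y(3) x] X_def)
    finally show ?thesis using K(1) by simp
  qed
  have RB: "B (R x) = R (B x)"
    if B: "bounded_op S S B" "\<And>x. x \<in> S \<Longrightarrow> B (A x) = A (B x)" and x: "x \<in> S" for B x
  proof -
    note Bl = bounded_opD[OF B(1)] bounded_op_linear[OF B(1) S]
    have "B (X x) = X (B x)" if "x \<in> S" for x
      using that bounded_opD(1)[OF P(3)] cs by (simp add: X_def Bl B(2))
    then have "B (Y x) = Y (B x)" using Y(4) B(1) x by blast
    then show ?thesis using x Yl(1) cs by (simp add: R_def Bl)
  qed
  show ?thesis
    by (intro exI[of _ R] conjI allI impI ballI) (simp_all add: Rpos RR RB)
qed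

text \<open>For \<open>y = R x - R' x\<close> the sum \<open>R y + R' y\<close> is the difference of
  the two squares at \<open>x\<close>, hence zero. Both forms are nonnegative, so both vanish at
  \<open>y\<close>; then \<open>R\<close> and \<open>R'\<close> kill \<open>y\<close>, which makes
  \<open>y\<close> orthogonal to both ranges and thus to itself.\<close>

lemma positive_sqrt_unique:
  fixes S :: "'a::complex_hilbert set"
  assumes S: "closed_csubspace S" and R: "positive_op S R" and R': "positive_op S R'"
    and eq: "\<And>x. x \<in> S \<Longrightarrow> R' (R' x) = R (R x)"
    and comm: "\<And>x. x \<in> S \<Longrightarrow> R' (R x) = R (R' x)" and x: "x \<in> S"
  shows "R' x = R x"
proof -
  note cs = closed_csubspaceD[OF S] and P = positive_opD[OF S R] and P' = positive_opD[OF S R']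
  note l = bounded_opD[OF P(3)] bounded_op_linear[OF P(3) S]
  note l' = bounded_opD[OF P'(3)] bounded_op_linear[OF P'(3) S]
  define y where "y = R x - R' x"
  have y: "y \<in> S" unfolding y_def by (rule cs(6)[OF l(1)[OF x] l'(1)[OF x]])
  have "R y + R' y = 0"
    unfolding y_def l(6)[OF l(1)[OF x] l'(1)[OF x]] l'(6)[OF l(1)[OF x] l'(1)[OF x]]
    by (simp add: eq[OF x] comm[OF x])
  then have "Re (cinner (R y + R' y) y) = 0" by simp
  then have "Re (cinner (R y) y) + Re (cinner (R' y) y) = 0" by (simp add: cinner_add_left)
  then have "Re (cinner (R y) y) = 0" "Re (cinner (R' y) y) = 0"
    using P(2)[OF y] P'(2)[OF y] by linarith+
  then have "R y = 0" "R' y = 0"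
    using positive_op_cinner_eq_0[OF S R y] positive_op_cinner_eq_0[OF S R' y] by auto
  then have "cinner y (R x) = 0" "cinner y (R' x) = 0"
    using selfadjoint_onD(2)[OF P(1) y x] selfadjoint_onD(2)[OF P'(1) y x] by auto
  then have "cinner y y = 0" by (simp add: y_def cinner_diff_right)
  then show ?thesis by (simp add: y_def)
qed

lemma sqrt_on_props:
  fixes S :: "'a::complex_hilbert set"
  assumes S: "closed_csubspace S" and A: "positive_op S A"
  shows positive_op_sqrt_on: "positive_op S (sqrt_on S A)"
    and sqrt_on_sqrt_on: "\<And>x. x \<in> S \<Longrightarrow> sqrt_on S A (sqrt_on S A x) = A x"
    and sqrt_on_commute: "\<And>B x. bounded_op S S B \<Longrightarrow> (\<And>x. x \<in> S \<Longrightarrow> B (A x) = A (B x)) \<Longrightarrow>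
      x \<in> S \<Longrightarrow> B (sqrt_on S A x) = sqrt_on S A (B x)"
proof -
  obtain R where R: "positive_op S R" "\<forall>x\<in>S. R (R x) = A x"
    "\<forall>B. bounded_op S S B \<longrightarrow> (\<forall>x\<in>S. B (A x) = A (B x)) \<longrightarrow> (\<forall>x\<in>S. B (R x) = R (B x))"
    using positive_sqrt_exists[OF S A] by blast
  have RB: "B (R x) = R (B x)"
    if "bounded_op S S B" "\<And>x. x \<in> S \<Longrightarrow> B (A x) = A (B x)" "x \<in> S" for B x
    using R(3) that by blast
  note Rb = bounded_opD(1)[OF positive_opD(3)[OF S R(1)]]
  define R0 where "R0 x = (if x \<in> S then R x else 0)" for x
  have R0: "R0 x = R x" if "x \<in> S" for x using that by (simp add: R0_def)
  have "positive_op S R0"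
    unfolding positive_op_def
  proof (intro conjI ballI)
    show "bounded_op S S R0" by (rule bounded_op_cong[OF S positive_opD(3)[OF S R(1)] R0])
    show "cinner (R0 x) x \<in> \<real>\<^sub>\<ge>\<^sub>0" if "x \<in> S" for x
      using R(1) that by (simp add: positive_op_def R0)
  qed
  then have ex: "positive_op S R0 \<and> (\<forall>x\<in>S. R0 (R0 x) = A x) \<and> (\<forall>x. x \<notin> S \<longrightarrow> R0 x = 0)"
    by (simp add: R0 Rb R(2)) (simp add: R0_def)
  have eq: "sqrt_on S A = R0"
    unfolding sqrt_on_def
  proof (rule the_equality)
    show "positive_op S R0 \<and> (\<forall>x\<in>S. R0 (R0 x) = A x) \<and> (\<forall>x. x \<notin> S \<longrightarrow> R0 x = 0)"
      by (rule ex)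
    fix R' assume "positive_op S R' \<and> (\<forall>x\<in>S. R' (R' x) = A x) \<and> (\<forall>x. x \<notin> S \<longrightarrow> R' x = 0)"
    then have R': "positive_op S R'" "\<forall>x\<in>S. R' (R' x) = A x" "\<forall>x. x \<notin> S \<longrightarrow> R' x = 0"
      by blast+
    note b = positive_opD(3)[OF S R'(1)]
    \<comment> \<open>\<open>R'\<close> commutes with its own square \<open>A\<close>, and
      \<open>R\<close> commutes with everything that commutes with \<open>A\<close>; so the two
      roots commute, as uniqueness requires.\<close>
    have comm: "R' (A x) = A (R' x)" if "x \<in> S" for x
    proof -
      have "R' (A x) = R' (R' (R' x))" using R'(2) that by simp
      also have "\<dots> = A (R' x)" using R'(2) bounded_opD(1)[OF b that] by blast
      finally show ?thesis .
    qed
    have "R' x = R0 x" for x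
    proof (cases "x \<in> S")
      case True
      have "R' (R' x) = R (R x)" if "x \<in> S" for x using R'(2) R(2) that by simp
      from positive_sqrt_unique[OF S R(1) R'(1) this RB[OF b comm] True]
      show ?thesis using True by (simp add: R0)
    qed (use R'(3) in \<open>simp add: R0_def\<close>)
    then show "R' = R0" ..
  qed
  show "positive_op S (sqrt_on S A)" "\<And>x. x \<in> S \<Longrightarrow> sqrt_on S A (sqrt_on S A x) = A x"
    unfolding eq using ex by blast+
  show "B (sqrt_on S A x) = sqrt_on S A (B x)"
    if "bounded_op S S B" "\<And>x. x \<in> S \<Longrightarrow> B (A x) = A (B x)" "x \<in> S" for B x
    unfolding eq using RB[OF that] that(3) bounded_opD(1)[OF that(1,3)] by (simp add: R0)
qed

text \<open>The root of \<open>B\<close> commutes with \<open>A\<close>, so one of its two factors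
  can be moved to the other side of the inner product. What remains is the form of \<open>A\<close>
  at a single vector.\<close>

lemma positive_op_commuting_product:
  fixes S :: "'a::complex_hilbert set"
  assumes S: "closed_csubspace S" and A: "positive_op S A" and B: "positive_op S B"
    and comm: "\<And>x. x \<in> S \<Longrightarrow> A (B x) = B (A x)"
  shows "positive_op S (\<lambda>x. A (B x))"
  unfolding positive_op_iff[OF S]
proof (intro conjI ballI)
  note a = positive_opD[OF S A] and b = positive_opD[OF S B]
  show "selfadjoint_on S (\<lambda>x. A (B x))" by (rule selfadjoint_on_compose[OF a(1) b(1) comm])
  fix x assume x: "x \<in> S"
  let ?R = "sqrt_on S B"
  note r = positive_opD[OF S positive_op_sqrt_on[OF S B]]
  have Rx: "?R x \<in> S" using bounded_opD(1)[OF r(3) x] .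
  have "cinner (A (B x)) x = cinner (A (?R (?R x))) x" using sqrt_on_sqrt_on[OF S B x] by simp
  also have "A (?R (?R x)) = ?R (A (?R x))"
    by (rule sqrt_on_commute[OF S B a(3) _ Rx]) (rule comm)
  also have "cinner (?R (A (?R x))) x = cinner (A (?R x)) (?R x)"
    by (rule selfadjoint_onD(2)[OF r(1) bounded_opD(1)[OF a(3) Rx] x])
  finally show "0 \<le> Re (cinner (A (B x)) x)" using a(2)[OF Rx] by simp
qed

text \<open>The lower bound makes the range closed, and the orthogonal complement of the range of a
  selfadjoint operator is its kernel, which the bound makes trivial.\<close>

lemma selfadjoint_bounded_below_surj:
  fixes S :: "'a::complex_hilbert set"
  assumes S: "closed_csubspace S" and N: "selfadjoint_on S N" and c: "c > 0"
    and below: "\<And>x. x \<in> S \<Longrightarrow> c * norm x \<le> norm (N x)"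
  shows "N ` S = S"
proof -
  note cs = closed_csubspaceD[OF S] and Nb = selfadjoint_onD(1)[OF N]
  note Nl = bounded_opD[OF Nb] bounded_op_linear[OF Nb S]
  have sub: "N ` S \<subseteq> S" using Nl(1) by blast
  have "closed (N ` S)"
    unfolding closed_sequential_limits
  proof (intro allI impI, elim conjE)
    fix y l assume "\<forall>n. y n \<in> N ` S" and lim: "y \<longlonglongrightarrow> l"
    then have "\<forall>n. \<exists>x. x \<in> S \<and> y n = N x" by blast
    then obtain x where x: "\<And>n. x n \<in> S" "\<And>n. y n = N (x n)" unfolding choice_iff by blast
    have "Cauchy x"
    proof (rule metric_CauchyI)
      fix e :: real assume "e > 0"
      then have "c * e > 0" using c by simp
      then obtain M where M: "\<And>m n. m \<ge> M \<Longrightarrow> n \<ge> M \<Longrightarrow> dist (y m) (y n) < c * e"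
        using metric_CauchyD[OF LIMSEQ_imp_Cauchy[OF lim]] by blast
      have "dist (x m) (x n) < e" if "m \<ge> M" "n \<ge> M" for m n
      proof -
        have "c * norm (x m - x n) \<le> norm (y m - y n)"
          using below[OF cs(6)[OF x(1) x(1)]] by (simp add: x(2) Nl(6)[OF x(1) x(1)])
        then have "c * norm (x m - x n) < c * e" using M[OF that] by (simp add: dist_norm)
        then show ?thesis using c by (simp add: dist_norm)
      qed
      then show "\<exists>M. \<forall>m\<ge>M. \<forall>n\<ge>M. dist (x m) (x n) < e" by blast
    qed
    then obtain p where p: "x \<longlonglongrightarrow> p" using Cauchy_convergent_iff convergent_def by blast
    have pS: "p \<in> S" using closed_sequentially[OF cs(1) _ p] x(1) by blast
    have "y \<longlonglongrightarrow> N p" using bounded_op_tendsto[OF S Nb x(1) pS p] unfolding x(2)[symmetric] .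
    then show "l \<in> N ` S" using LIMSEQ_unique[OF lim] pS by blast
  qed
  then have "closed_csubspace (N ` S)"
    unfolding closed_csubspace_def
    using imageI[OF cs(2), where f=N] imageI[OF cs(3), where f=N] imageI[OF cs(4), where f=N]
    by (auto simp: Nl(2,3,4))
  moreover have "orth_minus S (N ` S) \<subseteq> {0}"
  proof
    fix v assume v: "v \<in> orth_minus S (N ` S)"
    then have vS: "v \<in> S" by (simp add: orth_minus_def)
    have "cinner (N v) (N v) = cinner v (N (N v))" using selfadjoint_onD(2)[OF N vS Nl(1)[OF vS]] .
    also have "\<dots> = 0" using v Nl(1)[OF vS] by (auto simp: orth_minus_def)
    finally show "v \<in> {0}" using below[OF vS] c by (simp add: mult_le_0_iff)
  qed
  moreover have "orth_minus S {0} = S" by (auto simp: orth_minus_def)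
  moreover have "0 \<in> orth_minus S (N ` S)" using cs(2) by (simp add: orth_minus_def)
  ultimately show ?thesis
    using orth_minus_orth_minus[OF S _ sub] by (metis empty_subsetI insert_subset subset_antisym)
qed

section \<open>Joint approximate eigenvectors and the Koszul complex\<close>

lemma positive_op_add:
  assumes "closed_csubspace S" "positive_op S A" "positive_op S B"
  shows "positive_op S (\<lambda>x. A x + B x)"
  unfolding positive_op_iff[OF assms(1)]
proof (intro conjI ballI)
  note a = positive_opD[OF assms(1,2)] and b = positive_opD[OF assms(1,3)]
  show "selfadjoint_on S (\<lambda>x. A x + B x)" by (rule selfadjoint_on_add[OF assms(1) a(1) b(1)])
  show "0 \<le> Re (cinner (A x + B x) x)" if "x \<in> S" for x
    using a(2)[OF that] b(2)[OF that] by (simp add: cinner_add_left)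
qed

text \<open>For positive \<open>N\<close>, failure means that there are unit vectors along which the
  form of \<open>N\<close> tends to zero. Joint approximate null vectors of several operators thus
  become a statement about one form, that of the sum of their squares.\<close>

definition coercive_on :: "'a::complex_hilbert set \<Rightarrow> ('a \<Rightarrow> 'a) \<Rightarrow> bool" where
  "coercive_on S N \<longleftrightarrow> (\<exists>c>0. \<forall>x\<in>S. c * (norm x)\<^sup>2 \<le> Re (cinner (N x) x))"

text \<open>The value \<open>l\<close> is the supremum of the spectrum of \<open>A\<close> ``modulo \<open>N\<close>'', i.e. the infimum of all
  \<open>t\<close> with \<open>A \<le> t + K N\<close> for some \<open>K \<ge> 0\<close>. If the conclusion failed at \<open>l\<close>, positivity of the
  product of the commuting operators \<open>l + e - A + K N\<close> and \<open>C + A - l\<close> would yield a smaller such \<open>t\<close>.\<close>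

lemma not_coercive_extend:
  fixes S :: "'a::complex_hilbert set"
  assumes S: "closed_csubspace S" and N: "positive_op S N" and nc: "\<not> coercive_on S N"
    and A: "selfadjoint_on S A" and comm: "\<And>x. x \<in> S \<Longrightarrow> A (N x) = N (A x)"
  shows "\<exists>l. \<not> coercive_on S (\<lambda>x. N x + (A (A x - l *\<^sub>R x) - l *\<^sub>R (A x - l *\<^sub>R x)))"
proof -
  note cs = closed_csubspaceD[OF S] and n = positive_opD[OF S N]
  note Ab = selfadjoint_onD(1)[OF A]
  note Al = bounded_opD[OF Ab] bounded_op_linear[OF Ab S]
  note Nl = bounded_opD[OF n(3)] bounded_op_linear[OF n(3) S]
  obtain C where C: "C > 0" "\<And>x. x \<in> S \<Longrightarrow> norm (A x) \<le> C * norm x"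
    using bounded_op_bound[OF Ab] by blast
  have AC: "\<bar>Re (cinner (A x) x)\<bar> \<le> C * (norm x)\<^sup>2" if "x \<in> S" for x
    using Re_cinner_le[of "A x" x] mult_right_mono[OF C(2)[OF that] norm_ge_zero[of x]]
    by (simp add: power2_eq_square mult.assoc)
  define T where "T = {t. \<exists>K\<ge>0. \<forall>x\<in>S. Re (cinner (A x) x) \<le> t * (norm x)\<^sup>2 + K * Re (cinner (N x) x)}"
  have "\<forall>x\<in>S. Re (cinner (A x) x) \<le> C * (norm x)\<^sup>2 + 0 * Re (cinner (N x) x)"
    using AC by (fastforce simp: abs_le_iff)
  then have CT: "C \<in> T" unfolding T_def by blast
  \<comment> \<open>For \<open>t\<close> below \<open>- C\<close> the inequality defining
    \<open>T\<close> would bound the form of \<open>N\<close> from below, against \<open>nc\<close>.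
    The divisor \<open>K + 1\<close> is positive even for \<open>K = 0\<close>.\<close>
  have T_ge: "- C \<le> t" if t: "t \<in> T" for t
  proof (rule ccontr)
    assume "\<not> - C \<le> t"
    then have d: "- C - t > 0" by simp
    obtain K where K: "K \<ge> 0"
      "\<And>x. x \<in> S \<Longrightarrow> Re (cinner (A x) x) \<le> t * (norm x)\<^sup>2 + K * Re (cinner (N x) x)"
      using t unfolding T_def by blast
    have "(- C - t) / (K + 1) * (norm x)\<^sup>2 \<le> Re (cinner (N x) x)" if x: "x \<in> S" for x
    proof -
      have "(- C - t) * (norm x)\<^sup>2 \<le> K * Re (cinner (N x) x)"
        using K(2)[OF x] AC[OF x] by (simp add: abs_le_iff left_diff_distrib)
      also have "\<dots> \<le> (K + 1) * Re (cinner (N x) x)"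
        using n(2)[OF x] by (simp add: distrib_right)
      finally show ?thesis using K(1) by (simp add: field_simps)
    qed
    moreover have "(- C - t) / (K + 1) > 0" using d K(1) by simp
    ultimately show False using nc unfolding coercive_on_def by blast
  qed
  define l where "l = Inf T"
  have bdd: "bdd_below T" using T_ge by (intro bdd_belowI[of _ "- C"]) blast
  have l_le: "l \<le> t" if "t \<in> T" for t unfolding l_def by (rule cInf_lower[OF that bdd])
  define Y where "Y x = l *\<^sub>R x - A x" for x
  have Ysa: "selfadjoint_on S Y"
    unfolding Y_def by (intro selfadjoint_on_diff selfadjoint_on_scaleR selfadjoint_on_id S A)
  note Yb = selfadjoint_onD(1)[OF Ysa]
  note Yl = bounded_opD[OF Yb] bounded_op_linear[OF Yb S]
  have YN: "Y (N x) = N (Y x)" if "x \<in> S" for x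
    using that by (simp add: Y_def comm Nl(6)[OF cs(7) Al(1)] Nl(7))
  have YY: "Re (cinner (A (A x - l *\<^sub>R x) - l *\<^sub>R (A x - l *\<^sub>R x)) x) = (norm (Y x))\<^sup>2" if "x \<in> S" for x
  proof -
    have "A (A x - l *\<^sub>R x) - l *\<^sub>R (A x - l *\<^sub>R x) = Y (Y x)"
      using that by (simp add: Y_def Al cs algebra_simps)
    then show ?thesis using selfadjoint_onD(2)[OF Ysa Yl(1)[OF that] that] by (simp add: Re_cinner_self)
  qed
  have "\<not> coercive_on S (\<lambda>x. N x + (A (A x - l *\<^sub>R x) - l *\<^sub>R (A x - l *\<^sub>R x)))"
  proof
    assume "coercive_on S (\<lambda>x. N x + (A (A x - l *\<^sub>R x) - l *\<^sub>R (A x - l *\<^sub>R x)))"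
    then obtain c where c: "c > 0"
      "\<And>x. x \<in> S \<Longrightarrow> c * (norm x)\<^sup>2 \<le> Re (cinner (N x) x) + (norm (Y x))\<^sup>2"
      unfolding coercive_on_def by (auto simp: cinner_add_left YY)
    obtain D where D: "D > 0" "\<And>x. x \<in> S \<Longrightarrow> norm (Y x) \<le> D * norm x"
      using bounded_op_bound[OF Yb] by blast
    have YD: "\<bar>Re (cinner (Y x) x)\<bar> \<le> D * (norm x)\<^sup>2" if "x \<in> S" for x
      using Re_cinner_le[of "Y x" x] mult_right_mono[OF D(2)[OF that] norm_ge_zero[of x]]
      by (simp add: power2_eq_square mult.assoc)
    \<comment> \<open>This value makes the error \<open>e * (2 * D * (norm x)\<^sup>2)\<close> half
      of the assumed coercivity bound \<open>c * (norm x)\<^sup>2\<close>.\<close>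
    define e where "e = c / (4 * D)"
    have e: "e > 0" using c D by (simp add: e_def)
    have "T \<noteq> {}" using CT by blast
    then obtain t where t: "t \<in> T" "t < l + e"
      using e cInf_lessD[of T "l + e"] unfolding l_def by fastforce
    then obtain K where K: "K \<ge> 0"
      "\<And>x. x \<in> S \<Longrightarrow> Re (cinner (A x) x) \<le> t * (norm x)\<^sup>2 + K * Re (cinner (N x) x)"
      unfolding T_def by blast
    define P where "P x = Y x + e *\<^sub>R x + K *\<^sub>R N x" for x
    have Psa: "selfadjoint_on S P" unfolding P_def
      by (intro selfadjoint_on_add selfadjoint_on_scaleR selfadjoint_on_id S Ysa n(1))
    have P: "positive_op S P"
      unfolding positive_op_iff[OF S]
    proof (intro conjI ballI Psa)
      fix x assume x: "x \<in> S"
      have "t * (norm x)\<^sup>2 \<le> (l + e) * (norm x)\<^sup>2" using t(2) by (intro mult_right_mono) auto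
      then show "0 \<le> Re (cinner (P x) x)"
        using K(2)[OF x]
        by (simp add: P_def Y_def cinner_add_left cinner_diff_left cinner_scaleR_left Re_cinner_self
            distrib_right)
    qed
    have Q1: "positive_op S (\<lambda>x. D *\<^sub>R x - Y x)"
      unfolding positive_op_iff[OF S]
    proof (intro conjI ballI)
      show "selfadjoint_on S (\<lambda>x. D *\<^sub>R x - Y x)"
        by (intro selfadjoint_on_diff selfadjoint_on_scaleR selfadjoint_on_id S Ysa)
      show "0 \<le> Re (cinner (D *\<^sub>R x - Y x) x)" if "x \<in> S" for x
        using YD[OF that] by (simp add: cinner_diff_left cinner_scaleR_left Re_cinner_self abs_le_iff)
    qed
    have Q2: "positive_op S (\<lambda>x. D *\<^sub>R x + Y x)"
      unfolding positive_op_iff[OF S]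
    proof (intro conjI ballI)
      show "selfadjoint_on S (\<lambda>x. D *\<^sub>R x + Y x)"
        by (intro selfadjoint_on_add selfadjoint_on_scaleR selfadjoint_on_id S Ysa)
      show "0 \<le> Re (cinner (D *\<^sub>R x + Y x) x)" if "x \<in> S" for x
        using YD[OF that] by (simp add: cinner_add_left cinner_scaleR_left Re_cinner_self abs_le_iff)
    qed
    \<comment> \<open>This product controls the mixed term \<open>N (Y x)\<close> that appears when
      the product with \<open>P\<close> is expanded.\<close>
    have NQ: "positive_op S (\<lambda>x. N (D *\<^sub>R x + Y x))"
    proof (rule positive_op_commuting_product[OF S N Q2])
      show "N (D *\<^sub>R x + Y x) = D *\<^sub>R N x + Y (N x)" if "x \<in> S" for x
        using that by (simp add: Nl(2)[OF cs(7) Yl(1)] Nl(7) YN)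
    qed
    have PQ: "positive_op S (\<lambda>x. P (D *\<^sub>R x - Y x))"
    proof (rule positive_op_commuting_product[OF S P Q1])
      fix x assume x: "x \<in> S"
      show "P (D *\<^sub>R x - Y x) = D *\<^sub>R P x - Y (P x)"
        using x Yl(1)[OF x] Yl(1)[OF Yl(1)[OF x]] Nl(1)[OF x] cs
        by (simp add: P_def Nl(6)[OF cs(7) Yl(1)] Nl(7) YN Yl(2,6,7) algebra_simps)
    qed
    \<comment> \<open>Positivity of the product with \<open>P\<close> bounds \<open>D\<close> times
      the form of \<open>Y\<close> below by the squared norm of \<open>Y x\<close> minus error
      terms. The assumed coercivity bounds that square below by \<open>c * (norm x)\<^sup>2\<close>
      up to a multiple of the form of \<open>N\<close>, and half of it survives. Since
      \<open>Y\<close> is \<open>l - A\<close>, this lowers the admissible \<open>t\<close> by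
      \<open>c / (2 * D)\<close>.\<close>
    have "Re (cinner (A x) x) \<le> (l - c / (2 * D)) * (norm x)\<^sup>2 + (1 + 2 * K * D) / D * Re (cinner (N x) x)"
      if x: "x \<in> S" for x
    proof -
      let ?n = "Re (cinner (N x) x)" and ?ny = "Re (cinner (N (Y x)) x)" and ?y = "Re (cinner (Y x) x)"
      have y: "Y x \<in> S" using Yl(1)[OF x] .
      have "cinner (Y (Y x)) x = cinner (Y x) (Y x)" by (rule selfadjoint_onD(2)[OF Ysa y x])
      then have yy: "Re (cinner (Y (Y x)) x) = (norm (Y x))\<^sup>2" by (simp add: Re_cinner_self)
      have "0 \<le> Re (cinner (P (D *\<^sub>R x - Y x)) x)" by (rule positive_opD(2)[OF S PQ x])
      also have "P (D *\<^sub>R x - Y x) = D *\<^sub>R Y x - Y (Y x) + e *\<^sub>R (D *\<^sub>R x - Y x) + K *\<^sub>R (D *\<^sub>R N x - N (Y x))"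
        using x by (simp add: P_def Yl(6)[OF cs(7) y] Yl(7) Nl(6)[OF cs(7) y] Nl(7))
      finally have 1: "0 \<le> D * ?y - (norm (Y x))\<^sup>2 + e * (D * (norm x)\<^sup>2 - ?y) + K * (D * ?n - ?ny)"
        by (simp add: cinner_add_left cinner_diff_left cinner_scaleR_left yy Re_cinner_self)
      have "0 \<le> Re (cinner (N (D *\<^sub>R x + Y x)) x)" by (rule positive_opD(2)[OF S NQ x])
      then have "- ?ny \<le> D * ?n"
        using x by (simp add: Nl(2)[OF cs(7) y] Nl(7) cinner_add_left cinner_scaleR_left)
      then have 2: "K * (D * ?n - ?ny) \<le> K * (2 * D * ?n)"
        using K(1) by (intro mult_left_mono) auto
      have "- ?y \<le> D * (norm x)\<^sup>2" using YD[OF x] by (simp add: abs_le_iff)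
      then have "e * (D * (norm x)\<^sup>2 - ?y) \<le> e * (2 * D * (norm x)\<^sup>2)"
        using e by (intro mult_left_mono) auto
      also have "\<dots> = c / 2 * (norm x)\<^sup>2" using D(1) by (simp add: e_def)
      finally have "c / 2 * (norm x)\<^sup>2 - (1 + 2 * K * D) * ?n \<le> D * ?y"
        using 1 2 c(2)[OF x] by (simp add: algebra_simps)
      then have "(c / 2 * (norm x)\<^sup>2 - (1 + 2 * K * D) * ?n) / D \<le> ?y"
        using D(1) by (simp add: divide_le_eq mult.commute)
      then have "c / (2 * D) * (norm x)\<^sup>2 - (1 + 2 * K * D) / D * ?n \<le> ?y"
        by (simp add: diff_divide_distrib)
      moreover have "Re (cinner (A x) x) = l * (norm x)\<^sup>2 - ?y"
        by (simp add: Y_def cinner_diff_left cinner_scaleR_left Re_cinner_self)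
      ultimately show ?thesis by (simp add: left_diff_distrib)
    qed
    moreover have "(1 + 2 * K * D) / D \<ge> 0" using D(1) K(1) by simp
    ultimately have "l - c / (2 * D) \<in> T" unfolding T_def by blast
    then have "l \<le> l - c / (2 * D)" by (rule l_le)
    then show False using c(1) D(1) by (simp add: divide_le_0_iff)
  qed
  then show ?thesis by blast
qed

text \<open>Start from \<open>g\<close> minus the square of \<open>G\<close>, with \<open>g\<close>
  the squared norm of \<open>G\<close> on \<open>S\<close>: it is positive, and optimality of
  \<open>g\<close> is its failure of coercivity. Each extension adds the square of
  \<open>A - l\<close> or \<open>B - m\<close> and keeps the failure. By the last conclusion all
  summands are nonnegative, so a small total makes each of them small on the same vector.\<close>

lemma joint_approximate_eigenvector:
  fixes S :: "'a::complex_hilbert set"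
  assumes S: "closed_csubspace S" and G: "selfadjoint_on S G" and G0: "x0 \<in> S" "G x0 \<noteq> 0"
    and A: "selfadjoint_on S A" and B: "selfadjoint_on S B"
    and AG: "\<And>x. x \<in> S \<Longrightarrow> A (G x) = G (A x)" and BG: "\<And>x. x \<in> S \<Longrightarrow> B (G x) = G (B x)"
    and AB: "\<And>x. x \<in> S \<Longrightarrow> A (B x) = B (A x)"
  obtains g l m where "g > 0"
    "\<And>e. e > 0 \<Longrightarrow> \<exists>x\<in>S. g * (norm x)\<^sup>2 - (norm (G x))\<^sup>2 + (norm (A x - l *\<^sub>R x))\<^sup>2
        + (norm (B x - m *\<^sub>R x))\<^sup>2 < e * (norm x)\<^sup>2"
    "\<And>x. x \<in> S \<Longrightarrow> (norm (G x))\<^sup>2 \<le> g * (norm x)\<^sup>2"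
proof -
  note cs = closed_csubspaceD[OF S]
  note Gl = bounded_opD[OF selfadjoint_onD(1)[OF G]] bounded_op_linear[OF selfadjoint_onD(1)[OF G] S]
  note Al = bounded_opD[OF selfadjoint_onD(1)[OF A]] bounded_op_linear[OF selfadjoint_onD(1)[OF A] S]
  note Bl = bounded_opD[OF selfadjoint_onD(1)[OF B]] bounded_op_linear[OF selfadjoint_onD(1)[OF B] S]
  have G2: "Re (cinner (G (G x)) x) = (norm (G x))\<^sup>2" if "x \<in> S" for x
    using selfadjoint_onD(2)[OF G Gl(1)[OF that] that] by (simp add: Re_cinner_self)
  obtain C where C: "C > 0" "\<And>x. x \<in> S \<Longrightarrow> norm (G x) \<le> C * norm x"
    using bounded_op_bound[OF selfadjoint_onD(1)[OF G]] by blast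
  \<comment> \<open>The infimum of this set is the squared operator norm of \<open>G\<close> on
    \<open>S\<close>; the vector \<open>x0\<close> makes it strictly positive.\<close>
  define T where "T = {t. \<forall>x\<in>S. (norm (G x))\<^sup>2 \<le> t * (norm x)\<^sup>2}"
  define g where "g = Inf T"
  have x0: "x0 \<noteq> 0" using G0 Gl(4) by metis
  have "C\<^sup>2 \<in> T"
    using C power_mono[OF C(2), of _ 2] by (auto simp: T_def power_mult_distrib)
  then have Tne: "T \<noteq> {}" by blast
  have Tge: "(norm (G x0))\<^sup>2 / (norm x0)\<^sup>2 \<le> t" if "t \<in> T" for t
    using that G0(1) x0 unfolding T_def by (simp add: divide_le_eq)
  then have bdd: "bdd_below T" by (rule bdd_belowI)
  have "0 < (norm (G x0))\<^sup>2 / (norm x0)\<^sup>2" using G0(2) x0 by simp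
  also have "\<dots> \<le> g" unfolding g_def by (rule cInf_greatest[OF Tne Tge])
  finally have g0: "g > 0" .
  have gG: "(norm (G x))\<^sup>2 \<le> g * (norm x)\<^sup>2" if x: "x \<in> S" for x
  proof (cases "x = 0")
    case False
    have "(norm (G x))\<^sup>2 / (norm x)\<^sup>2 \<le> t" if "t \<in> T" for t
      using that x False unfolding T_def by (simp add: divide_le_eq)
    then have "(norm (G x))\<^sup>2 / (norm x)\<^sup>2 \<le> g" unfolding g_def by (intro cInf_greatest[OF Tne])
    then show ?thesis using False by (simp add: divide_le_eq)
  qed (simp add: Gl(4))
  define N0 where "N0 x = g *\<^sub>R x - G (G x)" for x
  have N0q: "Re (cinner (N0 x) x) = g * (norm x)\<^sup>2 - (norm (G x))\<^sup>2" if "x \<in> S" for x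
    using that by (simp add: N0_def cinner_diff_left cinner_scaleR_left Re_cinner_self G2)
  have N0: "positive_op S N0"
    unfolding positive_op_iff[OF S]
  proof (intro conjI ballI)
    show "selfadjoint_on S N0" unfolding N0_def
      by (intro selfadjoint_on_diff selfadjoint_on_scaleR selfadjoint_on_id S
          selfadjoint_on_compose[OF G G refl])
  qed (simp add: N0q gG)
  have nc0: "\<not> coercive_on S N0"
  proof
    assume "coercive_on S N0"
    then obtain c where c: "c > 0" "\<And>x. x \<in> S \<Longrightarrow> c * (norm x)\<^sup>2 \<le> g * (norm x)\<^sup>2 - (norm (G x))\<^sup>2"
      unfolding coercive_on_def using N0q by auto
    then have "g - c \<in> T" unfolding T_def by (fastforce simp: left_diff_distrib)
    then have "g \<le> g - c" unfolding g_def by (rule cInf_lower[OF _ bdd])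
    then show False using c(1) by simp
  qed
  have AN0: "A (N0 x) = N0 (A x)" if "x \<in> S" for x
    using that by (simp add: N0_def Al(6)[OF cs(7) Gl(1)] Al(7) AG Gl(1) Al(1))
  obtain l where l: "\<not> coercive_on S (\<lambda>x. N0 x + (A (A x - l *\<^sub>R x) - l *\<^sub>R (A x - l *\<^sub>R x)))"
    using not_coercive_extend[OF S N0 nc0 A AN0] by blast
  define A1 where "A1 x = A x - l *\<^sub>R x" for x
  have A1: "selfadjoint_on S A1" unfolding A1_def
    by (intro selfadjoint_on_diff selfadjoint_on_scaleR selfadjoint_on_id S A)
  define N1 where "N1 x = N0 x + A1 (A1 x)" for x
  have N1: "positive_op S N1"
    unfolding N1_def by (intro positive_op_add[OF S N0] positive_op_square S A1)
  have nc1: "\<not> coercive_on S N1" using l unfolding N1_def A1_def .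
  have A1S: "A1 x \<in> S" if "x \<in> S" for x
    using bounded_opD(1)[OF selfadjoint_onD(1)[OF A1] that] .
  have BA1: "B (A1 x) = A1 (B x)" if "x \<in> S" for x
    using that by (simp add: A1_def Bl(6)[OF Al(1) cs(7)] Bl(7) AB)
  have N0S: "N0 x \<in> S" if "x \<in> S" for x using bounded_opD(1)[OF positive_opD(3)[OF S N0] that] .
  have BN0: "B (N0 x) = N0 (B x)" if "x \<in> S" for x
    using that by (simp add: N0_def Bl(6)[OF cs(7) Gl(1)] Bl(7) BG Gl(1) Bl(1))
  have BN1: "B (N1 x) = N1 (B x)" if "x \<in> S" for x
    using that by (simp add: N1_def Bl(2)[OF N0S A1S] A1S BA1 BN0 Bl(1))
  obtain m where m: "\<not> coercive_on S (\<lambda>x. N1 x + (B (B x - m *\<^sub>R x) - m *\<^sub>R (B x - m *\<^sub>R x)))"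
    using not_coercive_extend[OF S N1 nc1 B BN1] by blast
  define B1 where "B1 x = B x - m *\<^sub>R x" for x
  have B1: "selfadjoint_on S B1" unfolding B1_def
    by (intro selfadjoint_on_diff selfadjoint_on_scaleR selfadjoint_on_id S B)
  have q: "Re (cinner (N1 x + B1 (B1 x)) x) = g * (norm x)\<^sup>2 - (norm (G x))\<^sup>2 + (norm (A1 x))\<^sup>2 + (norm (B1 x))\<^sup>2"
    if x: "x \<in> S" for x
    using x selfadjoint_onD(2)[OF A1 A1S[OF x] x]
      selfadjoint_onD(2)[OF B1 bounded_opD(1)[OF selfadjoint_onD(1)[OF B1] x] x]
    by (simp add: N1_def cinner_add_left N0q Re_cinner_self)
  have "\<exists>x\<in>S. g * (norm x)\<^sup>2 - (norm (G x))\<^sup>2 + (norm (A x - l *\<^sub>R x))\<^sup>2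
        + (norm (B x - m *\<^sub>R x))\<^sup>2 < e * (norm x)\<^sup>2" if "e > 0" for e
    using m that unfolding coercive_on_def B1_def[symmetric] A1_def[symmetric]
    by (metis q not_le)
  then show ?thesis by (rule that[OF g0 _ gG])
qed

text \<open>The closed sets \<open>F k\<close> cover the space, so by Baire's theorem one of them
  contains a ball, on which the functionals given by the \<open>u n\<close> are uniformly
  bounded.\<close>

lemma weakly_bounded_imp_bounded:
  fixes u :: "nat \<Rightarrow> 'a::complex_hilbert"
  assumes "\<And>w. \<exists>K. \<forall>n. cmod (cinner w (u n)) \<le> K"
  obtains K where "\<And>n. norm (u n) \<le> K"
proof -
  define F where "F k = {w. \<forall>n. cmod (cinner w (u n)) \<le> real k}" for k
  have F_closed: "closed (F k)" for k
  proof -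
    have "closed {w. cmod (cinner w (u n)) \<le> real k}" for n
      by (intro closed_Collect_le continuous_intros
          linear_continuous_on[OF bounded_bilinear.bounded_linear_left[OF bounded_bilinear_cinner]])
    moreover have "F k = (\<Inter>n. {w. cmod (cinner w (u n)) \<le> real k})" by (auto simp: F_def)
    ultimately show ?thesis by (auto intro: closed_INT)
  qed
  have "\<exists>k. w \<in> F k" for w
  proof -
    obtain K where "\<And>n. cmod (cinner w (u n)) \<le> K" using assms by blast
    moreover obtain k where "K \<le> real k" using real_arch_simple by blast
    ultimately show ?thesis unfolding F_def using order_trans by blast
  qed
  then have "\<Union>(range F) = UNIV" by blast
  have "\<exists>k. interior (F k) \<noteq> {}"
  proof (rule ccontr)
    assume "\<nexists>k. interior (F k) \<noteq> {}"
    then have "euclidean interior_of \<Union>(range F) = {}"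
      using F_closed completely_metrizable_space_euclidean
      by (intro Baire_category_alt) auto
    then show False using \<open>\<Union>(range F) = UNIV\<close> by simp
  qed
  then obtain k w where "w \<in> interior (F k)" by blast
  then obtain r where r: "r > 0" "cball w r \<subseteq> F k" by (auto simp: mem_interior_cball)
  have "norm (u n) \<le> 2 * real k / r" for n
  proof (cases "u n = 0")
    case False
    \<comment> \<open>\<open>u n\<close> rescaled to the radius of the ball pairs with
      \<open>u n\<close> to \<open>r * norm (u n)\<close>; writing it as a difference of two points
      of the ball costs the factor 2.\<close>
    define z where "z = (r / norm (u n)) *\<^sub>R u n"
    have "norm z = r" using r False by (simp add: z_def)
    then have "w + z \<in> cball w r" "w \<in> cball w r" using r by (auto simp: dist_norm)
    then have "cmod (cinner (w + z) (u n)) \<le> k" "cmod (cinner w (u n)) \<le> k"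
      using r(2) unfolding F_def by blast+
    then have "cmod (cinner z (u n)) \<le> 2 * k"
      using norm_triangle_ineq4[of "cinner (w + z) (u n)" "cinner w (u n)"] by (simp add: cinner_add_left)
    moreover have "cinner z (u n) = of_real (r * norm (u n))"
      using False by (simp add: z_def cinner_scaleR_left cinner_norm power2_eq_square)
    ultimately have "r * norm (u n) \<le> 2 * k" using r by (simp del: of_real_mult)
    then show ?thesis using r by (simp add: field_simps)
  qed (use r in simp)
  then show ?thesis by (rule that)
qed

text \<open>If no lower bound existed, some vectors \<open>u n\<close> of unbounded norm would have
  bounded images under \<open>A\<close> and \<open>B\<close>. Writing an arbitrary vector of
  \<open>S\<close> as \<open>A z - B y\<close> and moving the operators to \<open>u n\<close> shows
  that the \<open>u n\<close> are weakly bounded, contradicting uniform boundedness.\<close>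

lemma koszul1_surj_imp_bounded_below:
  fixes S :: "'a::complex_hilbert set"
  assumes S: "closed_csubspace S" and A: "selfadjoint_on S A" and B: "selfadjoint_on S B"
    and surj: "koszul1 A B ` (S \<times> S) = S"
  shows "\<exists>c>0. \<forall>x\<in>S. c * (norm x)\<^sup>2 \<le> (norm (A x))\<^sup>2 + (norm (B x))\<^sup>2"
proof (rule ccontr)
  note cs = closed_csubspaceD[OF S]
  note Al = bounded_opD[OF selfadjoint_onD(1)[OF A]] bounded_op_linear[OF selfadjoint_onD(1)[OF A] S]
  note Bl = bounded_opD[OF selfadjoint_onD(1)[OF B]] bounded_op_linear[OF selfadjoint_onD(1)[OF B] S]
  assume nb: "\<not> ?thesis"
  have below: "\<exists>x\<in>S. (norm (A x))\<^sup>2 + (norm (B x))\<^sup>2 < c * (norm x)\<^sup>2" if "c > 0" for c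
    using nb that by (meson not_le)
  have "\<forall>n. \<exists>x\<in>S. (norm (A x))\<^sup>2 + (norm (B x))\<^sup>2 < (1 / (real (Suc n))\<^sup>2) * (norm x)\<^sup>2"
    by (intro allI below) simp
  then obtain x where x: "\<And>n. x n \<in> S"
    "\<And>n. (norm (A (x n)))\<^sup>2 + (norm (B (x n)))\<^sup>2 < (1 / (real (Suc n))\<^sup>2) * (norm (x n))\<^sup>2"
    by metis
  have x0: "x n \<noteq> 0" for n
  proof
    assume "x n = 0"
    then show False using x(2)[of n] by (simp add: Al(4) Bl(4))
  qed
  \<comment> \<open>The threshold \<open>1 / (real (Suc n))\<^sup>2\<close> was chosen so that
    stretching to length \<open>Suc n\<close> leaves both images in the unit ball.\<close>
  define u where "u n = (real (Suc n) / norm (x n)) *\<^sub>R x n" for n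
  have u: "u n \<in> S" "norm (u n) = real (Suc n)" for n
    using x(1)[of n] x0[of n] cs(7) by (auto simp: u_def)
  have small: "norm (A (u n)) \<le> 1" "norm (B (u n)) \<le> 1" for n
  proof -
    have "(norm (A (x n)))\<^sup>2 \<le> (norm (x n) / real (Suc n))\<^sup>2" "(norm (B (x n)))\<^sup>2 \<le> (norm (x n) / real (Suc n))\<^sup>2"
      using x(2)[of n] zero_le_power2[of "norm (A (x n))"] zero_le_power2[of "norm (B (x n))"]
      unfolding power_divide times_divide_eq_left mult_1 by linarith+
    then have "norm (A (x n)) \<le> norm (x n) / real (Suc n)" "norm (B (x n)) \<le> norm (x n) / real (Suc n)"
      by (auto intro: power2_le_imp_le)
    then show "norm (A (u n)) \<le> 1" "norm (B (u n)) \<le> 1"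
      using x0[of n] by (auto simp: u_def Al(7)[OF x(1)] Bl(7)[OF x(1)] field_simps)
  qed
  have "\<exists>K. \<forall>n. cmod (cinner w (u n)) \<le> K" for w
  proof -
    \<comment> \<open>The test vector \<open>w\<close> comes from the ambient space, whereas
      surjectivity concerns \<open>S\<close>; its projection onto \<open>S\<close> has the same
      inner products with the \<open>u n\<close>.\<close>
    obtain p where p: "p \<in> S" "\<And>y. y \<in> S \<Longrightarrow> cinner (w - p) y = 0"
      using orthogonal_projection_exists[OF S] by blast
    obtain y z where yz: "y \<in> S" "z \<in> S" "p = A z - B y"
      using p(1) surj unfolding koszul1_def by force
    have "cmod (cinner w (u n)) \<le> norm z + norm y" for n
    proof -
      have "cinner w (u n) = cinner p (u n)" using p(2)[OF u(1)[of n]] by (simp add: cinner_diff_left)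
      also have "\<dots> = cinner z (A (u n)) - cinner y (B (u n))"
        using selfadjoint_onD(2)[OF A yz(2) u(1)[of n]] selfadjoint_onD(2)[OF B yz(1) u(1)[of n]]
        by (simp add: yz(3) cinner_diff_left)
      also have "cmod \<dots> \<le> norm z * norm (A (u n)) + norm y * norm (B (u n))"
        using norm_triangle_ineq4[of "cinner z (A (u n))" "cinner y (B (u n))"]
          Cauchy_Schwarz_cinner[of z "A (u n)"] Cauchy_Schwarz_cinner[of y "B (u n)"] by linarith
      also have "\<dots> \<le> norm z * 1 + norm y * 1"
        using small[of n] by (intro add_mono mult_left_mono) auto
      finally show ?thesis by simp
    qed
    then show ?thesis by blast
  qed
  then obtain K where K: "\<And>n. norm (u n) \<le> K" using weakly_bounded_imp_bounded[of u] by blast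
  obtain n where "K < real n" using reals_Archimedean2 by blast
  then show False using K[of n] u(2)[of n] by simp
qed

text \<open>The maps sending \<open>(x, y)\<close> to \<open>A' x + B' y\<close> and
  \<open>z\<close> to \<open>(- B' z, A' z)\<close> form, after composition with the inverse of
  \<open>A' A + B' B\<close>, a contracting homotopy of the Koszul complex. The commutation
  relations let \<open>A\<close> and \<open>B\<close> pass through this operator.\<close>

lemma koszul_exactI:
  fixes S :: "'a::complex_hilbert set"
  assumes S: "closed_csubspace S"
    and A: "bounded_op S S A" and B: "bounded_op S S B"
    and A': "bounded_op S S A'" and B': "bounded_op S S B'"
    and AB: "\<And>x. x \<in> S \<Longrightarrow> A (B x) = B (A x)" and AA': "\<And>x. x \<in> S \<Longrightarrow> A (A' x) = A' (A x)"
    and AB': "\<And>x. x \<in> S \<Longrightarrow> A (B' x) = B' (A x)" and BA': "\<And>x. x \<in> S \<Longrightarrow> B (A' x) = A' (B x)"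
    and BB': "\<And>x. x \<in> S \<Longrightarrow> B (B' x) = B' (B x)"
    and inj: "\<And>x. x \<in> S \<Longrightarrow> A' (A x) + B' (B x) = 0 \<Longrightarrow> x = 0"
    and surj: "(\<lambda>x. A' (A x) + B' (B x)) ` S = S"
  shows "koszul_exact S A B"
  unfolding koszul_exact_def
proof (intro conjI)
  note cs = closed_csubspaceD[OF S]
  note Al = bounded_opD[OF A] bounded_op_linear[OF A S]
  note Bl = bounded_opD[OF B] bounded_op_linear[OF B S]
  note A'l = bounded_opD[OF A'] bounded_op_linear[OF A' S]
  note B'l = bounded_opD[OF B'] bounded_op_linear[OF B' S]
  show "{x \<in> S. koszul0 A B x = (0, 0)} = {0}"
  proof
    show "{x \<in> S. koszul0 A B x = (0, 0)} \<subseteq> {0}"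
      using inj A'l(4) B'l(4) by (auto simp: koszul0_def)
    show "{0} \<subseteq> {x \<in> S. koszul0 A B x = (0, 0)}"
      using cs(2) Al(4) Bl(4) by (simp add: koszul0_def)
  qed
  show "{p \<in> S \<times> S. koszul1 A B p = 0} = koszul0 A B ` S"
  proof
    show "koszul0 A B ` S \<subseteq> {p \<in> S \<times> S. koszul1 A B p = 0}"
      using Al(1) Bl(1) AB by (auto simp: koszul0_def koszul1_def)
    show "{p \<in> S \<times> S. koszul1 A B p = 0} \<subseteq> koszul0 A B ` S"
    proof
      fix p assume "p \<in> {p \<in> S \<times> S. koszul1 A B p = 0}"
      then obtain x y where p: "p = (x, y)" and x: "x \<in> S" and y: "y \<in> S" and eq: "A y = B x"
        by (auto simp: koszul1_def)
      have "A' x + B' y \<in> S" using cs(3)[OF A'l(1)[OF x] B'l(1)[OF y]] .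
      then have "A' x + B' y \<in> (\<lambda>x. A' (A x) + B' (B x)) ` S" by (simp only: surj)
      then obtain z where z: "z \<in> S" "A' x + B' y = A' (A z) + B' (B z)" by (rule imageE)
      have Sm: "A z - x \<in> S" "B z - y \<in> S" using cs(6) Al(1) Bl(1) x y z(1) by auto
      \<comment> \<open>Since \<open>A y = B x\<close>, applying \<open>A\<close> to
        \<open>A' x + B' y\<close> gives the operator \<open>A' A + B' B\<close> at
        \<open>x\<close>. It therefore takes the same value at \<open>A z\<close> and at
        \<open>x\<close>, and injectivity yields \<open>A z = x\<close>; the other coordinate is
        symmetric.\<close>
      have "A' (A (A z)) + B' (B (A z)) = A (A' (A z) + B' (B z))"
        using z(1) by (simp add: Al(2)[OF A'l(1)[OF Al(1)] B'l(1)[OF Bl(1)]] AA' AB' Al(1) Bl(1) AB)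
      also have "\<dots> = A (A' x + B' y)" by (simp only: z(2))
      also have "\<dots> = A' (A x) + B' (B x)"
        using x y by (simp add: Al(2)[OF A'l(1) B'l(1)] AA' AB' eq)
      finally have "A' (A (A z - x)) + B' (B (A z - x)) = 0"
        using x z(1) by (simp add: Al(6)[OF Al(1)] Bl(6)[OF Al(1)] A'l(6)[OF Al(1)[OF Al(1)] Al(1)]
            B'l(6)[OF Bl(1)[OF Al(1)] Bl(1)] algebra_simps)
      then have 1: "A z = x" using inj[OF Sm(1)] by simp
      have "A' (A (B z)) + B' (B (B z)) = B (A' (A z) + B' (B z))"
        using z(1) by (simp add: Bl(2)[OF A'l(1)[OF Al(1)] B'l(1)[OF Bl(1)]] BA' BB' Al(1) Bl(1) AB)
      also have "\<dots> = B (A' x + B' y)" by (simp only: z(2))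
      also have "\<dots> = A' (A y) + B' (B y)"
        using x y by (simp add: Bl(2)[OF A'l(1) B'l(1)] BA' BB' eq)
      finally have "A' (A (B z - y)) + B' (B (B z - y)) = 0"
        using y z(1) by (simp add: Al(6)[OF Bl(1)] Bl(6)[OF Bl(1)] A'l(6)[OF Al(1)[OF Bl(1)] Al(1)]
            B'l(6)[OF Bl(1)[OF Bl(1)] Bl(1)] algebra_simps)
      then have 2: "B z = y" using inj[OF Sm(2)] by simp
      show "p \<in> koszul0 A B ` S" using 1 2 z(1) by (auto simp: p koszul0_def)
    qed
  qed
  show "koszul1 A B ` (S \<times> S) = S"
  proof
    show "koszul1 A B ` (S \<times> S) \<subseteq> S" using Al(1) Bl(1) cs(6) by (auto simp: koszul1_def)
    show "S \<subseteq> koszul1 A B ` (S \<times> S)"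
    proof
      fix y assume "y \<in> S"
      then have "y \<in> (\<lambda>x. A' (A x) + B' (B x)) ` S" by (simp only: surj)
      then obtain z where z: "y = A' (A z) + B' (B z)" "z \<in> S" by (rule imageE)
      have "y = koszul1 A B (- B' z, A' z)"
        using z by (simp add: koszul1_def Bl(5)[OF B'l(1)] AA' BB')
      moreover have "(- B' z, A' z) \<in> S \<times> S" using A'l(1) B'l(1) cs(5) z(2) by auto
      ultimately show "y \<in> koszul1 A B ` (S \<times> S)" by blast
    qed
  qed
qed

text \<open>For selfadjoint operators the adjoints of the shifts are the shifts by the conjugate
  numbers, and they commute with the shifts for all complex \<open>l\<close> and \<open>m\<close>.
  The form of the resulting \<open>N\<close> is the sum of squares in the hypothesis, so
  \<open>N\<close> is selfadjoint and bounded below, hence bijective on \<open>S\<close>.\<close>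

lemma koszul_exact_shiftI:
  fixes S :: "'a::complex_hilbert set"
  assumes S: "closed_csubspace S" and A: "selfadjoint_on S A" and B: "selfadjoint_on S B"
    and AB: "\<And>x. x \<in> S \<Longrightarrow> A (B x) = B (A x)" and c: "c > 0"
    and below: "\<And>x. x \<in> S \<Longrightarrow> c * (norm x)\<^sup>2 \<le> (norm (A x - l *\<^sub>C x))\<^sup>2 + (norm (B x - m *\<^sub>C x))\<^sup>2"
  shows "koszul_exact S (\<lambda>x. A x - l *\<^sub>C x) (\<lambda>x. B x - m *\<^sub>C x)"
proof -
  note cs = closed_csubspaceD[OF S]
  note Ab = selfadjoint_onD(1)[OF A] and Bb = selfadjoint_onD(1)[OF B]
  note Al = bounded_opD[OF Ab] bounded_op_linear[OF Ab S]
  note Bl = bounded_opD[OF Bb] bounded_op_linear[OF Bb S]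
  have A_shift: "bounded_op S S (\<lambda>x. A x - k *\<^sub>C x)" and B_shift: "bounded_op S S (\<lambda>x. B x - k *\<^sub>C x)" for k
    by (intro bounded_op_diff bounded_op_scaleC bounded_op_id S Ab Bb)+
  have A_adj: "cinner (A x - k *\<^sub>C x) y = cinner x (A y - cnj k *\<^sub>C y)"
    and B_adj: "cinner (B x - k *\<^sub>C x) y = cinner x (B y - cnj k *\<^sub>C y)"
    if "x \<in> S" "y \<in> S" for k x y
    using selfadjoint_onD(2)[OF A that] selfadjoint_onD(2)[OF B that] by (simp_all add: cinner_simps)
  have AA: "A (A x - j *\<^sub>C x) - k *\<^sub>C (A x - j *\<^sub>C x) = A (A x - k *\<^sub>C x) - j *\<^sub>C (A x - k *\<^sub>C x)"
    and BB: "B (B x - j *\<^sub>C x) - k *\<^sub>C (B x - j *\<^sub>C x) = B (B x - k *\<^sub>C x) - j *\<^sub>C (B x - k *\<^sub>C x)"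
    and ABs: "A (B x - j *\<^sub>C x) - k *\<^sub>C (B x - j *\<^sub>C x) = B (A x - k *\<^sub>C x) - j *\<^sub>C (A x - k *\<^sub>C x)"
    if x: "x \<in> S" for j k x
    using AB[OF x]
    by (simp_all add: Al(6)[OF Al(1)[OF x] cs(4)[OF x]] Bl(6)[OF Bl(1)[OF x] cs(4)[OF x]]
        Al(6)[OF Bl(1)[OF x] cs(4)[OF x]] Bl(6)[OF Al(1)[OF x] cs(4)[OF x]] Al(3)[OF x] Bl(3)[OF x]
        scaleC_diff_right scaleC_scaleC mult.commute)
  define N where "N x = (A (A x - l *\<^sub>C x) - cnj l *\<^sub>C (A x - l *\<^sub>C x))
    + (B (B x - m *\<^sub>C x) - cnj m *\<^sub>C (B x - m *\<^sub>C x))" for x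
  note As = bounded_opD(1)[OF A_shift] and Bs = bounded_opD(1)[OF B_shift]
  have Nq: "cinner (N x) y = cinner (A x - l *\<^sub>C x) (A y - l *\<^sub>C y) + cinner (B x - m *\<^sub>C x) (B y - m *\<^sub>C y)"
    if "x \<in> S" "y \<in> S" for x y
    unfolding N_def cinner_add_left A_adj[OF As[OF that(1)] that(2)] B_adj[OF Bs[OF that(1)] that(2)]
    by simp
  have N: "selfadjoint_on S N"
    unfolding selfadjoint_on_def
  proof (intro conjI ballI)
    show "bounded_op S S N"
      unfolding N_def
      by (intro bounded_op_add[OF S] bounded_op_compose[OF A_shift A_shift] bounded_op_compose[OF B_shift B_shift])
    fix x y assume xy: "x \<in> S" "y \<in> S"
    have "cinner x (N y) = cnj (cinner (N y) x)" by (rule cinner_commute)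
    also have "\<dots> = cinner (A x - l *\<^sub>C x) (A y - l *\<^sub>C y) + cinner (B x - m *\<^sub>C x) (B y - m *\<^sub>C y)"
      unfolding Nq[OF xy(2,1)] complex_cnj_add
      by (simp only: cinner_commute[of "A x - l *\<^sub>C x" "A y - l *\<^sub>C y"]
          cinner_commute[of "B x - m *\<^sub>C x" "B y - m *\<^sub>C y"])
    finally show "cinner (N x) y = cinner x (N y)" using Nq[OF xy] by simp
  qed
  have N_below: "c * norm x \<le> norm (N x)" if x: "x \<in> S" for x
  proof (cases "x = 0")
    case False
    have "c * (norm x)\<^sup>2 \<le> Re (cinner (N x) x)" using below[OF x] by (simp add: Nq x Re_cinner_self)
    also have "\<dots> \<le> norm (N x) * norm x" using Re_cinner_le[of "N x" x] by linarith
    finally show ?thesis using False by (simp add: power2_eq_square)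
  qed simp
  have surj: "N ` S = S" by (rule selfadjoint_bounded_below_surj[OF S N c N_below])
  show ?thesis
  proof (rule koszul_exactI[OF S A_shift B_shift A_shift[of "cnj l"] B_shift[of "cnj m"]])
    show "(\<lambda>x. (A (A x - l *\<^sub>C x) - cnj l *\<^sub>C (A x - l *\<^sub>C x))
        + (B (B x - m *\<^sub>C x) - cnj m *\<^sub>C (B x - m *\<^sub>C x))) ` S = S"
      using surj unfolding N_def .
    show "x = 0" if "x \<in> S" "(A (A x - l *\<^sub>C x) - cnj l *\<^sub>C (A x - l *\<^sub>C x))
        + (B (B x - m *\<^sub>C x) - cnj m *\<^sub>C (B x - m *\<^sub>C x)) = 0" for x
      using N_below[OF that(1)] that(2) c unfolding N_def by (simp add: mult_le_0_iff)
  qed (use AA BB ABs in auto)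
qed

text \<open>Real shifts keep both operators selfadjoint, so surjectivity of the last Koszul map can
  be tested against the shifted operators themselves.\<close>

lemma koszul_exact_real_shiftD:
  fixes S :: "'a::complex_hilbert set"
  assumes S: "closed_csubspace S" and A: "selfadjoint_on S A" and B: "selfadjoint_on S B"
    and ex: "koszul_exact S (\<lambda>x. A x - of_real l *\<^sub>C x) (\<lambda>x. B x - of_real m *\<^sub>C x)"
  shows "\<exists>c>0. \<forall>x\<in>S. c * (norm x)\<^sup>2 \<le> (norm (A x - l *\<^sub>R x))\<^sup>2 + (norm (B x - m *\<^sub>R x))\<^sup>2"
proof (rule koszul1_surj_imp_bounded_below[OF S])
  show "selfadjoint_on S (\<lambda>x. A x - l *\<^sub>R x)" "selfadjoint_on S (\<lambda>x. B x - m *\<^sub>R x)"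
    by (intro selfadjoint_on_diff selfadjoint_on_scaleR selfadjoint_on_id S A B)+
  show "koszul1 (\<lambda>x. A x - l *\<^sub>R x) (\<lambda>x. B x - m *\<^sub>R x) ` (S \<times> S) = S"
    using ex unfolding koszul_exact_def scaleR_scaleC by blast
qed

section \<open>The Taylor spectrum of a commuting pair of positive operators\<close>

lemma approximate_eigenvalue_positive_op:
  assumes A: "positive_op S A"
    and approx: "\<And>c. c > 0 \<Longrightarrow> \<exists>x\<in>S. x \<noteq> 0 \<and> norm (A x - l *\<^sub>C x) \<le> c * norm x"
  shows "l \<in> \<real>\<^sub>\<ge>\<^sub>0"
proof -
  have "l \<in> closure \<real>\<^sub>\<ge>\<^sub>0"
    unfolding closure_approachable
  proof (intro allI impI)
    fix e :: real assume "e > 0"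
    then obtain x where x: "x \<in> S" "x \<noteq> 0" "norm (A x - l *\<^sub>C x) \<le> e / 2 * norm x"
      using approx[of "e / 2"] by auto
    \<comment> \<open>The Rayleigh quotient of \<open>x\<close> is real and nonnegative, and by
      Cauchy-Schwarz it differs from \<open>l\<close> by at most the relative error of
      \<open>x\<close> as an eigenvector.\<close>
    define z where "z = cinner (A x) x / of_real ((norm x)\<^sup>2)"
    have "of_real ((norm x)\<^sup>2) \<in> (\<real>\<^sub>\<ge>\<^sub>0 :: complex set)" by (simp del: of_real_power)
    then have "z \<in> \<real>\<^sub>\<ge>\<^sub>0"
      unfolding z_def using A x(1) by (intro nonneg_Reals_divide_I) (auto simp: positive_op_def)
    moreover have "cinner (A x - l *\<^sub>C x) x = (z - l) * of_real ((norm x)\<^sup>2)"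
      using x(2) by (simp add: z_def cinner_simps cinner_norm left_diff_distrib)
    then have "cmod (z - l) * (norm x)\<^sup>2 = cmod (cinner (A x - l *\<^sub>C x) x)"
      by (simp add: norm_mult norm_power)
    then have "cmod (z - l) * (norm x)\<^sup>2 \<le> (e / 2 * norm x) * norm x"
      using Cauchy_Schwarz_cinner[of "A x - l *\<^sub>C x" x] mult_right_mono[OF x(3) norm_ge_zero[of x]]
      by linarith
    then have "cmod (z - l) * (norm x)\<^sup>2 \<le> e / 2 * (norm x)\<^sup>2" by (simp add: power2_eq_square)
    then have "cmod (z - l) \<le> e / 2" using x(2) by simp
    then have "dist z l < e" using \<open>e > 0\<close> by (simp add: dist_norm)
    ultimately show "\<exists>y\<in>\<real>\<^sub>\<ge>\<^sub>0. dist y l < e" by blast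
  qed
  then show ?thesis using closed_nonneg_Reals_complex by simp
qed

text \<open>With \<open>p(s, t) = (s^2 - 1) (s^2 + t^2 - 1)\<close>, the operator
  \<open>p(A, B)\<close> minus the number \<open>p(l, m)\<close> is a combination of
  \<open>A - l\<close> and \<open>B - m\<close> with bounded operator coefficients on the left.
  Joint approximate eigenvectors of the pair are therefore approximate eigenvectors of
  \<open>p(A, B)\<close>.\<close>

lemma polynomial_eigenvalue_estimate:
  fixes S :: "'a::complex_hilbert set"
  assumes S: "closed_csubspace S" and A: "bounded_op S S A" and B: "bounded_op S S B"
    and D: "\<And>x. x \<in> S \<Longrightarrow> D x = A (A x) + B (B x) - x"
  shows "\<exists>M\<ge>0. \<forall>x\<in>S. norm (A (A (D x)) - D x - ((l\<^sup>2 - 1) * (l\<^sup>2 + m\<^sup>2 - 1)) *\<^sub>C x)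
    \<le> M * (norm (A x - l *\<^sub>C x) + norm (B x - m *\<^sub>C x))"
proof -
  note cs = closed_csubspaceD[OF S]
  note Al = bounded_opD[OF A] bounded_op_linear[OF A S]
  note Bl = bounded_opD[OF B] bounded_op_linear[OF B S]
  obtain a where a: "a > 0" "\<And>x. x \<in> S \<Longrightarrow> norm (A x) \<le> a * norm x"
    using bounded_op_bound[OF A] by blast
  obtain b where b: "b > 0" "\<And>x. x \<in> S \<Longrightarrow> norm (B x) \<le> b * norm x"
    using bounded_op_bound[OF B] by blast
  define d where "d = l\<^sup>2 + m\<^sup>2 - 1"
  \<comment> \<open>A common bound for the norms of \<open>A + l\<close> and \<open>B + m\<close>,
    the cofactors in the factorization of a difference of squares.\<close>
  define k where "k = a + cmod l + (b + cmod m)"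
  have k: "0 \<le> k" using a b by (simp add: k_def)
  have square: "norm (C (C x) - (j\<^sup>2) *\<^sub>C x) \<le> k * norm (C x - j *\<^sub>C x)"
    if C: "bounded_op S S C" and c: "\<And>x. x \<in> S \<Longrightarrow> norm (C x) \<le> c * norm x" "c + cmod j \<le> k"
      and x: "x \<in> S" for C c j x
  proof -
    note Cl = bounded_opD[OF C] bounded_op_linear[OF C S]
    let ?y = "C x - j *\<^sub>C x"
    have y: "?y \<in> S" using Cl(1) x cs by simp
    have "C (C x) - (j\<^sup>2) *\<^sub>C x = C ?y + j *\<^sub>C ?y"
      using x by (simp add: Cl(6)[OF Cl(1) cs(4)] Cl(3) scaleC_diff_right scaleC_scaleC power2_eq_square)
    then have "norm (C (C x) - (j\<^sup>2) *\<^sub>C x) \<le> norm (C ?y) + cmod j * norm ?y"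
      using norm_triangle_ineq[of "C ?y" "j *\<^sub>C ?y"] by simp
    also have "\<dots> \<le> (c + cmod j) * norm ?y" using c(1)[OF y] by (simp add: distrib_right)
    also have "\<dots> \<le> k * norm ?y" using c(2) by (intro mult_right_mono) auto
    finally show ?thesis .
  qed
  have A2: "norm (A (A x) - (l\<^sup>2) *\<^sub>C x) \<le> k * norm (A x - l *\<^sub>C x)" if "x \<in> S" for x
    by (rule square[OF A a(2) _ that]) (use b in \<open>auto simp: k_def\<close>)
  have B2: "norm (B (B x) - (m\<^sup>2) *\<^sub>C x) \<le> k * norm (B x - m *\<^sub>C x)" if "x \<in> S" for x
    by (rule square[OF B b(2) _ that]) (use a in \<open>auto simp: k_def\<close>)
  have "norm (A (A (D x)) - D x - ((l\<^sup>2 - 1) * d) *\<^sub>C x)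
      \<le> ((a\<^sup>2 + 1) * k + cmod d * k) * (norm (A x - l *\<^sub>C x) + norm (B x - m *\<^sub>C x))"
    if x: "x \<in> S" for x
  proof -
    let ?\<alpha> = "norm (A x - l *\<^sub>C x)" and ?\<beta> = "norm (B x - m *\<^sub>C x)"
    define y where "y = D x - d *\<^sub>C x"
    have y_eq: "y = (A (A x) - (l\<^sup>2) *\<^sub>C x) + (B (B x) - (m\<^sup>2) *\<^sub>C x)"
      by (simp add: y_def D[OF x] d_def scaleC_add_left scaleC_diff_left)
    have Dx: "D x \<in> S" unfolding D[OF x] using cs(3,6) Al(1) Bl(1) x by simp
    have yS: "y \<in> S" using Dx x cs by (simp add: y_def)
    have y: "norm y \<le> k * (?\<alpha> + ?\<beta>)"
      unfolding y_eq using A2[OF x] B2[OF x]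
        norm_triangle_ineq[of "A (A x) - (l\<^sup>2) *\<^sub>C x" "B (B x) - (m\<^sup>2) *\<^sub>C x"]
      by (simp add: distrib_left)
    have "norm (A (A y)) \<le> a * (a * norm y)"
      using a(2)[OF Al(1)[OF yS]] mult_left_mono[OF a(2)[OF yS], of a] a(1) by linarith
    then have AAy: "norm (A (A y) - y) \<le> (a\<^sup>2 + 1) * norm y"
      using norm_triangle_ineq4[of "A (A y)" y] by (simp add: power2_eq_square distrib_right)
    \<comment> \<open>This is the splitting (A^2 - 1) (D - d) + d (A^2 - l^2), with \<open>y\<close>
      the value of \<open>D - d\<close> at \<open>x\<close>.\<close>
    have "A (A (D x)) - D x - ((l\<^sup>2 - 1) * d) *\<^sub>C x = (A (A y) - y) + d *\<^sub>C (A (A x) - (l\<^sup>2) *\<^sub>C x)"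
    proof -
      have "A (A y) = A (A (D x)) - d *\<^sub>C A (A x)"
        using Dx x by (simp add: y_def Al(6)[OF _ cs(4)] Al(6)[OF Al(1) cs(4)[OF Al(1)]] Al(3)[OF Al(1)] Al(3))
      then show ?thesis
        by (simp add: y_def scaleC_diff_right scaleC_scaleC scaleC_diff_left left_diff_distrib right_diff_distrib mult.commute)
    qed
    then have "norm (A (A (D x)) - D x - ((l\<^sup>2 - 1) * d) *\<^sub>C x)
        \<le> norm (A (A y) - y) + cmod d * norm (A (A x) - (l\<^sup>2) *\<^sub>C x)"
      using norm_triangle_ineq[of "A (A y) - y" "d *\<^sub>C (A (A x) - (l\<^sup>2) *\<^sub>C x)"] by simp
    also have "\<dots> \<le> (a\<^sup>2 + 1) * (k * (?\<alpha> + ?\<beta>)) + cmod d * (k * (?\<alpha> + ?\<beta>))"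
    proof (rule add_mono)
      show "norm (A (A y) - y) \<le> (a\<^sup>2 + 1) * (k * (?\<alpha> + ?\<beta>))"
        using AAy mult_left_mono[OF y, of "a\<^sup>2 + 1"] by fastforce
      have "k * ?\<alpha> \<le> k * (?\<alpha> + ?\<beta>)" using k by (intro mult_left_mono) auto
      then show "cmod d * norm (A (A x) - (l\<^sup>2) *\<^sub>C x) \<le> cmod d * (k * (?\<alpha> + ?\<beta>))"
        using A2[OF x] by (intro mult_left_mono) auto
    qed
    finally show ?thesis by (simp add: distrib_right mult.assoc)
  qed
  moreover have "0 \<le> (a\<^sup>2 + 1) * k + cmod d * k" using k by simp
  ultimately show ?thesis unfolding d_def by blast
qed

lemma taylor_spectrum_subset_iff:
  fixes S :: "'a::complex_hilbert set"
  assumes S: "closed_csubspace S" and A: "positive_op S A" and B: "positive_op S B"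
    and AB: "\<And>x. x \<in> S \<Longrightarrow> A (B x) = B (A x)"
    and D: "\<And>x. x \<in> S \<Longrightarrow> D x = A (A x) + B (B x) - x"
  shows "taylor_spectrum S A B \<subseteq>
      (\<lambda>(s, t). (complex_of_real s, complex_of_real t)) ` (T_plus \<union> {1} \<times> {0..}) \<longleftrightarrow>
    (\<forall>x\<in>S. A (A (D x)) - D x = 0)"
proof
  note cs = closed_csubspaceD[OF S]
  note Asa = positive_opD(1)[OF S A] and Bsa = positive_opD(1)[OF S B]
  note Ab = positive_opD(3)[OF S A] and Bb = positive_opD(3)[OF S B]
  note Al = bounded_opD[OF Ab] bounded_op_linear[OF Ab S]
  note Bl = bounded_opD[OF Bb] bounded_op_linear[OF Bb S]
  {
    assume zero: "\<forall>x\<in>S. A (A (D x)) - D x = 0"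
    show "taylor_spectrum S A B \<subseteq>
      (\<lambda>(s, t). (complex_of_real s, complex_of_real t)) ` (T_plus \<union> {1} \<times> {0..})"
    proof
      fix lm assume "lm \<in> taylor_spectrum S A B"
      then obtain l m where lm: "lm = (l, m)"
        and nex: "\<not> koszul_exact S (\<lambda>x. A x - l *\<^sub>C x) (\<lambda>x. B x - m *\<^sub>C x)"
        unfolding taylor_spectrum_def by blast
      have small: "\<exists>x\<in>S. x \<noteq> 0 \<and> norm (A x - l *\<^sub>C x) \<le> c * norm x \<and> norm (B x - m *\<^sub>C x) \<le> c * norm x"
        if c: "c > 0" for c
      proof -
        have "c\<^sup>2 > 0" using c by simp
        have "\<not> (\<forall>x\<in>S. c\<^sup>2 * (norm x)\<^sup>2 \<le> (norm (A x - l *\<^sub>C x))\<^sup>2 + (norm (B x - m *\<^sub>C x))\<^sup>2)"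
          using koszul_exact_shiftI[OF S Asa Bsa AB \<open>c\<^sup>2 > 0\<close>] nex by blast
        then obtain x where x: "x \<in> S"
          "(norm (A x - l *\<^sub>C x))\<^sup>2 + (norm (B x - m *\<^sub>C x))\<^sup>2 < (c * norm x)\<^sup>2"
          by (auto simp: not_le power_mult_distrib)
        have "(norm (A x - l *\<^sub>C x))\<^sup>2 \<le> (c * norm x)\<^sup>2" "(norm (B x - m *\<^sub>C x))\<^sup>2 \<le> (c * norm x)\<^sup>2"
          using x(2) zero_le_power2[of "norm (A x - l *\<^sub>C x)"] zero_le_power2[of "norm (B x - m *\<^sub>C x)"]
          by linarith+
        then have "norm (A x - l *\<^sub>C x) \<le> c * norm x" "norm (B x - m *\<^sub>C x) \<le> c * norm x"
          using c by (auto intro: power2_le_imp_le)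
        moreover have "x \<noteq> 0" using x(2) by (auto simp: Al(4) Bl(4))
        ultimately show ?thesis using x(1) by blast
      qed
      \<comment> \<open>Points of the Taylor spectrum are arbitrary complex pairs by definition;
        only as approximate eigenvalues of positive operators are their coordinates seen to be
        nonnegative reals.\<close>
      have "l \<in> \<real>\<^sub>\<ge>\<^sub>0" by (rule approximate_eigenvalue_positive_op[OF A]) (use small in blast)
      then obtain s where s: "l = of_real s" "s \<ge> 0" by (rule nonneg_Reals_cases)
      have "m \<in> \<real>\<^sub>\<ge>\<^sub>0" by (rule approximate_eigenvalue_positive_op[OF B]) (use small in blast)
      then obtain t where t: "m = of_real t" "t \<ge> 0" by (rule nonneg_Reals_cases)
      let ?p = "(l\<^sup>2 - 1) * (l\<^sup>2 + m\<^sup>2 - 1)"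
      obtain M where M: "M \<ge> 0" "\<And>x. x \<in> S \<Longrightarrow> norm (A (A (D x)) - D x - ?p *\<^sub>C x)
          \<le> M * (norm (A x - l *\<^sub>C x) + norm (B x - m *\<^sub>C x))"
        using polynomial_eigenvalue_estimate[OF S Ab Bb D, of l m] by blast
      have *: "cmod ?p \<le> M * 2 * c" if c: "c > 0" for c
      proof -
        obtain x where x: "x \<in> S" "x \<noteq> 0" "norm (A x - l *\<^sub>C x) \<le> c * norm x"
          "norm (B x - m *\<^sub>C x) \<le> c * norm x" using small[OF c] by blast
        have "cmod ?p * norm x \<le> M * (norm (A x - l *\<^sub>C x) + norm (B x - m *\<^sub>C x))"
          using M(2)[OF x(1)] bspec[OF zero x(1)] by (simp del: norm_mult)
        also have "\<dots> \<le> M * (c * norm x + c * norm x)" using x M(1) by (intro mult_left_mono add_mono)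
        finally have "cmod ?p * norm x \<le> M * 2 * c * norm x" by (simp add: algebra_simps)
        then show ?thesis using x(2) by simp
      qed
      have "cmod ?p \<le> 0"
      proof (rule field_le_epsilon)
        fix e :: real assume e: "e > 0"
        \<comment> \<open>The summand 1 keeps the quotient meaningful when
          \<open>M = 0\<close>.\<close>
        have "cmod ?p \<le> M * 2 * (e / (2 * M + 1))"
          by (rule *) (use e M(1) in simp)
        also have "\<dots> \<le> e" using e M(1) by (simp add: field_simps)
        finally show "cmod ?p \<le> 0 + e" by simp
      qed
      then have "complex_of_real ((s\<^sup>2 - 1) * (s\<^sup>2 + t\<^sup>2 - 1)) = 0" using s t by simp
      then have "(s\<^sup>2 - 1) * (s\<^sup>2 + t\<^sup>2 - 1) = 0" by (simp only: of_real_eq_0_iff)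
      then have "s = 1 \<or> s\<^sup>2 + t\<^sup>2 = 1" using s(2) by (auto simp: power2_eq_1_iff)
      then have "(s, t) \<in> T_plus \<union> {1} \<times> {0..}" using s(2) t(2) by (auto simp: T_plus_def)
      then show "lm \<in> (\<lambda>(s, t). (complex_of_real s, complex_of_real t)) ` (T_plus \<union> {1} \<times> {0..})"
        unfolding lm s(1) t(1) by force
    qed
  next
    assume sub: "taylor_spectrum S A B \<subseteq>
      (\<lambda>(s, t). (complex_of_real s, complex_of_real t)) ` (T_plus \<union> {1} \<times> {0..})"
    define R where "R x = A (A x)" for x
    define G where "G x = R (D x) - D x" for x
    have R: "selfadjoint_on S R" unfolding R_def by (rule selfadjoint_on_compose[OF Asa Asa refl])
    have "selfadjoint_on S (\<lambda>x. A (A x) + B (B x) - x)"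
      by (intro selfadjoint_on_diff selfadjoint_on_add selfadjoint_on_id S
          selfadjoint_on_compose[OF Asa Asa refl] selfadjoint_on_compose[OF Bsa Bsa refl])
    then have Dsa: "selfadjoint_on S D" by (rule selfadjoint_on_cong[OF S _ D])
    note DS = bounded_opD(1)[OF selfadjoint_onD(1)[OF Dsa]]
    have BBA: "B (B (A x)) = A (B (B x))" "A (A (B x)) = B (A (A x))" if "x \<in> S" for x
      using that by (simp_all add: AB Al(1) Bl(1) flip: AB)
    have AD: "A (D x) = D (A x)" if x: "x \<in> S" for x
      using x cs(3) Al(1) Bl(1) BBA(1)[OF x] by (simp add: D Al(6) Al(2))
    have BD: "B (D x) = D (B x)" if x: "x \<in> S" for x
      using x cs(3) Al(1) Bl(1) BBA(2)[OF x] by (simp add: D Bl(6) Bl(2))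
    have RD: "R (D x) = D (R x)" if "x \<in> S" for x
      using that Al(1) by (simp add: R_def AD)
    have Gsa: "selfadjoint_on S G"
      unfolding G_def by (intro selfadjoint_on_diff S Dsa selfadjoint_on_compose[OF R Dsa RD])
    have AG: "A (G x) = G (A x)" if x: "x \<in> S" for x
      using x DS Al(1) by (simp add: G_def R_def Al(6) AD)
    have BG: "B (G x) = G (B x)" if x: "x \<in> S" for x
      using DS[OF x] Al(1) BBA(2)[OF DS[OF x]] by (simp add: G_def R_def Bl(6) BD[OF x])
    show "\<forall>x\<in>S. A (A (D x)) - D x = 0"
    proof (rule ccontr)
      assume "\<not> (\<forall>x\<in>S. A (A (D x)) - D x = 0)"
      then obtain x0 where x0: "x0 \<in> S" "G x0 \<noteq> 0" unfolding G_def R_def by blast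
      obtain g l m where g: "g > 0"
        and approx: "\<And>e. e > 0 \<Longrightarrow> \<exists>x\<in>S. g * (norm x)\<^sup>2 - (norm (G x))\<^sup>2 + (norm (A x - l *\<^sub>R x))\<^sup>2
          + (norm (B x - m *\<^sub>R x))\<^sup>2 < e * (norm x)\<^sup>2"
        and gG: "\<And>x. x \<in> S \<Longrightarrow> (norm (G x))\<^sup>2 \<le> g * (norm x)\<^sup>2"
        using joint_approximate_eigenvector[OF S Gsa x0 Asa Bsa AG BG AB] by blast
      \<comment> \<open>Exactness would give a lower bound \<open>c\<close> for the two shifts,
        which the vectors found for \<open>e = c\<close> violate because the \<open>G\<close> part
        of the sum is nonnegative.\<close>
      have "\<not> koszul_exact S (\<lambda>x. A x - of_real l *\<^sub>C x) (\<lambda>x. B x - of_real m *\<^sub>C x)"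
      proof
        assume "koszul_exact S (\<lambda>x. A x - of_real l *\<^sub>C x) (\<lambda>x. B x - of_real m *\<^sub>C x)"
        then obtain c where c: "c > 0"
          "\<And>x. x \<in> S \<Longrightarrow> c * (norm x)\<^sup>2 \<le> (norm (A x - l *\<^sub>R x))\<^sup>2 + (norm (B x - m *\<^sub>R x))\<^sup>2"
          using koszul_exact_real_shiftD[OF S Asa Bsa] by blast
        obtain x where "x \<in> S" "g * (norm x)\<^sup>2 - (norm (G x))\<^sup>2 + (norm (A x - l *\<^sub>R x))\<^sup>2
          + (norm (B x - m *\<^sub>R x))\<^sup>2 < c * (norm x)\<^sup>2" using approx[OF c(1)] by blast
        then show False using c(2)[of x] gG[of x] by linarith
      qed
      then have "(complex_of_real l, complex_of_real m) \<in> taylor_spectrum S A B"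
        by (simp add: taylor_spectrum_def)
      then have "(l, m) \<in> T_plus \<union> {1} \<times> {0..}" using sub by auto
      then have p0: "((complex_of_real l)\<^sup>2 - 1) * ((complex_of_real l)\<^sup>2 + (complex_of_real m)\<^sup>2 - 1) = 0"
        by (auto simp: T_plus_def simp flip: of_real_power of_real_add)
      obtain M where M: "M \<ge> 0" "\<And>x. x \<in> S \<Longrightarrow> norm (G x) \<le> M * (norm (A x - l *\<^sub>R x) + norm (B x - m *\<^sub>R x))"
        using polynomial_eigenvalue_estimate[OF S Ab Bb D, of "of_real l" "of_real m"]
        unfolding p0 by (auto simp: G_def R_def scaleR_scaleC)
      \<comment> \<open>On an approximate eigenvector the squared norm of \<open>G x\<close> is at
        most \<open>2 * M\<^sup>2 * e\<close> times that of \<open>x\<close>, but it also exceeds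
        \<open>g - e\<close> times that of \<open>x\<close>. The choice
        \<open>e * (1 + 2 * M\<^sup>2) = g\<close> makes these bounds collide.\<close>
      define e where "e = g / (1 + 2 * M\<^sup>2)"
      have den: "1 + 2 * M\<^sup>2 > 0" by (simp add: add_pos_nonneg)
      have e: "e > 0" using g den by (simp add: e_def)
      obtain x where x: "x \<in> S" "g * (norm x)\<^sup>2 - (norm (G x))\<^sup>2 + (norm (A x - l *\<^sub>R x))\<^sup>2
          + (norm (B x - m *\<^sub>R x))\<^sup>2 < e * (norm x)\<^sup>2" using approx[OF e] by blast
      let ?a = "norm (A x - l *\<^sub>R x)" and ?b = "norm (B x - m *\<^sub>R x)"
      have ab: "?a\<^sup>2 + ?b\<^sup>2 \<le> e * (norm x)\<^sup>2" using x(2) gG[OF x(1)] by linarith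
      have "(norm (G x))\<^sup>2 \<le> (M * (?a + ?b))\<^sup>2" using M(2)[OF x(1)] by (intro power_mono) auto
      also have "\<dots> = M\<^sup>2 * (?a + ?b)\<^sup>2" by (simp add: power_mult_distrib)
      also have "\<dots> \<le> M\<^sup>2 * (2 * (?a\<^sup>2 + ?b\<^sup>2))"
        using zero_le_power2[of "?a - ?b"] by (intro mult_left_mono) (auto simp: power2_eq_square algebra_simps)
      also have "\<dots> \<le> M\<^sup>2 * (2 * (e * (norm x)\<^sup>2))" using ab by (intro mult_left_mono) auto
      finally have "g * (norm x)\<^sup>2 < e * (norm x)\<^sup>2 + M\<^sup>2 * (2 * (e * (norm x)\<^sup>2))"
        using x(2) zero_le_power2[of ?a] zero_le_power2[of ?b] by linarith
      also have "\<dots> = (e * (1 + 2 * M\<^sup>2)) * (norm x)\<^sup>2" by (simp add: algebra_simps)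
      also have "e * (1 + 2 * M\<^sup>2) = g" using den by (simp add: e_def)
      finally show False by simp
    qed
  }
qed

section \<open>Reducing subspaces and the Wold decomposition\<close>

text \<open>\<open>A'\<close> is any formal adjoint of \<open>A\<close> on \<open>S\<close>, which
  covers both \<open>adj_on S A\<close> and, for selfadjoint operators, \<open>A\<close>
  itself.\<close>

lemma reducesI:
  fixes S :: "'a::complex_hilbert set"
  assumes M: "closed_csubspace M" "M \<subseteq> S" and A: "\<And>x. x \<in> S \<Longrightarrow> A x \<in> S"
    and adj: "\<And>x y. x \<in> S \<Longrightarrow> y \<in> S \<Longrightarrow> cinner (A x) y = cinner x (A' y)"
    and inv: "A ` M \<subseteq> M" "A' ` M \<subseteq> M"
  shows "reduces S M A"
  unfolding reduces_def
proof (intro conjI M inv(1))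
  show "A ` orth_minus S M \<subseteq> orth_minus S M"
  proof
    fix y assume "y \<in> A ` orth_minus S M"
    then obtain x where x: "y = A x" "x \<in> S" "\<And>z. z \<in> M \<Longrightarrow> cinner x z = 0"
      by (auto simp: orth_minus_def)
    have "cinner (A x) z = 0" if "z \<in> M" for z
    proof -
      have "z \<in> S" "A' z \<in> M" using that M(2) inv(2) by auto
      then show ?thesis using adj[OF x(2)] x(3) by simp
    qed
    then show "y \<in> orth_minus S M" using A x by (simp add: orth_minus_def)
  qed
qed

text \<open>The adjoint maps \<open>M\<close> into the double complement of \<open>M\<close>,
  because \<open>A\<close> preserves the complement; for closed \<open>M\<close> the double
  complement is \<open>M\<close>.\<close>

lemma reduces_adj_on_invariant:
  fixes S :: "'a::complex_hilbert set"
  assumes S: "closed_csubspace S" and A: "bounded_op S S A" and red: "reduces S M A"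
  shows "adj_on S A ` M \<subseteq> M"
proof
  have M: "closed_csubspace M" "M \<subseteq> S" "A ` orth_minus S M \<subseteq> orth_minus S M"
    using red by (auto simp: reduces_def)
  fix y assume "y \<in> adj_on S A ` M"
  then obtain x where x: "y = adj_on S A x" "x \<in> M" by blast
  have "cinner y z = 0" if z: "z \<in> orth_minus S M" for z
  proof -
    have "z \<in> S" using z by (simp add: orth_minus_def)
    moreover have "A z \<in> orth_minus S M" using M(3) z by blast
    then have "cinner (A z) x = 0" using x(2) by (simp add: orth_minus_def)
    ultimately show ?thesis
      using cinner_adj_on_left[OF S A, of z x] cinner_eq_0_commute x(1) by metis
  qed
  then have "y \<in> orth_minus S (orth_minus S M)"
    using adj_on_in[OF S A] x(1) by (auto simp: orth_minus_def)
  then show "y \<in> M" using orth_minus_orth_minus[OF S M(1,2)] by simp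
qed

text \<open>This bridges the two adjoints in play: isometries and spherical isometries on a summand
  are stated with \<open>adj_on M\<close>, while the algebraic relations of the class live on the
  whole of \<open>S\<close>.\<close>

lemma adj_on_reduces:
  fixes S :: "'a::complex_hilbert set"
  assumes S: "closed_csubspace S" and A: "bounded_op S S A" and red: "reduces S M A" and y: "y \<in> M"
  shows "adj_on M A y = adj_on S A y"
proof (rule adj_on_eqI)
  have M: "closed_csubspace M" "M \<subseteq> S" "A ` M \<subseteq> M" using red by (auto simp: reduces_def)
  show "closed_csubspace M" by (rule M(1))
  show "bounded_op M M A" by (rule bounded_op_subset[OF A M(2,3)])
  show "adj_on S A y \<in> M" using reduces_adj_on_invariant[OF S A red] y by blast
  show "cinner (A z) y = cinner z (adj_on S A y)" if "z \<in> M" for z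
    using cinner_adj_on[OF S A] that M(2) by blast
qed

lemma reduces_orth_minus:
  fixes S :: "'a::complex_hilbert set"
  assumes S: "closed_csubspace S" and red: "reduces S M A"
  shows "reduces S (orth_minus S M) A"
proof -
  have M: "closed_csubspace M" "M \<subseteq> S" "A ` M \<subseteq> M" using red by (auto simp: reduces_def)
  show ?thesis
    using red closed_csubspace_orth_minus[OF S] unfolding reduces_def orth_minus_orth_minus[OF S M(1,2)]
    by (auto simp: orth_minus_def)
qed

text \<open>The kernel is the orthogonal complement of the range, and such complements are closed
  subspaces.\<close>

lemma selfadjoint_on_kernel:
  fixes S :: "'a::complex_hilbert set"
  assumes S: "closed_csubspace S" and Z: "selfadjoint_on S Z"
  shows "closed_csubspace {x \<in> S. Z x = 0}"
proof -
  note Zl = bounded_opD[OF selfadjoint_onD(1)[OF Z]]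
  have "{x \<in> S. Z x = 0} = orth_minus S (Z ` S)"
  proof (intro set_eqI iffI)
    fix x assume "x \<in> {x \<in> S. Z x = 0}"
    then show "x \<in> orth_minus S (Z ` S)"
      by (auto simp: orth_minus_def simp flip: selfadjoint_onD(2)[OF Z])
  next
    fix x assume x: "x \<in> orth_minus S (Z ` S)"
    then have xS: "x \<in> S" by (simp add: orth_minus_def)
    have "cinner (Z x) (Z x) = cinner x (Z (Z x))" by (rule selfadjoint_onD(2)[OF Z xS Zl(1)[OF xS]])
    also have "\<dots> = 0" using x Zl(1)[OF xS] by (simp add: orth_minus_def)
    finally show "x \<in> {x \<in> S. Z x = 0}" using xS by simp
  qed
  then show ?thesis using closed_csubspace_orth_minus[OF S] by simp
qed

lemma adj_on_commute_selfadjoint: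
  fixes S :: "'a::complex_hilbert set"
  assumes S: "closed_csubspace S" and A: "bounded_op S S A" and C: "selfadjoint_on S C"
    and comm: "\<And>x. x \<in> S \<Longrightarrow> A (C x) = C (A x)" and x: "x \<in> S"
  shows "adj_on S A (C x) = C (adj_on S A x)"
proof (rule adj_on_eqI[OF S A])
  note Cl = bounded_opD[OF selfadjoint_onD(1)[OF C]]
  note adj = adj_on_in[OF S A]
  show "C (adj_on S A x) \<in> S" using Cl(1)[OF adj] .
  fix z assume z: "z \<in> S"
  have "cinner (A z) (C x) = cinner (C (A z)) x"
    using selfadjoint_onD(2)[OF C bounded_opD(1)[OF A z] x] by simp
  also have "\<dots> = cinner (A (C z)) x" by (simp add: comm[OF z])
  also have "\<dots> = cinner (C z) (adj_on S A x)" by (rule cinner_adj_on[OF S A Cl(1)[OF z]])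
  also have "\<dots> = cinner z (C (adj_on S A x))" by (rule selfadjoint_onD(2)[OF C z adj])
  finally show "cinner (A z) (C x) = cinner z (C (adj_on S A x))" .
qed

text \<open>The hypotheses put \<open>D q - P q\<close> into the kernel of \<open>D\<close> for
  every \<open>q\<close>. For \<open>q\<close> orthogonal to this kernel the forms of
  \<open>D\<close> and \<open>P\<close> therefore agree, and the component of \<open>x\<close> in
  the kernel contributes nothing to the form of \<open>D\<close>.\<close>

lemma positive_op_if_square_eq:
  fixes S :: "'a::complex_hilbert set"
  assumes S: "closed_csubspace S" and D: "selfadjoint_on S D" and P: "positive_op S P"
    and comm: "\<And>x. x \<in> S \<Longrightarrow> D (P x) = P (D x)"
    and eq: "\<And>x. x \<in> S \<Longrightarrow> D (D x) = P (D x)"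
  shows "positive_op S D"
  unfolding positive_op_iff[OF S]
proof (intro conjI ballI D)
  fix x assume x: "x \<in> S"
  note cs = closed_csubspaceD[OF S]
  note Db = selfadjoint_onD(1)[OF D] and p = positive_opD[OF S P]
  note Dl = bounded_opD[OF Db] bounded_op_linear[OF Db S]
  note Pl = bounded_opD[OF p(3)] bounded_op_linear[OF p(3) S]
  obtain k where k: "k \<in> {x \<in> S. D x = 0}" "\<And>y. y \<in> {x \<in> S. D x = 0} \<Longrightarrow> cinner (x - k) y = 0"
    using orthogonal_projection_exists[OF selfadjoint_on_kernel[OF S D]] by blast
  define q where "q = x - k"
  have kS: "k \<in> S" "D k = 0" and q: "q \<in> S" using k(1) x cs(6) by (auto simp: q_def)
  have Dx: "D x = D q" by (simp add: q_def Dl(6)[OF x kS(1)] kS(2))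
  have "cinner (D q) k = 0" using selfadjoint_onD(2)[OF D q kS(1)] kS(2) by simp
  then have "cinner (D x) x = cinner (D q) q"
    unfolding Dx by (simp add: q_def cinner_diff_right)
  also have "\<dots> = cinner (P q) q"
  proof -
    have "D q - P q \<in> {x \<in> S. D x = 0}"
      using cs(6) Dl(1) Pl(1) q by (simp add: Dl(6) comm eq)
    then have "cinner q (D q - P q) = 0" using k(2) by (simp add: q_def)
    then have "cinner (D q - P q) q = 0" using cinner_eq_0_commute by blast
    then show ?thesis by (simp add: cinner_diff_left)
  qed
  finally show "0 \<le> Re (cinner (D x) x)" using p(2)[OF q] by simp
qed

section \<open>Powers of an isometry and its Wold decomposition\<close>

lemma bounded_op_funpow: "bounded_op M M W \<Longrightarrow> bounded_op M M (W ^^ n)"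
proof (induction n)
  case 0
  then show ?case using bounded_op_id by (simp add: id_def)
next
  case (Suc n)
  then show ?case using bounded_op_compose[OF Suc.IH[OF Suc.prems] Suc.prems] by (simp add: o_def)
qed

context
  fixes M :: "'a::complex_hilbert set" and W :: "'a \<Rightarrow> 'a"
  assumes M: "closed_csubspace M" and W: "isometry_on M W"
begin

lemma isometry_bounded_op: "bounded_op M M W"
  using W by (simp add: isometry_on_def)

lemma isometry_adj: "x \<in> M \<Longrightarrow> adj_on M W (W x) = x"
  using W by (simp add: isometry_on_def)

lemma isometry_funpow_in: "x \<in> M \<Longrightarrow> (W ^^ n) x \<in> M"
  by (rule bounded_opD(1)[OF bounded_op_funpow[OF isometry_bounded_op]])

lemma adj_funpow_in: "x \<in> M \<Longrightarrow> (adj_on M W ^^ n) x \<in> M"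
  by (induction n) (simp_all add: adj_on_in[OF M isometry_bounded_op])

lemma cinner_funpow_adj:
  "x \<in> M \<Longrightarrow> y \<in> M \<Longrightarrow> cinner ((W ^^ n) x) y = cinner x ((adj_on M W ^^ n) y)"
proof (induction n arbitrary: x)
  case (Suc n)
  have "cinner ((W ^^ Suc n) x) y = cinner ((W ^^ n) (W x)) y" by (simp add: funpow_swap1)
  also have "\<dots> = cinner (W x) ((adj_on M W ^^ n) y)"
    using Suc bounded_opD(1)[OF isometry_bounded_op] by blast
  also have "\<dots> = cinner x (adj_on M W ((adj_on M W ^^ n) y))"
    by (rule cinner_adj_on[OF M isometry_bounded_op Suc.prems(1)])
  finally show ?case by simp
qed simp

lemma adj_funpow_funpow: "x \<in> M \<Longrightarrow> (adj_on M W ^^ n) ((W ^^ n) x) = x"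
proof (induction n arbitrary: x)
  case (Suc n)
  have "(adj_on M W ^^ Suc n) ((W ^^ Suc n) x) = (adj_on M W ^^ n) (adj_on M W (W ((W ^^ n) x)))"
    by (simp add: funpow_swap1)
  then show ?case using Suc isometry_adj[OF isometry_funpow_in[OF Suc.prems]] by simp
qed simp

lemma isometry_funpow_cinner:
  "x \<in> M \<Longrightarrow> y \<in> M \<Longrightarrow> cinner ((W ^^ n) x) ((W ^^ n) y) = cinner x y"
  by (simp add: cinner_funpow_adj isometry_funpow_in adj_funpow_funpow)

lemma isometry_funpow_norm: "x \<in> M \<Longrightarrow> norm ((W ^^ n) x) = norm x"
  using isometry_funpow_cinner[of x x n] Re_cinner_self[of x] Re_cinner_self[of "(W ^^ n) x"] by simp

text \<open>The power of \<open>W\<close> composed with the same power of the adjoint is the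
  identity on the range, and by continuity it fixes limits of range vectors, which puts them into
  the range.\<close>

lemma closed_csubspace_funpow_image: "closed_csubspace ((W ^^ n) ` M)"
proof -
  note Wl = bounded_opD[OF bounded_op_funpow[OF isometry_bounded_op, of n]]
  note cs = closed_csubspaceD[OF M]
  have "closed ((W ^^ n) ` M)"
    unfolding closed_sequential_limits
  proof (intro allI impI, elim conjE)
    fix y l assume y: "\<forall>k. y k \<in> (W ^^ n) ` M" and lim: "y \<longlonglongrightarrow> l"
    have W': "bounded_op M M (adj_on M W ^^ n)"
      by (rule bounded_op_funpow[OF bounded_op_adj_on[OF M isometry_bounded_op M]])
    have yM: "y k \<in> M" for k
      using spec[OF y, of k] isometry_funpow_in[of _ n] by fastforce
    have lM: "l \<in> M" by (rule closed_sequentially[OF cs(1) yM lim])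
    have yk: "(W ^^ n) ((adj_on M W ^^ n) (y k)) = y k" for k
      using spec[OF y, of k] adj_funpow_funpow[of _ n] by fastforce
    have "(\<lambda>k. (adj_on M W ^^ n) (y k)) \<longlonglongrightarrow> (adj_on M W ^^ n) l"
      by (rule bounded_op_tendsto[OF M W' yM lM lim])
    then have "(\<lambda>k. (W ^^ n) ((adj_on M W ^^ n) (y k))) \<longlonglongrightarrow> (W ^^ n) ((adj_on M W ^^ n) l)"
      by (rule bounded_op_tendsto[OF M bounded_op_funpow[OF isometry_bounded_op]
            adj_funpow_in[OF yM] adj_funpow_in[OF lM]])
    then have "y \<longlonglongrightarrow> (W ^^ n) ((adj_on M W ^^ n) l)" unfolding yk .
    then have "l = (W ^^ n) ((adj_on M W ^^ n) l)" by (rule LIMSEQ_unique[OF lim])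
    then show "l \<in> (W ^^ n) ` M" using adj_funpow_in[OF lM] by blast
  qed
  then show ?thesis
    unfolding closed_csubspace_def
    using imageI[OF cs(2), where f="W ^^ n"] imageI[OF cs(3), where f="W ^^ n"]
      imageI[OF cs(4), where f="W ^^ n"]
    by (auto simp: Wl(2,3) bounded_op_linear(1)[OF bounded_op_funpow[OF isometry_bounded_op] M])
qed

lemma closed_csubspace_wold_unitary_part: "closed_csubspace (wold_unitary_part M W)"
  unfolding wold_unitary_part_def by (intro closed_csubspace_INT closed_csubspace_funpow_image)

lemma wold_unitary_part_subset: "wold_unitary_part M W \<subseteq> M"
proof
  fix x assume "x \<in> wold_unitary_part M W"
  then have "x \<in> (W ^^ 0) ` M" unfolding wold_unitary_part_def by blast
  then show "x \<in> M" by simp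
qed

lemma wold_unitary_partE:
  assumes "x \<in> wold_unitary_part M W"
  obtains w where "w \<in> M" "x = (W ^^ n) w"
  using assms unfolding wold_unitary_part_def by blast

lemma wold_unitary_partI: "(\<And>n. \<exists>w\<in>M. x = (W ^^ n) w) \<Longrightarrow> x \<in> wold_unitary_part M W"
  unfolding wold_unitary_part_def by blast

text \<open>Cancelling \<open>W ^^ m\<close> on both sides leaves \<open>a\<close> against a vector
  in the range of \<open>W\<close>, and that range is orthogonal to the kernel of the
  adjoint.\<close>

lemma ker_adj_funpow_orthogonal:
  assumes "a \<in> ker_adj_on M W" "b \<in> M" "m < n"
  shows "cinner ((W ^^ m) a) ((W ^^ n) b) = 0"
proof -
  have a: "a \<in> M" "adj_on M W a = 0" using assms(1) by (auto simp: ker_adj_on_def)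
  define k where "k = n - m - 1"
  have n: "n = m + Suc k" using assms(3) by (simp add: k_def)
  have "(W ^^ n) b = (W ^^ m) (W ((W ^^ k) b))" unfolding n funpow_add by simp
  then have "cinner ((W ^^ m) a) ((W ^^ n) b) = cinner a (W ((W ^^ k) b))"
    using isometry_funpow_cinner[OF a(1), of "W ((W ^^ k) b)" m]
      bounded_opD(1)[OF isometry_bounded_op isometry_funpow_in[OF assms(2)]] by simp
  also have "\<dots> = cinner (adj_on M W a) ((W ^^ k) b)"
    using cinner_adj_on_left[OF M isometry_bounded_op isometry_funpow_in[OF assms(2)]] by simp
  finally show ?thesis using a by simp
qed

text \<open>For the inclusion from right to left, \<open>p n\<close> is the projection of
  \<open>x\<close> onto the range of \<open>W ^^ n\<close>. These projections converge to a vector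
  of the unitary part that has to vanish when \<open>x\<close> is orthogonal to this part, so
  \<open>x\<close> is the telescoping sum of the differences \<open>p n - p (Suc n)\<close>, which
  lie in the wandering subspaces.\<close>

lemma wold_shift_part_eq: "wold_shift_part M W = orth_minus M (wold_unitary_part M W)"
proof
  note Wb = isometry_bounded_op and cs = closed_csubspaceD[OF M]
  let ?W' = "adj_on M W"
  show "wold_shift_part M W \<subseteq> orth_minus M (wold_unitary_part M W)"
  proof
    fix x assume "x \<in> wold_shift_part M W"
    then obtain f where f: "\<And>n. f n \<in> (W ^^ n) ` ker_adj_on M W" "f sums x"
      by (auto simp: wold_shift_part_def hilbert_sum_def)
    have ker: "ker_adj_on M W \<subseteq> M" by (auto simp: ker_adj_on_def)
    have fM: "f n \<in> M" for n using f(1)[of n] ker isometry_funpow_in[of _ n] by auto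
    have "sum f {..<n} \<in> M" for n
      by (induction n) (use cs(2,3) fM in auto)
    then have "x \<in> M" using f(2) unfolding sums_def by (rule closed_sequentially[OF cs(1)])
    moreover have "cinner x z = 0" if z: "z \<in> wold_unitary_part M W" for z
    proof -
      have "cinner (f n) z = 0" for n
      proof -
        \<comment> \<open>The exponent \<open>Suc n\<close> puts \<open>z\<close> one power beyond
          \<open>f n\<close>, as orthogonality requires a strict inequality.\<close>
        obtain w where "w \<in> M" "z = (W ^^ Suc n) w" using wold_unitary_partE[OF z] by blast
        moreover obtain a where "a \<in> ker_adj_on M W" "f n = (W ^^ n) a" using f(1) by blast
        ultimately show ?thesis using ker_adj_funpow_orthogonal[of a w n "Suc n"] by simp
      qed
      moreover have "(\<lambda>n. cinner (f n) z) sums cinner x z"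
        by (rule bounded_linear.sums[OF bounded_bilinear.bounded_linear_left[OF bounded_bilinear_cinner] f(2)])
      ultimately show ?thesis using sums_unique2[OF _ sums_zero] by simp
    qed
    ultimately show "x \<in> orth_minus M (wold_unitary_part M W)" by (simp add: orth_minus_def)
  qed
  show "orth_minus M (wold_unitary_part M W) \<subseteq> wold_shift_part M W"
  proof
    fix x assume "x \<in> orth_minus M (wold_unitary_part M W)"
    then have x: "x \<in> M" "\<And>z. z \<in> wold_unitary_part M W \<Longrightarrow> cinner x z = 0"
      by (auto simp: orth_minus_def)
    define p where "p n = (W ^^ n) ((?W' ^^ n) x)" for n
    define a where "a n = (norm ((?W' ^^ n) x))\<^sup>2" for n
    have pM: "p n \<in> M" for n
      unfolding p_def by (intro isometry_funpow_in adj_funpow_in x)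
    have np: "(norm (p n))\<^sup>2 = a n" for n
      by (simp add: p_def a_def isometry_funpow_norm adj_funpow_in x)
    have p_fac: "\<exists>w\<in>M. p n = (W ^^ m) w" if "m \<le> n" for m n
    proof -
      have "p n = (W ^^ m) ((W ^^ (n - m)) ((?W' ^^ n) x))"
        using that unfolding p_def by (metis comp_apply funpow_add le_add_diff_inverse)
      then show ?thesis using isometry_funpow_in adj_funpow_in x(1) by blast
    qed
    have p_range: "cinner (p m) ((W ^^ m) w) = cinner x ((W ^^ m) w)" if "w \<in> M" for m w
    proof -
      have "cinner (p m) ((W ^^ m) w) = cinner ((?W' ^^ m) x) w"
        unfolding p_def by (rule isometry_funpow_cinner[OF adj_funpow_in[OF x(1)] that])
      also have "\<dots> = cnj (cinner ((W ^^ m) w) x)"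
        unfolding cinner_funpow_adj[OF that x(1)] by (rule cinner_commute)
      also have "\<dots> = cinner x ((W ^^ m) w)" by (rule cinner_commute[symmetric])
      finally show ?thesis .
    qed
    \<comment> \<open>The ranges of the powers decrease, so pairing \<open>p m\<close> with a vector
      of the smaller range is the same as pairing \<open>x\<close> with it. Consequently squared
      distances between the \<open>p n\<close> are differences of the monotone sequence
      \<open>a\<close>.\<close>
    have pp: "cinner (p m) (p n) = of_real (a n)" if "m \<le> n" for m n
    proof -
      have *: "cinner (p m) (p n) = cinner x (p n)" if "m \<le> n" for m
        using p_fac[OF that] p_range by force
      have "cinner (p m) (p n) = cinner (p n) (p n)" using *[OF that] *[of n] by simp
      then show ?thesis using np by (simp add: cinner_norm)
    qed
    have p_diff: "(norm (p m - p n))\<^sup>2 = a m - a n" if "m \<le> n" for m n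
      using pp[OF that] by (simp add: norm_diff_square np)
    have "decseq a"
    proof (rule decseq_SucI)
      show "a (Suc n) \<le> a n" for n
        using p_diff[of n "Suc n"] zero_le_power2[of "norm (p n - p (Suc n))"] by simp
    qed
    moreover have "0 \<le> a n" for n by (simp add: a_def)
    ultimately have "convergent a" unfolding convergent_def using decseq_convergent[of a 0] by metis
    then have aC: "Cauchy a" by (rule convergent_Cauchy)
    have "Cauchy p"
    proof (rule metric_CauchyI)
      fix e :: real assume e: "e > 0"
      then have "e\<^sup>2 > 0" by simp
      then obtain K where K: "\<And>m n. m \<ge> K \<Longrightarrow> n \<ge> K \<Longrightarrow> dist (a m) (a n) < e\<^sup>2"
        using metric_CauchyD[OF aC] by blast
      have le: "dist (p m) (p n) < e" if "K \<le> m" "m \<le> n" for m n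
      proof -
        have "(norm (p m - p n))\<^sup>2 < e\<^sup>2"
          using p_diff[OF that(2)] K[of m n] that by (simp add: dist_real_def)
        then show ?thesis unfolding dist_norm by (rule power2_less_imp_less) (use e in simp)
      qed
      show "\<exists>K. \<forall>m\<ge>K. \<forall>n\<ge>K. dist (p m) (p n) < e"
        using le by (metis dist_commute nle_le)
    qed
    then obtain y where y: "p \<longlonglongrightarrow> y" using Cauchy_convergent_iff convergent_def by blast
    have "y \<in> (W ^^ m) ` M" for m
    proof (rule closed_sequentially)
      show "closed ((W ^^ m) ` M)" using closed_csubspaceD(1)[OF closed_csubspace_funpow_image] .
      show "(\<lambda>n. p (n + m)) \<longlonglongrightarrow> y" using y by (rule LIMSEQ_ignore_initial_segment)
      show "p (n + m) \<in> (W ^^ m) ` M" for n using p_fac[of m "n + m"] by auto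
    qed
    then have yu: "y \<in> wold_unitary_part M W" by (simp add: wold_unitary_part_def)
    have "cinner (p n) y = 0" for n
    proof -
      obtain w where "w \<in> M" "y = (W ^^ n) w" using wold_unitary_partE[OF yu] by blast
      then show ?thesis using p_range[of w n] x(2)[OF yu] by simp
    qed
    moreover have "(\<lambda>n. cinner (p n) y) \<longlonglongrightarrow> cinner y y" by (intro tendsto_cinner y tendsto_const)
    ultimately have "(\<lambda>n. 0) \<longlonglongrightarrow> cinner y y" by simp
    then have "0 = cinner y y" by (rule LIMSEQ_unique[OF tendsto_const])
    then have "y = 0" using cinner_self_eq_0[of y] by metis
    then have p0: "p \<longlonglongrightarrow> 0" using y by simp
    define f where "f n = p n - p (Suc n)" for n
    have "sum f {..<n} = p 0 - p n" for n by (simp add: f_def sum_lessThan_telescope')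
    then have "f sums (p 0 - 0)" unfolding sums_def using tendsto_diff[OF tendsto_const p0] by simp
    then have "f sums x" by (simp add: p_def)
    moreover have "f n \<in> (W ^^ n) ` ker_adj_on M W" for n
    proof -
      let ?z = "(?W' ^^ n) x"
      have z: "?z \<in> M" "?W' ?z \<in> M" "W (?W' ?z) \<in> M"
        using adj_funpow_in[OF x(1)] adj_on_in[OF M Wb] bounded_opD(1)[OF Wb] by auto
      \<comment> \<open>Pulling out \<open>W ^^ n\<close> leaves the projection of \<open>?z\<close>
        onto the kernel of the adjoint.\<close>
      have "p (Suc n) = (W ^^ n) (W (?W' ?z))" by (simp add: p_def funpow_swap1)
      then have "f n = (W ^^ n) (?z - W (?W' ?z))"
        using bounded_op_linear(3)[OF bounded_op_funpow[OF Wb] M z(1,3), of n] by (simp add: f_def p_def)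
      moreover have "?z - W (?W' ?z) \<in> ker_adj_on M W"
        using cs(6)[OF z(1,3)] isometry_adj[OF z(2)]
          bounded_op_linear(3)[OF bounded_op_adj_on[OF M Wb M] M z(1,3)]
        by (simp add: ker_adj_on_def)
      ultimately show ?thesis by blast
    qed
    ultimately show "x \<in> wold_shift_part M W"
      unfolding wold_shift_part_def hilbert_sum_def by blast
  qed
qed

lemma closed_csubspace_ker_adj: "closed_csubspace (ker_adj_on M W)"
proof -
  note Wb = isometry_bounded_op
  have "ker_adj_on M W = orth_minus M (W ` M)"
  proof (intro set_eqI iffI)
    fix x assume "x \<in> ker_adj_on M W"
    then show "x \<in> orth_minus M (W ` M)"
      by (auto simp: ker_adj_on_def orth_minus_def simp flip: cinner_adj_on_left[OF M Wb])
  next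
    fix x assume x: "x \<in> orth_minus M (W ` M)"
    have "cinner (adj_on M W x) (adj_on M W x) = cinner x (W (adj_on M W x))"
      by (rule cinner_adj_on_left[OF M Wb adj_on_in[OF M Wb]])
    also have "\<dots> = 0" using x adj_on_in[OF M Wb] by (auto simp: orth_minus_def)
    finally show "x \<in> ker_adj_on M W" using x by (simp add: ker_adj_on_def orth_minus_def)
  qed
  then show ?thesis using closed_csubspace_orth_minus[OF M] by simp
qed

lemma ker_adj_subset_wold_shift_part: "ker_adj_on M W \<subseteq> wold_shift_part M W"
proof
  fix x assume x: "x \<in> ker_adj_on M W"
  have "cinner x z = 0" if "z \<in> wold_unitary_part M W" for z
    using wold_unitary_partE[OF that, of "Suc 0"] ker_adj_funpow_orthogonal[OF x, of _ 0 "Suc 0"]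
    by auto
  then show "x \<in> wold_shift_part M W"
    using x unfolding wold_shift_part_eq by (simp add: orth_minus_def ker_adj_on_def)
qed

end

text \<open>The wandering subspace is the kernel of the adjoint on \<open>M\<close>. The isometry
  hypothesis on the shift part refers to the adjoint taken on that part; it is supplied once the
  part is known to be reducing.\<close>

lemma unilateral_shift_on_wold_shift_part:
  fixes M :: "'a::complex_hilbert set"
  assumes M: "closed_csubspace M" and W: "isometry_on M W" and iso: "isometry_on (wold_shift_part M W) W"
  shows "unilateral_shift_on (wold_shift_part M W) W"
  unfolding unilateral_shift_on_def
proof (intro conjI iso exI[of _ "ker_adj_on M W"] allI impI ballI)
  show "closed_csubspace (ker_adj_on M W)" by (rule closed_csubspace_ker_adj[OF M W])
  show "ker_adj_on M W \<subseteq> wold_shift_part M W" by (rule ker_adj_subset_wold_shift_part[OF M W])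
  show "wold_shift_part M W = hilbert_sum (\<lambda>n. (W ^^ n) ` ker_adj_on M W)"
    by (rule wold_shift_part_def)
  fix m n :: nat and x y
  assume mn: "m \<noteq> n" and "x \<in> (W ^^ m) ` ker_adj_on M W" "y \<in> (W ^^ n) ` ker_adj_on M W"
  then obtain a b where ab: "a \<in> ker_adj_on M W" "x = (W ^^ m) a" "b \<in> ker_adj_on M W" "y = (W ^^ n) b"
    by blast
  have "a \<in> M" "b \<in> M" using ab by (auto simp: ker_adj_on_def)
  then show "cinner x y = 0"
    using mn ker_adj_funpow_orthogonal[OF M W ab(1), of b m n]
      ker_adj_funpow_orthogonal[OF M W ab(3), of a n m] cinner_eq_0_commute[of x y] ab
    by (cases "m < n") auto
qed

text \<open>\<open>P\<close> preserves \<open>M\<close> and commutes with the powers of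
  \<open>Q\<close>, so it preserves each range whose intersection is the unitary part. The shift
  part inherits reducibility as the complement of the unitary part inside \<open>M\<close>.\<close>

lemma wold_decomposition_reduces:
  fixes S :: "'a::complex_hilbert set"
  assumes S: "closed_csubspace S" and Q: "bounded_op S S Q" and P: "selfadjoint_on S P"
    and QP: "\<And>x. x \<in> S \<Longrightarrow> Q (P x) = P (Q x)"
    and redQ: "reduces S M Q" and redP: "reduces S M P" and iso: "isometry_on M Q"
  shows "reduces S (wold_unitary_part M Q) Q" "reduces S (wold_unitary_part M Q) P"
    "reduces S (wold_shift_part M Q) Q" "reduces S (wold_shift_part M Q) P"
    "unitary_on (wold_unitary_part M Q) Q" "unilateral_shift_on (wold_shift_part M Q) Q"
proof -
  let ?U = "wold_unitary_part M Q" and ?Q' = "adj_on S Q"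
  have M: "closed_csubspace M" "M \<subseteq> S" "Q ` M \<subseteq> M" "P ` M \<subseteq> M"
    using redQ redP by (auto simp: reduces_def)
  note U = closed_csubspace_wold_unitary_part[OF M(1) iso] wold_unitary_part_subset[OF M(1) iso]
  have US: "?U \<subseteq> S" using U(2) M(2) by blast
  have Q'M: "?Q' ` M \<subseteq> M" by (rule reduces_adj_on_invariant[OF S Q redQ])
  have Q'Q: "?Q' (Q x) = x" if "x \<in> M" for x
  proof -
    have "Q x \<in> M" using M(3) that by blast
    then show ?thesis using isometry_adj[OF M(1) iso that] adj_on_reduces[OF S Q redQ] by simp
  qed
  have inv: "Q ` ?U \<subseteq> ?U" "?Q' ` ?U \<subseteq> ?U" "P ` ?U \<subseteq> ?U"
  proof safe
    fix x assume x: "x \<in> ?U"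
    have "\<exists>w\<in>M. Q x = (Q ^^ n) w" "\<exists>w\<in>M. ?Q' x = (Q ^^ n) w" "\<exists>w\<in>M. P x = (Q ^^ n) w" for n
    proof -
      obtain w where w: "w \<in> M" "x = (Q ^^ n) w" using wold_unitary_partE[OF M(1) iso x] by blast
      have "Q x = (Q ^^ n) (Q w)" by (simp add: w(2) funpow_swap1)
      then show "\<exists>w\<in>M. Q x = (Q ^^ n) w" using w(1) M(3) by blast
      have "P ((Q ^^ n) w) = (Q ^^ n) (P w)"
      proof (induction n)
        case (Suc n)
        have "(Q ^^ n) w \<in> S" using isometry_funpow_in[OF M(1) iso w(1)] M(2) by blast
        then show ?case using Suc QP[of "(Q ^^ n) w", symmetric] by simp
      qed simp
      then show "\<exists>w\<in>M. P x = (Q ^^ n) w" using w M(4) by blast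
      \<comment> \<open>The adjoint removes one factor of \<open>Q\<close>, so the representation is
        taken with one more power than is wanted.\<close>
      obtain v where v: "v \<in> M" "x = (Q ^^ Suc n) v" using wold_unitary_partE[OF M(1) iso x] by blast
      then have "?Q' x = (Q ^^ n) v" using Q'Q[OF isometry_funpow_in[OF M(1) iso v(1)]] by simp
      then show "\<exists>w\<in>M. ?Q' x = (Q ^^ n) w" using v(1) by blast
    qed
    then show "Q x \<in> ?U" "?Q' x \<in> ?U" "P x \<in> ?U" by (auto intro: wold_unitary_partI[OF M(1) iso])
  qed
  \<comment> \<open>Stated for a pair of formally adjoint operators so that it serves
    \<open>Q\<close> with its adjoint as well as \<open>P\<close> with itself. The complement is
    first treated inside \<open>M\<close> and then regarded in \<open>S\<close>.\<close>
  have red: "reduces S ?U A \<and> reduces S (wold_shift_part M Q) A"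
    if A: "\<And>x. x \<in> S \<Longrightarrow> A x \<in> S" "\<And>x y. x \<in> S \<Longrightarrow> y \<in> S \<Longrightarrow> cinner (A x) y = cinner x (A' y)"
      and A': "\<And>x. x \<in> S \<Longrightarrow> A' x \<in> S"
      and AM: "A ` M \<subseteq> M" "A' ` M \<subseteq> M" and AU: "A ` ?U \<subseteq> ?U" "A' ` ?U \<subseteq> ?U" for A A'
  proof
    show "reduces S ?U A" by (rule reducesI[OF U(1) US A AU])
    have sub: "orth_minus M ?U \<subseteq> M" "orth_minus M ?U \<subseteq> S" using M(2) by (auto simp: orth_minus_def)
    have A'_adj: "cinner (A' x) y = cinner x (A y)" if "x \<in> S" "y \<in> S" for x y
      using A(2)[OF that(2,1)] cinner_commute by metis
    have AMS: "\<And>x y. x \<in> M \<Longrightarrow> y \<in> M \<Longrightarrow> cinner (A x) y = cinner x (A' y)"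
      "\<And>x y. x \<in> M \<Longrightarrow> y \<in> M \<Longrightarrow> cinner (A' x) y = cinner x (A y)"
      using A(2) A'_adj M(2) by blast+
    have "reduces M ?U A" by (rule reducesI[OF U _ AMS(1) AU]) (use AM in auto)
    moreover have "reduces M ?U A'" by (rule reducesI[OF U _ AMS(2) AU(2,1)]) (use AM in auto)
    ultimately have inv': "A ` orth_minus M ?U \<subseteq> orth_minus M ?U" "A' ` orth_minus M ?U \<subseteq> orth_minus M ?U"
      by (auto simp: reduces_def)
    show "reduces S (wold_shift_part M Q) A"
      unfolding wold_shift_part_eq[OF M(1) iso]
      by (rule reducesI[OF closed_csubspace_orth_minus[OF M(1)] sub(2) A inv'])
  qed
  have Pb: "\<And>x. x \<in> S \<Longrightarrow> P x \<in> S" by (rule bounded_opD(1)[OF selfadjoint_onD(1)[OF P]])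
  have redQ': "reduces S ?U Q \<and> reduces S (wold_shift_part M Q) Q"
    by (rule red[OF bounded_opD(1)[OF Q] cinner_adj_on[OF S Q] adj_on_in[OF S Q] M(3) Q'M inv(1,2)])
  then show "reduces S ?U Q" "reduces S (wold_shift_part M Q) Q" by auto
  have "reduces S ?U P \<and> reduces S (wold_shift_part M Q) P"
    by (rule red[OF Pb selfadjoint_onD(2)[OF P] Pb M(4) M(4) inv(3) inv(3)])
  then show "reduces S ?U P" "reduces S (wold_shift_part M Q) P" by auto
  have iso_sub: "isometry_on N Q" if N: "N \<subseteq> M" and red: "reduces S N Q" for N
  proof -
    have QN: "Q ` N \<subseteq> N" using red by (simp add: reduces_def)
    have "adj_on N Q (Q x) = x" if "x \<in> N" for x
    proof -
      have "Q x \<in> N" "x \<in> M" using QN N that by auto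
      then show ?thesis using adj_on_reduces[OF S Q red] Q'Q by simp
    qed
    then show ?thesis
      using bounded_op_subset[OF Q _ QN] N M(2) by (auto simp: isometry_on_def)
  qed
  have "Q (adj_on ?U Q x) = x" if x: "x \<in> ?U" for x
  proof -
    obtain w where "w \<in> M" "x = (Q ^^ Suc 0) w" using wold_unitary_partE[OF M(1) iso x] by blast
    then show ?thesis using Q'Q[of w] adj_on_reduces[OF S Q conjunct1[OF redQ'] x] by simp
  qed
  then show "unitary_on ?U Q"
    using iso_sub[OF U(2)] redQ' by (simp add: unitary_on_def)
  have "wold_shift_part M Q \<subseteq> M" unfolding wold_shift_part_eq[OF M(1) iso] by (auto simp: orth_minus_def)
  then show "unilateral_shift_on (wold_shift_part M Q) Q"
    using unilateral_shift_on_wold_shift_part[OF M(1) iso] iso_sub redQ' by blast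
qed

section \<open>Block operators\<close>

lemma abs_on_props:
  fixes S :: "'a::complex_hilbert set"
  assumes S: "closed_csubspace S" and A: "bounded_op S S' A" and S': "closed_csubspace S'"
  shows positive_op_abs_on: "positive_op S (abs_on S A)"
    and abs_on_abs_on: "\<And>x. x \<in> S \<Longrightarrow> abs_on S A (abs_on S A x) = adj_on S A (A x)"
    and abs_on_commute: "\<And>B x. bounded_op S S B \<Longrightarrow>
      (\<And>x. x \<in> S \<Longrightarrow> B (adj_on S A (A x)) = adj_on S A (A (B x))) \<Longrightarrow> x \<in> S \<Longrightarrow>
      B (abs_on S A x) = abs_on S A (B x)"
proof -
  note p = positive_op_adj_on_comp[OF S A S']
  show "positive_op S (abs_on S A)" unfolding abs_on_def by (rule positive_op_sqrt_on[OF S p])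
  show "abs_on S A (abs_on S A x) = adj_on S A (A x)" if "x \<in> S" for x
    unfolding abs_on_def by (rule sqrt_on_sqrt_on[OF S p that])
  show "B (abs_on S A x) = abs_on S A (B x)"
    if B: "bounded_op S S B" and comm: "\<And>x. x \<in> S \<Longrightarrow> B (adj_on S A (A x)) = adj_on S A (A (B x))"
      and x: "x \<in> S" for B x
    unfolding abs_on_def by (rule sqrt_on_commute[OF S p B _ x]) (rule comm)
qed

section \<open>Blocks of an operator in the class and their commutation relations\<close>

context
  fixes H1 H2 :: "'h::complex_hilbert set" and T V E Q :: "'h \<Rightarrow> 'h"
  assumes decomp: "orth_decomp UNIV H1 H2" and class_Q: "class_Q H1 H2 T V E Q"
begin

private lemma H1: "closed_csubspace H1" and H2: "closed_csubspace H2"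
  and orth: "\<And>x y. x \<in> H1 \<Longrightarrow> y \<in> H2 \<Longrightarrow> cinner x y = 0"
  using decomp by (auto simp: orth_decomp_def)

private lemma split:
  obtains x1 x2 where "x1 \<in> H1" "x2 \<in> H2" "x = x1 + x2"
proof -
  have "x \<in> {x + y | x y. x \<in> H1 \<and> y \<in> H2}" using decomp unfolding orth_decomp_def by blast
  then show ?thesis using that by blast
qed

private lemma ops: "bounded_op UNIV UNIV T" "bounded_op H1 H1 V" "bounded_op H2 H1 E" "bounded_op H2 H2 Q"
  and T_eq: "\<And>x y. x \<in> H1 \<Longrightarrow> y \<in> H2 \<Longrightarrow> T (x + y) = (V x + E y) + Q y"
  and V_iso: "\<And>x. x \<in> H1 \<Longrightarrow> adj_on H1 V (V x) = x"
  and VE: "\<And>y. y \<in> H2 \<Longrightarrow> adj_on H1 V (E y) = 0"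
  and QE: "\<And>y. y \<in> H2 \<Longrightarrow> Q (adj_on H2 E (E y)) = adj_on H2 E (E (Q y))"
  and QQ: "\<And>y. y \<in> H2 \<Longrightarrow> Q (adj_on H2 Q (Q y)) = adj_on H2 Q (Q (Q y))"
  using class_Q by (auto simp: class_Q_def quasinormal_on_def)

text \<open>The squares of the moduli are written through adjoints because the defining relations of
  the class apply to them in this form; \<open>A_sq\<close> and \<open>B_sq\<close> translate to the
  moduli.\<close>

private definition "R x = adj_on H2 Q (Q x)"
private definition "EE x = adj_on H2 E (E x)"
private definition "D x = R x + EE x - x"

private lemma R_sa: "selfadjoint_on H2 R"
  unfolding R_def by (rule selfadjoint_on_adj_on_comp[OF H2 ops(4) H2])

private lemma EE_sa: "selfadjoint_on H2 EE"
  unfolding EE_def by (rule selfadjoint_on_adj_on_comp[OF H2 ops(3) H1])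

private lemma EE_pos: "positive_op H2 EE"
  unfolding EE_def by (rule positive_op_adj_on_comp[OF H2 ops(3) H1])

private lemma D_sa: "selfadjoint_on H2 D"
  unfolding D_def by (intro selfadjoint_on_diff selfadjoint_on_add selfadjoint_on_id H2 R_sa EE_sa)

private lemmas V_in = bounded_opD(1)[OF ops(2)] and E_in = bounded_opD(1)[OF ops(3)]
  and Q_in = bounded_opD(1)[OF ops(4)]
private lemmas R_b = selfadjoint_onD(1)[OF R_sa] and EE_b = selfadjoint_onD(1)[OF EE_sa]
  and D_b = selfadjoint_onD(1)[OF D_sa]
private lemmas R_in = bounded_opD(1)[OF R_b] and EE_in = bounded_opD(1)[OF EE_b]
  and D_in = bounded_opD(1)[OF D_b]
private lemmas Q_lin = bounded_opD(2)[OF ops(4)] bounded_op_linear(3)[OF ops(4) H2]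
private lemmas R_lin = bounded_opD(2)[OF R_b] bounded_op_linear(3)[OF R_b H2]
private lemmas EE_lin = bounded_opD(2)[OF EE_b] bounded_op_linear(3)[OF EE_b H2]
private lemmas D_lin = bounded_opD(2)[OF D_b] bounded_op_linear(3)[OF D_b H2]
private lemmas H2_cs = closed_csubspaceD[OF H2]
private lemmas A_pos = positive_op_abs_on[OF H2 ops(4) H2] and B_pos = positive_op_abs_on[OF H2 ops(3) H1]

private lemma QR: "y \<in> H2 \<Longrightarrow> Q (R y) = R (Q y)"
  by (simp add: R_def QQ)

private lemma QEE: "y \<in> H2 \<Longrightarrow> Q (EE y) = EE (Q y)"
  by (simp add: EE_def QE)

private lemma Q'_in: "adj_on H2 Q y \<in> H2"
  by (rule adj_on_in[OF H2 ops(4)])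

private lemma Q'R: "y \<in> H2 \<Longrightarrow> adj_on H2 Q (R y) = R (adj_on H2 Q y)"
  by (rule adj_on_commute_selfadjoint[OF H2 ops(4) R_sa QR])

private lemma Q'EE: "y \<in> H2 \<Longrightarrow> adj_on H2 Q (EE y) = EE (adj_on H2 Q y)"
  by (rule adj_on_commute_selfadjoint[OF H2 ops(4) EE_sa QEE])

private lemma R_EE: "y \<in> H2 \<Longrightarrow> R (EE y) = EE (R y)"
  by (simp add: R_def QEE Q'EE Q_in)

private lemma QD: "y \<in> H2 \<Longrightarrow> Q (D y) = D (Q y)"
  by (simp add: D_def QR QEE Q_lin R_in EE_in H2_cs)

private lemma RD: "y \<in> H2 \<Longrightarrow> R (D y) = D (R y)"
  by (simp add: D_def R_EE R_lin R_in EE_in H2_cs)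

private lemma D_EE: "y \<in> H2 \<Longrightarrow> D (EE y) = EE (D y)"
  by (simp add: D_def R_EE EE_lin R_in EE_in H2_cs)

private lemma A_sq: "y \<in> H2 \<Longrightarrow> abs_on H2 Q (abs_on H2 Q y) = R y"
  unfolding R_def by (rule abs_on_abs_on[OF H2 ops(4) H2])

private lemma B_sq: "y \<in> H2 \<Longrightarrow> abs_on H2 E (abs_on H2 E y) = EE y"
  unfolding EE_def by (rule abs_on_abs_on[OF H2 ops(3) H1])

private lemmas A_b = positive_opD(3)[OF H2 A_pos] and B_b = positive_opD(3)[OF H2 B_pos]
private lemmas B_in = bounded_opD(1)[OF B_b]

private lemma B_comm:
  assumes "bounded_op H2 H2 C" "\<And>x. x \<in> H2 \<Longrightarrow> C (EE x) = EE (C x)" "y \<in> H2"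
  shows "C (abs_on H2 E y) = abs_on H2 E (C y)"
  by (rule abs_on_commute[OF H2 ops(3) H1 assms(1) _ assms(3)]) (use assms(2) in \<open>simp add: EE_def\<close>)

private lemma A_comm:
  assumes "bounded_op H2 H2 C" "\<And>x. x \<in> H2 \<Longrightarrow> C (R x) = R (C x)" "y \<in> H2"
  shows "C (abs_on H2 Q y) = abs_on H2 Q (C y)"
  by (rule abs_on_commute[OF H2 ops(4) H2 assms(1) _ assms(3)]) (use assms(2) in \<open>simp add: R_def\<close>)

private lemma QB: "y \<in> H2 \<Longrightarrow> Q (abs_on H2 E y) = abs_on H2 E (Q y)"
  by (rule B_comm[OF ops(4) QEE])

private lemma RB: "y \<in> H2 \<Longrightarrow> R (abs_on H2 E y) = abs_on H2 E (R y)"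
  by (rule B_comm[OF R_b R_EE])

text \<open>Commutation is lifted from the squares one root at a time: \<open>R\<close> commutes
  with \<open>EE\<close>, hence with |E|, and then |E|, commuting with \<open>R\<close>, commutes
  with |Q|.\<close>

private lemma AB: "y \<in> H2 \<Longrightarrow> abs_on H2 Q (abs_on H2 E y) = abs_on H2 E (abs_on H2 Q y)"
  by (rule A_comm[OF B_b RB[symmetric], symmetric])

text \<open>The relations for \<open>V\<close> make the two block columns of \<open>T\<close>
  orthogonal and the first one isometric, so \<open>T\<close> composed with its adjoint is block
  diagonal with identity upper corner.\<close>

private lemma triangle_eq:
  assumes x: "x1 \<in> H1" "x2 \<in> H2"
  shows "triangle_on UNIV T (x1 + x2) = D x2"
proof -
  have "adj_on UNIV T (T (x1 + x2)) = x1 + (R x2 + EE x2)"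
  proof (rule adj_on_eqI[OF closed_csubspace_UNIV ops(1)])
    fix z :: 'h
    obtain z1 z2 where z: "z1 \<in> H1" "z2 \<in> H2" "z = z1 + z2" by (rule split)
    have orth': "cinner y x = 0" if "x \<in> H1" "y \<in> H2" for x y
      using orth[OF that] cinner_eq_0_commute by blast
    have 1: "cinner (V z1) (V x1) = cinner z1 x1"
      using cinner_adj_on[OF H1 ops(2) z(1)] V_iso[OF x(1)] by simp
    have 2: "cinner (V z1) (E x2) = 0"
      using cinner_adj_on[OF H1 ops(2) z(1)] VE[OF x(2)] by simp
    have "cinner (V x1) (E z2) = 0"
      using cinner_adj_on[OF H1 ops(2) x(1)] VE[OF z(2)] by simp
    then have 3: "cinner (E z2) (V x1) = 0" using cinner_eq_0_commute by blast
    have 4: "cinner (E z2) (E x2) = cinner z2 (EE x2)"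
      using cinner_adj_on[OF H2 ops(3) z(2)] by (simp add: EE_def)
    have 5: "cinner (Q z2) (Q x2) = cinner z2 (R x2)"
      using cinner_adj_on[OF H2 ops(4) z(2)] by (simp add: R_def)
    have 6: "cinner (V z1) (Q x2) = 0" "cinner (E z2) (Q x2) = 0"
      "cinner (Q z2) (V x1) = 0" "cinner (Q z2) (E x2) = 0" "cinner z1 (R x2) = 0" "cinner z1 (EE x2) = 0"
      "cinner z2 x1 = 0"
      using x z V_in E_in Q_in R_in EE_in orth orth' by auto
    show "cinner (T z) (T (x1 + x2)) = cinner z (x1 + (R x2 + EE x2))"
      unfolding z(3) T_eq[OF x] T_eq[OF z(1,2)]
      by (simp add: cinner_add_left cinner_add_right 1 2 3 4 5 6)
  qed simp
  then show ?thesis by (simp add: triangle_on_def D_def)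
qed

text \<open>In the adjoint block matrix the second column is \<open>0\<close> and the adjoint of
  \<open>Q\<close>.\<close>

private lemma adj_T_H2:
  assumes w: "w \<in> H2"
  shows "adj_on UNIV T w = adj_on H2 Q w"
proof (rule adj_on_eqI[OF closed_csubspace_UNIV ops(1)])
  fix z :: 'h
  obtain z1 z2 where z: "z1 \<in> H1" "z2 \<in> H2" "z = z1 + z2" by (rule split)
  have "cinner (V z1) w = 0" "cinner (E z2) w = 0" "cinner z1 (adj_on H2 Q w) = 0"
    using orth V_in[OF z(1)] E_in[OF z(2)] z(1) w Q'_in by auto
  then show "cinner (T z) w = cinner z (adj_on H2 Q w)"
    unfolding z(3) T_eq[OF z(1,2)]
    by (simp add: cinner_add_left cinner_adj_on[OF H2 ops(4) z(2)])
qed simp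

text \<open>Writing t for the triangle, the defect of a 2-isometry is T* t T - t. As t only sees the
  \<open>H2\<close> component, t T is \<open>D Q = Q D\<close> there with values in
  \<open>H2\<close>, where the adjoint of \<open>T\<close> acts as that of \<open>Q\<close>; this
  gives \<open>R D - D\<close>.\<close>

private lemma two_isometry_iff: "two_isometry_on UNIV T \<longleftrightarrow> (\<forall>x\<in>H2. R (D x) - D x = 0)"
proof -
  let ?T' = "adj_on UNIV T" and ?tri = "triangle_on UNIV T"
  have T'b: "bounded_op UNIV UNIV ?T'"
    by (rule bounded_op_adj_on[OF closed_csubspace_UNIV ops(1) closed_csubspace_UNIV])
  have T'T: "?T' (T x) = x + ?tri x" for x by (simp add: triangle_on_def)
  have eq: "?T' (?T' (T (T (x1 + x2)))) - 2 *\<^sub>R ?T' (T (x1 + x2)) + (x1 + x2) = R (D x2) - D x2"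
    if x: "x1 \<in> H1" "x2 \<in> H2" for x1 x2
  proof -
    let ?x = "x1 + x2"
    have "?tri (T ?x) = D (Q x2)"
      unfolding T_eq[OF x]
      using triangle_eq[OF closed_csubspaceD(3)[OF H1 V_in[OF x(1)] E_in[OF x(2)]] Q_in[OF x(2)]] .
    also have "\<dots> = Q (D x2)" by (rule QD[OF x(2), symmetric])
    finally have "?T' (?tri (T ?x)) = R (D x2)"
      using adj_T_H2[OF Q_in[OF D_in[OF x(2)]]] by (simp add: R_def)
    moreover have "?T' (?T' (T (T ?x))) = ?x + ?tri ?x + ?T' (?tri (T ?x))"
      unfolding T'T[of "T ?x"] by (simp add: bounded_opD(2)[OF T'b] T'T)
    ultimately show ?thesis
      unfolding T'T[of ?x] triangle_eq[OF x] by (simp add: scaleR_2)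
  qed
  show ?thesis
  proof
    assume "two_isometry_on UNIV T"
    then show "\<forall>x\<in>H2. R (D x) - D x = 0"
      using eq[OF closed_csubspaceD(2)[OF H1]] by (auto simp: two_isometry_on_def)
  next
    assume zero: "\<forall>x\<in>H2. R (D x) - D x = 0"
    have "?T' (?T' (T (T x))) - 2 *\<^sub>R ?T' (T x) + x = 0" for x
    proof -
      obtain x1 x2 where x: "x1 \<in> H1" "x2 \<in> H2" "x = x1 + x2" by (rule split)
      show ?thesis unfolding x(3) eq[OF x(1,2)] using zero x(2) by blast
    qed
    then show "two_isometry_on UNIV T" using ops(1) by (simp add: two_isometry_on_def)
  qed
qed

text \<open>The square root \<open>W\<close> of the triangle vanishes on \<open>H\<^sub>1\<close>, has range in \<open>H\<^sub>2\<close> and commutes with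
  \<open>0 \<oplus> Q\<close>, because the triangle \<open>0 \<oplus> D\<close> does; hence \<open>W T W = (0 \<oplus> Q) W\<^sup>2\<close>.\<close>

private lemma triangle_regular_if:
  assumes zero: "\<And>x. x \<in> H2 \<Longrightarrow> R (D x) - D x = 0"
  shows "triangle_regular_on UNIV T"
proof -
  let ?tri = "triangle_on UNIV T"
  note U = closed_csubspace_UNIV
  \<comment> \<open>\<open>D\<close> is \<open>R - I\<close> plus \<open>EE\<close>, and the
    hypothesis removes the first summand from the square.\<close>
  have DD: "D (D x) = EE (D x)" if "x \<in> H2" for x
    using zero[OF that] by (simp add: D_def[of "D x"])
  have D_pos: "positive_op H2 D"
    by (rule positive_op_if_square_eq[OF H2 D_sa EE_pos D_EE DD])
  have tri_sa: "selfadjoint_on UNIV ?tri"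
    unfolding triangle_on_def
    by (intro selfadjoint_on_diff U selfadjoint_on_adj_on_comp[OF U ops(1) U] selfadjoint_on_id)
  have tri_pos: "positive_op UNIV ?tri"
    unfolding positive_op_iff[OF U]
  proof (intro conjI ballI tri_sa)
    fix x
    obtain x1 x2 where x: "x1 \<in> H1" "x2 \<in> H2" "x = x1 + x2" by (rule split)
    have "cinner (D x2) x1 = 0" using orth[OF x(1) D_in[OF x(2)]] cinner_eq_0_commute by blast
    then show "0 \<le> Re (cinner (?tri x) x)"
      unfolding x(3) triangle_eq[OF x(1,2)]
      using positive_opD(2)[OF H2 D_pos x(2)] by (simp add: cinner_add_right)
  qed
  define W where "W = sqrt_on UNIV ?tri"
  note W_pos = positive_op_sqrt_on[OF U tri_pos, folded W_def]
    and WW = sqrt_on_sqrt_on[OF U tri_pos UNIV_I, folded W_def]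
  note W_sa = positive_opD(1)[OF U W_pos]
  have W_H1: "W h = 0" if "h \<in> H1" for h
  proof -
    have "cinner (W h) (W h) = cinner (?tri h) h"
      using selfadjoint_onD(2)[OF W_sa, of "W h" h] WW by simp
    also have "?tri h = 0"
      using triangle_eq[OF that H2_cs(2)] bounded_op_linear(1)[OF D_b H2] by simp
    finally show ?thesis by simp
  qed
  \<comment> \<open>The range of a selfadjoint operator is orthogonal to its kernel, and
    \<open>W\<close> vanishes on \<open>H1\<close>.\<close>
  have W_in: "W x \<in> H2" for x
  proof -
    obtain a b where ab: "a \<in> H1" "b \<in> H2" "W x = a + b" by (rule split)
    have "cinner (W x) a = 0" using selfadjoint_onD(2)[OF W_sa, of x a] W_H1[OF ab(1)] by simp
    moreover have "cinner b a = 0" using orth[OF ab(1,2)] cinner_eq_0_commute by blast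
    ultimately have "a = 0" using ab(3) by (simp add: cinner_add_left)
    then show ?thesis using ab by simp
  qed
  text \<open>The adjoint of the inclusion of \<open>H\<^sub>2\<close> is the orthogonal projection onto \<open>H\<^sub>2\<close>.\<close>
  have incl: "bounded_op H2 UNIV (\<lambda>x. x)" by (rule bounded_opI[where K=1]) auto
  define p where "p = adj_on H2 (\<lambda>x::'h. x)"
  have p_b: "bounded_op UNIV H2 p" unfolding p_def by (rule bounded_op_adj_on[OF H2 incl U])
  have p_eq: "p (x1 + x2) = x2" if "x1 \<in> H1" "x2 \<in> H2" for x1 x2
    unfolding p_def
  proof (rule adj_on_eqI[OF H2 incl that(2)])
    show "cinner z (x1 + x2) = cinner z x2" if "z \<in> H2" for z
      using orth[OF \<open>x1 \<in> H1\<close> that] cinner_eq_0_commute[of z x1] by (simp add: cinner_add_right)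
  qed
  \<comment> \<open>The square root on the whole space commutes with operators on the whole space,
    so \<open>Q\<close> is extended by zero on \<open>H1\<close>.\<close>
  define F where "F x = Q (p x)" for x
  have F_b: "bounded_op UNIV UNIV F"
    using bounded_op_subset[OF bounded_op_compose[OF p_b ops(4)] subset_refl, of UNIV]
    by (simp add: F_def[abs_def])
  \<comment> \<open>\<open>T\<close> and \<open>F\<close> differ by terms with values in
    \<open>H1\<close>, which the triangle kills; \<open>F\<close> commutes with the triangle because
    \<open>Q\<close> commutes with \<open>D\<close>.\<close>
  have tri_T: "?tri (T x) = ?tri (F x)" and F_tri: "F (?tri x) = ?tri (F x)" for x
  proof -
    obtain x1 x2 where x: "x1 \<in> H1" "x2 \<in> H2" "x = x1 + x2" by (rule split)
    note t0 = triangle_eq[OF closed_csubspaceD(2)[OF H1], simplified]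
    have "?tri (T x) = D (Q x2)"
      unfolding x(3) T_eq[OF x(1,2)]
      by (rule triangle_eq[OF closed_csubspaceD(3)[OF H1 V_in[OF x(1)] E_in[OF x(2)]] Q_in[OF x(2)]])
    moreover have F: "?tri (F x) = D (Q x2)"
      unfolding F_def x(3) p_eq[OF x(1,2)] by (rule t0[OF Q_in[OF x(2)]])
    ultimately show "?tri (T x) = ?tri (F x)" by simp
    have "F (?tri x) = Q (D x2)"
      unfolding F_def x(3) triangle_eq[OF x(1,2)]
      using p_eq[OF closed_csubspaceD(2)[OF H1] D_in[OF x(2)]] by simp
    then show "F (?tri x) = ?tri (F x)" using F QD[OF x(2)] by simp
  qed
  have FW: "F (W x) = W (F x)" for x
    unfolding W_def by (rule sqrt_on_commute[OF U tri_pos F_b F_tri UNIV_I])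
  have "?tri (T x) = W (T (W x))" for x
  proof -
    let ?y = "W x"
    have y: "?y \<in> H2" by (rule W_in)
    have "T (0 + ?y) = E ?y + Q ?y"
      unfolding T_eq[OF closed_csubspaceD(2)[OF H1] y]
      by (simp add: bounded_op_linear(1)[OF ops(2) H1])
    then have "W (T ?y) = W (E ?y) + W (Q ?y)"
      by (simp add: bounded_opD(2)[OF selfadjoint_onD(1)[OF W_sa]])
    also have "Q ?y = F ?y" unfolding F_def using p_eq[OF closed_csubspaceD(2)[OF H1] y] by simp
    also have "W (E ?y) = 0" by (rule W_H1[OF E_in[OF y]])
    also have "0 + W (F ?y) = F (?tri x)" by (simp add: WW flip: FW)
    also have "\<dots> = ?tri (T x)" by (simp add: F_tri tri_T)
    finally show ?thesis by simp
  qed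
  then show ?thesis
    using ops(1) tri_pos by (simp add: triangle_regular_on_def W_def)
qed

section \<open>The equivalent conditions, each reduced to one operator identity on the second
  summand\<close>

private lemma quasi_brownian_iff: "quasi_brownian_isometry_on UNIV T \<longleftrightarrow> two_isometry_on UNIV T"
  using triangle_regular_if two_isometry_iff by (auto simp: quasi_brownian_isometry_on_def)

private lemma operator_identity_iff:
  "(\<forall>x\<in>H2. let R = (\<lambda>y. abs_on H2 Q (abs_on H2 Q y)); S = (\<lambda>y. abs_on H2 E (abs_on H2 E y))
      in R (R x + S x - x) - (R x + S x - x) = 0) \<longleftrightarrow> (\<forall>x\<in>H2. R (D x) - D x = 0)"
  by (rule ball_cong[OF refl]) (simp add: Let_def A_sq B_sq D_in flip: D_def)

private lemma taylor_iff:
  "taylor_spectrum H2 (abs_on H2 Q) (abs_on H2 E) \<subseteq>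
      (\<lambda>(s, t). (complex_of_real s, complex_of_real t)) ` (T_plus \<union> {1} \<times> {0..}) \<longleftrightarrow>
    (\<forall>x\<in>H2. R (D x) - D x = 0)"
proof -
  have "D x = abs_on H2 Q (abs_on H2 Q x) + abs_on H2 E (abs_on H2 E x) - x" if "x \<in> H2" for x
    using that by (simp add: D_def A_sq B_sq)
  from taylor_spectrum_subset_iff[OF H2 A_pos B_pos AB this]
  show ?thesis by (simp add: A_sq D_in)
qed

text \<open>On the isometric summand \<open>R\<close> is the identity, and on the spherical one
  \<open>D\<close> vanishes. Since \<open>R\<close> and \<open>D\<close> commute, their combination
  \<open>(R - I) D\<close> is zero on both.\<close>

private lemma decomp_imp:
  assumes "isometry_spherical_decomp H2 Q (abs_on H2 E) Hi Hsi" and x: "x \<in> H2"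
  shows "R (D x) - D x = 0"
proof -
  note B_sa = positive_opD(1)[OF H2 B_pos]
  have i: "orth_decomp H2 Hi Hsi" "reduces H2 Hi Q" "reduces H2 Hsi Q" "reduces H2 Hsi (abs_on H2 E)"
    "isometry_on Hi Q" "spherical_isometry_on Hsi Q (abs_on H2 E)"
    using assms(1) by (auto simp: isometry_spherical_decomp_def)
  obtain u v where uv: "u \<in> Hi" "v \<in> Hsi" "x = u + v" using i(1) x unfolding orth_decomp_def by blast
  have sub: "Hi \<subseteq> H2" "Hsi \<subseteq> H2" "Q ` Hi \<subseteq> Hi" "Q ` Hsi \<subseteq> Hsi" "abs_on H2 E ` Hsi \<subseteq> Hsi"
    using i by (auto simp: reduces_def)
  have uS: "u \<in> H2" "v \<in> H2" "Q u \<in> Hi" "Q v \<in> Hsi" "abs_on H2 E v \<in> Hsi" using uv sub by auto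
  have Ru: "R u = u"
    using adj_on_reduces[OF H2 ops(4) i(2) uS(3)] i(5) uv(1) by (simp add: R_def isometry_on_def)
  have "adj_on Hsi (abs_on H2 E) (abs_on H2 E v) = EE v"
    using adj_on_reduces[OF H2 B_b i(4) uS(5)] adj_on_selfadjoint[OF H2 B_sa B_in[OF uS(2)]] B_sq[OF uS(2)]
    by simp
  moreover have "adj_on Hsi Q (Q v) = R v"
    using adj_on_reduces[OF H2 ops(4) i(3) uS(4)] by (simp add: R_def)
  moreover have "adj_on Hsi Q (Q v) + adj_on Hsi (abs_on H2 E) (abs_on H2 E v) = v"
    using i(6) uv(2) by (simp add: spherical_isometry_on_def)
  ultimately have "D v = 0" by (simp add: D_def)
  then have "D x = D u" using D_lin(1)[OF uS(1,2)] uv(3) by simp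
  then show ?thesis using RD[OF uS(1)] Ru by simp
qed

private lemma decomp_exists:
  assumes zero: "\<And>x. x \<in> H2 \<Longrightarrow> R (D x) - D x = 0"
  shows "\<exists>Hi Hsi. isometry_spherical_decomp H2 Q (abs_on H2 E) Hi Hsi"
proof -
  let ?B = "abs_on H2 E"
  note B_sa = positive_opD(1)[OF H2 B_pos]
  define Hi where "Hi = {x \<in> H2. R x - x = 0}"
  define Hsi where "Hsi = orth_minus H2 Hi"
  have "selfadjoint_on H2 (\<lambda>x. R x - x)" by (intro selfadjoint_on_diff selfadjoint_on_id H2 R_sa)
  then have Hi: "closed_csubspace Hi" unfolding Hi_def by (rule selfadjoint_on_kernel[OF H2])
  have Hi_sub: "Hi \<subseteq> H2" by (auto simp: Hi_def)
  \<comment> \<open>Whatever commutes with \<open>R\<close> preserves this eigenspace;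
    \<open>Q\<close> and its adjoint are both treated in order to obtain a reducing
    subspace.\<close>
  have inv: "C ` Hi \<subseteq> Hi" if "\<And>x. x \<in> H2 \<Longrightarrow> C x \<in> H2" "\<And>x. x \<in> H2 \<Longrightarrow> C (R x) = R (C x)" for C
  proof
    fix y assume "y \<in> C ` Hi"
    then obtain x where x: "y = C x" "x \<in> H2" "R x = x" by (auto simp: Hi_def)
    then show "y \<in> Hi" using that(1)[OF x(2)] that(2)[OF x(2)] by (simp add: Hi_def)
  qed
  have inv_Q: "Q ` Hi \<subseteq> Hi" by (rule inv[of Q]) (simp_all add: Q_in QR)
  have inv_Q': "adj_on H2 Q ` Hi \<subseteq> Hi" by (rule inv[of "adj_on H2 Q"]) (simp_all add: Q'_in Q'R)
  have inv_B: "?B ` Hi \<subseteq> Hi" by (rule inv[of ?B]) (simp_all add: B_in RB)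
  have redQ: "reduces H2 Hi Q"
    by (rule reducesI[OF Hi Hi_sub Q_in cinner_adj_on[OF H2 ops(4)] inv_Q inv_Q'])
  have redB: "reduces H2 Hi ?B"
    by (rule reducesI[OF Hi Hi_sub B_in selfadjoint_onD(2)[OF B_sa] inv_B inv_B])
  have redQ': "reduces H2 Hsi Q" and redB': "reduces H2 Hsi ?B"
    unfolding Hsi_def by (rule reduces_orth_minus[OF H2 redQ], rule reduces_orth_minus[OF H2 redB])
  have "isometry_on Hi Q"
    unfolding isometry_on_def
  proof (intro conjI ballI)
    have QHi: "Q ` Hi \<subseteq> Hi" using redQ by (simp add: reduces_def)
    show "bounded_op Hi Hi Q" by (rule bounded_op_subset[OF ops(4) Hi_sub QHi])
    show "adj_on Hi Q (Q x) = x" if "x \<in> Hi" for x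
    proof -
      have "Q x \<in> Hi" using QHi that by blast
      then have "adj_on Hi Q (Q x) = R x" using adj_on_reduces[OF H2 ops(4) redQ] by (simp add: R_def)
      then show ?thesis using that by (simp add: Hi_def)
    qed
  qed
  moreover have "spherical_isometry_on Hsi Q ?B"
    unfolding spherical_isometry_on_def
  proof (intro conjI ballI)
    have sub: "Hsi \<subseteq> H2" "Q ` Hsi \<subseteq> Hsi" "?B ` Hsi \<subseteq> Hsi"
      using redQ' redB' by (auto simp: reduces_def)
    show "bounded_op Hsi Hsi Q" "bounded_op Hsi Hsi ?B"
      by (rule bounded_op_subset[OF ops(4) sub(1,2)], rule bounded_op_subset[OF B_b sub(1,3)])
    fix x assume x: "x \<in> Hsi"
    then have xS: "x \<in> H2" using sub by blast
    show "Q (?B x) = ?B (Q x)" by (rule QB[OF xS])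
    \<comment> \<open>The hypothesis says that \<open>D\<close> maps into the eigenspace
      \<open>Hi\<close>. For \<open>x\<close> orthogonal to \<open>Hi\<close>, selfadjointness then
      turns the squared norm of \<open>D x\<close> into the inner product of \<open>x\<close> with a
      vector of \<open>Hi\<close>, so \<open>D x = 0\<close>.\<close>
    have Hi_mem: "D y \<in> Hi" if "y \<in> H2" for y using zero[OF that] D_in[OF that] by (simp add: Hi_def)
    have "cinner (D x) (D x) = cinner x (D (D x))" by (rule selfadjoint_onD(2)[OF D_sa xS D_in[OF xS]])
    also have "\<dots> = 0" using x Hi_mem[OF D_in[OF xS]] by (simp add: Hsi_def orth_minus_def)
    finally have "R x + EE x = x" by (simp add: D_def)
    moreover have "Q x \<in> Hsi" "?B x \<in> Hsi" using sub x by auto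
    ultimately show "adj_on Hsi Q (Q x) + adj_on Hsi ?B (?B x) = x"
      using adj_on_reduces[OF H2 ops(4) redQ', of "Q x"] adj_on_reduces[OF H2 B_b redB', of "?B x"]
        adj_on_selfadjoint[OF H2 B_sa B_in[OF xS]] B_sq[OF xS]
      by (simp add: R_def)
  qed
  moreover have "orth_decomp H2 Hi Hsi" unfolding Hsi_def by (rule orth_decomp_orth_minus[OF H2 Hi Hi_sub])
  ultimately have "isometry_spherical_decomp H2 Q ?B Hi Hsi"
    using redQ redB redQ' redB' by (simp add: isometry_spherical_decomp_def)
  then show ?thesis by blast
qed

lemma class_Q_two_isometry_characterizations:
  "quasi_brownian_isometry_on UNIV T \<longleftrightarrow> two_isometry_on UNIV T"
  "two_isometry_on UNIV T \<longleftrightarrow>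
    (\<forall>x\<in>H2. let R = (\<lambda>y. abs_on H2 Q (abs_on H2 Q y)); S = (\<lambda>y. abs_on H2 E (abs_on H2 E y))
      in R (R x + S x - x) - (R x + S x - x) = 0)"
  "two_isometry_on UNIV T \<longleftrightarrow> taylor_spectrum H2 (abs_on H2 Q) (abs_on H2 E) \<subseteq>
    (\<lambda>(s, t). (complex_of_real s, complex_of_real t)) ` (T_plus \<union> {1} \<times> {0..})"
  "two_isometry_on UNIV T \<longleftrightarrow> (\<exists>Hi Hsi. isometry_spherical_decomp H2 Q (abs_on H2 E) Hi Hsi)"
  using quasi_brownian_iff operator_identity_iff taylor_iff two_isometry_iff decomp_imp decomp_exists
  by blast+

lemma class_Q_wold_decomposition:
  assumes "isometry_spherical_decomp H2 Q (abs_on H2 E) Hi Hsi"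
  shows "reduces H2 (wold_unitary_part Hi Q) Q" "reduces H2 (wold_unitary_part Hi Q) (abs_on H2 E)"
    "reduces H2 (wold_shift_part Hi Q) Q" "reduces H2 (wold_shift_part Hi Q) (abs_on H2 E)"
    "unitary_on (wold_unitary_part Hi Q) Q" "unilateral_shift_on (wold_shift_part Hi Q) Q"
proof -
  have i: "reduces H2 Hi Q" "reduces H2 Hi (abs_on H2 E)" "isometry_on Hi Q"
    using assms by (auto simp: isometry_spherical_decomp_def)
  note w = wold_decomposition_reduces[OF H2 ops(4) positive_opD(1)[OF H2 B_pos] QB i]
  show "reduces H2 (wold_unitary_part Hi Q) Q" "reduces H2 (wold_unitary_part Hi Q) (abs_on H2 E)"
    "reduces H2 (wold_shift_part Hi Q) Q" "reduces H2 (wold_shift_part Hi Q) (abs_on H2 E)"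
    "unitary_on (wold_unitary_part Hi Q) Q" "unilateral_shift_on (wold_shift_part Hi Q) Q"
    by (rule w, assumption)+
qed

end

theorem theorem7p1:
  fixes H1 H2 :: "'h::complex_hilbert set"
    and T V E Q :: "'h \<Rightarrow> 'h"
  assumes "orth_decomp UNIV H1 H2" and "H1 \<noteq> {0}" and "H2 \<noteq> {0}"
    and "class_Q H1 H2 T V E Q"
  shows
    "(quasi_brownian_isometry_on UNIV T \<longleftrightarrow> two_isometry_on UNIV T) \<and>
     (two_isometry_on UNIV T \<longleftrightarrow>
        (\<forall>x\<in>H2. let R = (\<lambda>y. abs_on H2 Q (abs_on H2 Q y));
                    S = (\<lambda>y. abs_on H2 E (abs_on H2 E y))
                in R (R x + S x - x) - (R x + S x - x) = 0)) \<and>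
     (two_isometry_on UNIV T \<longleftrightarrow>
        taylor_spectrum H2 (abs_on H2 Q) (abs_on H2 E) \<subseteq>
          (\<lambda>(s, t). (complex_of_real s, complex_of_real t)) ` (T_plus \<union> {1} \<times> {0..})) \<and>
     (two_isometry_on UNIV T \<longleftrightarrow>
        (\<exists>Hi Hsi. isometry_spherical_decomp H2 Q (abs_on H2 E) Hi Hsi)) \<and>
     (\<forall>Hi Hsi Hu Hs.
        isometry_spherical_decomp H2 Q (abs_on H2 E) Hi Hsi \<and>
        Hu = wold_unitary_part Hi Q \<and> Hs = wold_shift_part Hi Q \<longrightarrow>
        reduces H2 Hu Q \<and> reduces H2 Hu (abs_on H2 E) \<and>
        reduces H2 Hs Q \<and> reduces H2 Hs (abs_on H2 E) \<and>
        unitary_on Hu Q \<and> unilateral_shift_on Hs Q)"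
  using class_Q_two_isometry_characterizations[OF assms(1,4)]
    class_Q_wold_decomposition[OF assms(1,4)] by blast

end
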